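(* Let $G$ be an $\{\mathrm{ISK}_4, \text{diamond}, \text{bowtie}, \text{prism}, K_{3,3}\}$-free graph, and let $W=(C,x)$ be a proper wheel in $G$ with center $x$ having the minimum number of spokes among all proper wheels in $G$ with center $x$. Let $P=p_1\cdots p_k$ be a path with $V(P)\subseteq V(G)\setminus V(W)$ such that $x$ has at most one neighbor in $V(P)$. Then: (i) if $P$ contains no neighbor of $x$, there is a sector $S$ of $W$ such that every edge from $V(P)$ to $V(C)$ has an end in $V(S)$; (ii) if $P$ contains exactly one neighbor of $x$, there are two sectors $S_1,S_2$ of $W$ (possibly $S_1=S_2$) with $V(S_1)\cap V(S_2)\neq\emptyset$ such that every edge from $V(P)$ to $V(C)$ has an end in $V(S_1)\cup V(S_2)$.
   Context: "$H$-free" means no induced subgraph isomorphic to $H$; $\mathrm{ISK}_4$-free means no induced subdivision of $K_4$. Diamond: $K_4$ minus an edge. Bowtie: two triangles sharing one vertex. Prism: three vertex-disjoint paths $a_i\ldots b_i$ ($i=1,2,3$) of length $\ge1$ with $a_1a_2a_3$ and $b_1b_2b_3$ triangles and no other edges between the paths. A hole is an induced cycle of length at least four. A wheel $W=(C,x)$ (center $x$) consists of a hole $C$ and a vertex $x\notin V(C)$ with at least three neighbors in $V(C)$; $V(W)=V(C)\cup\{x\}$; spokes are the neighbors of $x$ in $C$; a sector is a subpath of $C$ whose ends are spokes and whose interior contains no spoke. A vertex $v$ is proper for $W$ if $v\in V(W)$, or all neighbors of $v$ in $V(C)$ lie in one sector and, if $v$ has more than two neighbors in $V(C)$, then $vx\in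 E(G)$. $W$ is proper in $G$ if every vertex of $G$ is proper for $W$. *)

theory Defs
  imports "Graph_Theory.Graph_Theory"
begin

text \<open>
  A finite simple graph is a \<^locale>\<open>pair_graph\<close>: an undirected edge \<open>uv\<close> is the pair of arcs
  \<open>(u,v)\<close>, \<open>(v,u)\<close>, and adjacency in \<open>G\<close> is \<open>u \<rightarrow>\<^bsub>G\<^esub> v\<close>. Paths are lists of vertices
  (\<^const>\<open>vpath\<close>) and, as usual for paths in a graph, they need not be induced.
\<close>

definition undirected :: "('a \<times> 'a) set \<Rightarrow> ('a \<times> 'a) set" where
  "undirected E = E \<union> converse E"

text \<open>
  A forbidden graph is given as an isomorphism-closed predicate, in the manner of
  \<^const>\<open>complete_digraph\<close> and \<^const>\<open>complete_bipartite_digraph\<close>, so that having an induced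
  subgraph with the property is the same as having one isomorphic to the forbidden graph.
\<close>

definition free_of :: "('a pair_pre_digraph \<Rightarrow> bool) \<Rightarrow> 'a pair_pre_digraph \<Rightarrow> bool" where
  "free_of Q G \<longleftrightarrow> \<not> (\<exists>H. induced_subgraph (with_proj H) (with_proj G) \<and> Q H)"

definition K4_subdivision :: "'a pair_pre_digraph \<Rightarrow> bool" where
  "K4_subdivision H \<longleftrightarrow> (\<exists>K. K\<^bsub>4\<^esub> (with_proj K) \<and> subdivision_pair K H)"

definition K33 :: "'a pair_pre_digraph \<Rightarrow> bool" where
  "K33 H \<longleftrightarrow> K\<^bsub>3,3\<^esub> (with_proj H)"

definition diamond :: "'a pair_pre_digraph \<Rightarrow> bool" where
  "diamond H \<longleftrightarrow> (\<exists>K u v. K\<^bsub>4\<^esub> (with_proj K) \<and> (u, v) \<in> parcs K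
     \<and> pverts H = pverts K \<and> parcs H = parcs K - {(u, v), (v, u)})"

definition bowtie :: "'a pair_pre_digraph \<Rightarrow> bool" where
  "bowtie H \<longleftrightarrow> (\<exists>v a b c d. distinct [v, a, b, c, d]
     \<and> pverts H = {v, a, b, c, d}
     \<and> parcs H = undirected {(v, a), (a, b), (b, v), (v, c), (c, d), (d, v)})"

definition prism :: "'a pair_pre_digraph \<Rightarrow> bool" where
  "prism H \<longleftrightarrow> (\<exists>p q r. distinct (p @ q @ r)
     \<and> vwalk_length p \<ge> 1 \<and> vwalk_length q \<ge> 1 \<and> vwalk_length r \<ge> 1
     \<and> pverts H = set p \<union> set q \<union> set r
     \<and> parcs H = undirected
         (set (vwalk_arcs p) \<union> set (vwalk_arcs q) \<union> set (vwalk_arcs r)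
          \<union> {(hd p, hd q), (hd q, hd r), (hd r, hd p)}
          \<union> {(last p, last q), (last q, last r), (last r, last p)}))"

definition cycle_graph :: "'a pair_pre_digraph \<Rightarrow> bool" where
  "cycle_graph C \<longleftrightarrow> (\<exists>cs. distinct cs \<and> length cs \<ge> 3 \<and> pverts C = set cs
     \<and> parcs C = undirected (set (vwalk_arcs (cs @ [hd cs]))))"

definition hole :: "'a pair_pre_digraph \<Rightarrow> 'a pair_pre_digraph \<Rightarrow> bool" where
  "hole G C \<longleftrightarrow> induced_subgraph (with_proj C) (with_proj G) \<and> cycle_graph C \<and> card (pverts C) \<ge> 4"

definition nbrs_in :: "'a pair_pre_digraph \<Rightarrow> 'a \<Rightarrow> 'a set \<Rightarrow> 'a set" where
  "nbrs_in G v A = {u \<in> A. v \<rightarrow>\<^bsub>with_proj G\<^esub> u}"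

definition wheel :: "'a pair_pre_digraph \<Rightarrow> 'a pair_pre_digraph \<Rightarrow> 'a \<Rightarrow> bool" where
  "wheel G C x \<longleftrightarrow> hole G C \<and> x \<in> pverts G \<and> x \<notin> pverts C \<and> card (nbrs_in G x (pverts C)) \<ge> 3"

definition wheel_verts :: "'a pair_pre_digraph \<Rightarrow> 'a \<Rightarrow> 'a set" where
  "wheel_verts C x = pverts C \<union> {x}"

definition spokes :: "'a pair_pre_digraph \<Rightarrow> 'a pair_pre_digraph \<Rightarrow> 'a \<Rightarrow> 'a set" where
  "spokes G C x = nbrs_in G x (pverts C)"

text \<open>The two ends of a sector are distinct, i.e. the one-vertex subpaths are not counted.\<close>

definition sector :: "'a pair_pre_digraph \<Rightarrow> 'a pair_pre_digraph \<Rightarrow> 'a \<Rightarrow> 'a list \<Rightarrow> bool" where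
  "sector G C x s \<longleftrightarrow> vpath s (with_proj C) \<and> vwalk_length s \<ge> 1
     \<and> hd s \<in> spokes G C x \<and> last s \<in> spokes G C x
     \<and> set (butlast (tl s)) \<inter> spokes G C x = {}"

definition proper_for :: "'a pair_pre_digraph \<Rightarrow> 'a pair_pre_digraph \<Rightarrow> 'a \<Rightarrow> 'a \<Rightarrow> bool" where
  "proper_for G C x v \<longleftrightarrow> v \<in> wheel_verts C x \<or>
     (\<exists>s. sector G C x s \<and> nbrs_in G v (pverts C) \<subseteq> set s) \<and>
     (card (nbrs_in G v (pverts C)) > 2 \<longrightarrow> v \<rightarrow>\<^bsub>with_proj G\<^esub> x)"

definition proper_wheel :: "'a pair_pre_digraph \<Rightarrow> 'a pair_pre_digraph \<Rightarrow> 'a \<Rightarrow> bool" where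
  "proper_wheel G C x \<longleftrightarrow> wheel G C x \<and> (\<forall>v \<in> pverts G. proper_for G C x v)"

end

theory Submission
  imports Defs
begin

text \<open>
  The heart of the proof is that rerouting part of the rim \<open>C\<close> never produces a wheel with centre \<open>x\<close>
  and fewer spokes. Consider the cycles with at least three and fewer spokes than \<open>C\<close> that consist of
  an arc of \<open>C\<close> and a path \<open>Q\<close> with at most one spoke besides its ends. Choose one with fewest spokes
  and, subject to that, shortest. By minimality of \<open>W\<close> some vertex \<open>v\<close> is not proper for it. Rerouting
  through \<open>v\<close> between two consecutive neighbours of \<open>v\<close> stays in the family, so every such stretch
  contains at most one spoke if \<open>v\<close> is adjacent to \<open>x\<close>, and at most two otherwise. Not all stretches
  contain at most one spoke: \<open>v\<close> would have neighbours inside two consecutive sectors of \<open>C\<close>, although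
  \<open>W\<close> is proper. A stretch with exactly two spokes yields an induced subdivision of \<open>K\<^sub>4\<close>.

  Now let \<open>P\<close> be a path off_wheel the wheel, and consider two attachments of \<open>P\<close> that are consecutive on
  \<open>C\<close>. Together with a shortest connection in \<open>P\<close> the arc between them is a cycle of the family, so
  it contains few spokes or almost all of them. For a shortest path without neighbours of \<open>x\<close> that
  attaches to two different sectors this leaves only wheels with four spokes, where a prism or a
  subdivision of \<open>K\<^sub>4\<close> appears. For a path with one neighbour of \<open>x\<close>, that vertex and the two parts of
  the path attach to one sector each, while there are at least four sectors; the stretch around a
  sector that is missed contains all but at most one of the spokes.
\<close>

section \<open>Cyclic lists, induced paths and induced cycles\<close>

text \<open>Minimality of \<open>W\<close> only speaks about proper wheels, so a rim with fewer
  spokes is no contradiction by itself. This is why a family closed under further rerouting and an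
  extremal choice inside it are needed: they take the place of properness of the new wheel. The
  number four governs the counting. Three neighbours on an induced cycle already give a subdivision
  of K4, so every wheel has at least four spokes, and a vertex with more than two neighbours on an
  induced cycle has at least four. Four spokes also give a Helly property: rim vertices that
  pairwise share a sector all share one. (With three spokes, the spokes themselves would be a
  counterexample.) It reduces (i) to two attachments at a time, and for a shortest path joining two
  attachments without a common sector it confines the attachments to the two ends. \<open>P\<close>
  need not be induced. Connections are therefore extracted from walks, and in (ii) the two parts of
  \<open>P\<close> may be joined by an edge that bypasses the neighbour of \<open>x\<close>.\<close>

definition rot :: "'a list \<Rightarrow> 'a list \<Rightarrow> bool" where
  "rot xs ys \<longleftrightarrow> (\<exists>u v. xs = u @ v \<and> ys = v @ u)"

lemma rotI: "rot (u @ v) (v @ u)"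
  by (auto simp: rot_def)

lemma rot_refl [simp]: "rot xs xs"
  by (auto simp: rot_def)

lemma rot_sym: "rot xs ys \<Longrightarrow> rot ys xs"
  by (auto simp: rot_def)

lemma rot_trans:
  assumes "rot xs ys" "rot ys zs" shows "rot xs zs"
proof -
  from assms obtain u v u' v' where eq: "xs = u @ v" "ys = v @ u" "ys = u' @ v'" "zs = v' @ u'"
    by (auto simp: rot_def)
  then have "v @ u = u' @ v'" by simp
  then consider w where "v = u' @ w" "v' = w @ u" | w where "u' = v @ w" "u = w @ v'"
    by (auto simp: append_eq_append_conv2)
  then show ?thesis
  proof cases
    case 1
    then have "xs = (u @ u') @ w" "zs = w @ (u @ u')" using eq by auto
    then show ?thesis unfolding rot_def by blast
  next
    case 2
    then have "xs = w @ (v' @ v)" "zs = (v' @ v) @ w" using eq by auto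
    then show ?thesis unfolding rot_def by blast
  qed
qed

lemma rot_set: "rot xs ys \<Longrightarrow> set xs = set ys"
  and rot_distinct: "rot xs ys \<Longrightarrow> distinct xs = distinct ys"
  and rot_length: "rot xs ys \<Longrightarrow> length xs = length ys"
  and rot_filter: "rot xs ys \<Longrightarrow> length (filter p xs) = length (filter p ys)"
  by (auto simp: rot_def)

lemma rot_rev: "rot xs ys \<Longrightarrow> rot (rev xs) (rev ys)"
  unfolding rot_def by (elim exE conjE) (metis rev_append)

lemma rot_start:
  assumes "c \<in> set xs" obtains ys where "rot xs (c # ys)"
  using split_list[OF assms] that rotI append_Cons by metis

lemma butlast_tl_rev: "butlast (tl (rev xs)) = rev (butlast (tl xs))"
  by (cases xs; cases "tl xs" rule: rev_cases) auto

lemma length_filter_eq_card: "distinct xs \<Longrightarrow> length (filter p xs) = card {a \<in> set xs. p a}"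
  by (metis distinct_card distinct_filter set_filter)

text \<open>Each end of the arc is pushed outwards, if necessary, until it satisfies
  \<open>p\<close>; two hits on the cyclic list keep the two ends distinct. The same extension
  serves for sectors (\<open>p\<close> is adjacency to the centre), for stretches between
  consecutive neighbours of a vertex, and for gaps between consecutive attachments of a
  path.\<close>

lemma extend_arc:
  assumes rt: "rot cs (xs @ ys)" and ne: "xs \<noteq> []"
    and int: "\<forall>c \<in> set (butlast (tl xs)). \<not> p c"
    and two: "2 \<le> length (filter p cs)"
  obtains a M b R L1 L2 where "rot cs (a # M @ b # R)" "p a" "p b" "\<forall>c \<in> set M. \<not> p c"
    "a # M @ [b] = L1 @ xs @ L2"
proof -
  have cnt: "2 \<le> length (filter p (xs @ ys))" using rot_filter[OF rt, of p] two by linarith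
  have first: "\<exists>u c w. zs = u @ c # w \<and> p c \<and> (\<forall>d\<in>set u. \<not> p d)"
    if "length (filter p zs) \<ge> 1" for zs
    using that split_list_first_prop[of zs p] by (auto simp: Suc_le_eq filter_empty_conv)
  have last: "\<exists>u c w. zs = u @ c # w \<and> p c \<and> (\<forall>d\<in>set w. \<not> p d)"
    if "length (filter p zs) \<ge> 1" for zs
    using that split_list_last_prop[of zs p] by (auto simp: Suc_le_eq filter_empty_conv)
  note goal = that
  have fin: thesis if "ys = L2 @ Y @ L1" "L1 @ xs @ L2 = a # M @ [b]" "p a" "p b" "\<forall>c \<in> set M. \<not> p c"
    for L1 L2 Y a M b
  proof -
    have "rot (xs @ ys) ((L1 @ xs @ L2) @ Y)"
      unfolding that(1) using rotI[of "xs @ L2 @ Y" L1] by simp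
    then have "rot cs (a # M @ b # Y)" using rot_trans[OF rt] unfolding that(2) by simp
    then show thesis using that(2-) goal by metis
  qed
  have none: thesis if all: "\<forall>c \<in> set xs. \<not> p c"
  proof -
    have "length (filter p ys) \<ge> 2" using cnt all by simp
    then obtain u c w where ys: "ys = u @ c # w" "p c" "\<forall>d\<in>set u. \<not> p d"
      using first[of ys] by auto
    with \<open>length (filter p ys) \<ge> 2\<close> have "length (filter p w) \<ge> 1" by simp
    then obtain u' c' w' where w: "w = u' @ c' # w'" "p c'" "\<forall>d\<in>set w'. \<not> p d"
      using last by blast
    show thesis using ys w all by (intro fin[of "u @ [c]" u' "c' # w'" c' "w' @ xs @ u" c]) auto
  qed
  have start: thesis if xs: "xs = h # t" "p h" "\<forall>c \<in> set t. \<not> p c" for h t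
  proof -
    have "length (filter p ys) \<ge> 1" using cnt xs by simp
    then obtain u c w where "ys = u @ c # w" "p c" "\<forall>d\<in>set u. \<not> p d"
      using first by blast
    then show thesis using xs by (intro fin[of "u @ [c]" w "[]" h "t @ u" c]) auto
  qed
  consider h where "xs = [h]" | h m l where "xs = h # m @ [l]"
    using ne by (metis list.exhaust rev_exhaust)
  then show thesis
  proof cases
    case 1
    then show thesis using none start[of h "[]"] by (cases "p h") auto
  next
    case 2
    then have m: "\<forall>c \<in> set m. \<not> p c" using int by simp
    show thesis
    proof (cases "p h")
      case True
      then show thesis using 2 m start[of h "m @ [l]"] fin[of "[]" ys "[]" h m l] by (cases "p l") auto
    next
      case nh: False
      show thesis
      proof (cases "p l")
        case True
        have "length (filter p ys) \<ge> 1" using cnt 2 nh m True by simp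
        then obtain u c w where "ys = u @ c # w" "p c" "\<forall>d\<in>set w. \<not> p d"
          using last by blast
        then show thesis using 2 nh m True by (intro fin[of "[]" u "c # w" c "w @ h # m" l]) auto
      next
        case False
        then show thesis using 2 nh m none by auto
      qed
    qed
  qed
qed

locale sgraph =
  fixes adj :: "'a \<Rightarrow> 'a \<Rightarrow> bool"
  assumes adj_sym: "adj a b \<Longrightarrow> adj b a" and adj_irrefl [simp]: "\<not> adj a a"
begin

lemma adj_commute: "adj a b = adj b a"
  using adj_sym by blast

fun ipath :: "'a list \<Rightarrow> bool" where
  "ipath [] = True"
| "ipath (a # xs) = (ipath xs \<and> a \<notin> set xs \<and> (\<forall>b \<in> set xs. adj a b \<longleftrightarrow> b = hd xs))"

text \<open>Triangles count as cycles, so rerouting need not watch the length. That a new rim is a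
  hole follows afterwards from its having at least four spokes.\<close>

definition icyc :: "'a list \<Rightarrow> bool" where
  "icyc cs \<longleftrightarrow> (\<exists>a p. cs = a # p \<and> length p \<ge> 2 \<and> ipath p \<and> a \<notin> set p \<and>
     (\<forall>b \<in> set p. adj a b \<longleftrightarrow> b = hd p \<or> b = last p))"

lemma ipath_distinct: "ipath xs \<Longrightarrow> distinct xs"
  by (induction xs) auto

lemma ipath_append:
  assumes "xs \<noteq> []" "ys \<noteq> []"
  shows "ipath (xs @ ys) \<longleftrightarrow> ipath xs \<and> ipath ys \<and> set xs \<inter> set ys = {} \<and>
    (\<forall>a \<in> set xs. \<forall>b \<in> set ys. adj a b \<longleftrightarrow> a = last xs \<and> b = hd ys)"
  using assms(1)
proof (induction xs)
  case (Cons a xs)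
  show ?case
  proof (cases "xs = []")
    case True
    then show ?thesis using assms(2) by auto
  next
    case False
    then have h: "hd xs \<in> set xs" "last xs \<in> set xs" by auto
    define P where "P \<longleftrightarrow> (\<forall>c \<in> set xs. \<forall>b \<in> set ys. adj c b \<longleftrightarrow> c = last xs \<and> b = hd ys)"
    have 1: "ipath ((a # xs) @ ys) \<longleftrightarrow> (ipath xs \<and> ipath ys \<and> set xs \<inter> set ys = {} \<and> P) \<and>
        a \<notin> set xs \<and> a \<notin> set ys \<and> (\<forall>b \<in> set xs. adj a b \<longleftrightarrow> b = hd xs) \<and> (\<forall>b \<in> set ys. adj a b \<longleftrightarrow> b = hd xs)"
      using Cons.IH[OF False] False unfolding P_def[symmetric] by (simp add: ball_Un)
    have 2: "(\<forall>c \<in> set (a # xs). \<forall>b \<in> set ys. adj c b \<longleftrightarrow> c = last (a # xs) \<and> b = hd ys) \<longleftrightarrow>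
        P \<and> (\<forall>b \<in> set ys. adj a b \<longleftrightarrow> a = last xs \<and> b = hd ys)"
      unfolding P_def using False by (simp add: conj_commute)
    have 3: "a \<notin> set xs \<Longrightarrow> set xs \<inter> set ys = {} \<Longrightarrow>
       (\<forall>b \<in> set ys. adj a b \<longleftrightarrow> b = hd xs) \<longleftrightarrow> (\<forall>b \<in> set ys. adj a b \<longleftrightarrow> a = last xs \<and> b = hd ys)"
    proof -
      assume "a \<notin> set xs" "set xs \<inter> set ys = {}"
      then have "hd xs \<notin> set ys" "a \<noteq> last xs" using h by (auto simp: disjoint_iff)
      then have "(\<forall>b \<in> set ys. adj a b \<longleftrightarrow> b = hd xs) \<longleftrightarrow> (\<forall>b \<in> set ys. \<not> adj a b)"
        and "(\<forall>b \<in> set ys. adj a b \<longleftrightarrow> a = last xs \<and> b = hd ys) \<longleftrightarrow> (\<forall>b \<in> set ys. \<not> adj a b)"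
        by (metis, metis)
      then show ?thesis by simp
    qed
    have 4: "set (a # xs) \<inter> set ys = {} \<longleftrightarrow> a \<notin> set ys \<and> set xs \<inter> set ys = {}"
      by simp
    define X Y Z where "X \<longleftrightarrow> (\<forall>b \<in> set ys. adj a b \<longleftrightarrow> b = hd xs)"
      and "Y \<longleftrightarrow> (\<forall>b \<in> set ys. adj a b \<longleftrightarrow> a = last xs \<and> b = hd ys)"
      and "Z \<longleftrightarrow> (\<forall>b \<in> set xs. adj a b \<longleftrightarrow> b = hd xs)"
    show ?thesis unfolding 1 2 4 ipath.simps using 3 unfolding X_def[symmetric] Y_def[symmetric] Z_def[symmetric]
      by blast
  qed
qed auto

lemma ipath_sub: "ipath (xs @ ys @ zs) \<Longrightarrow> ipath ys"
proof -
  assume a: "ipath (xs @ ys @ zs)"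
  have "ipath (ys @ zs)" using a ipath_append[of xs "ys @ zs"] by (cases "xs = []"; cases "ys @ zs = []") auto
  then show ?thesis using ipath_append[of ys zs] by (cases "ys = []"; cases "zs = []") auto
qed

lemma ipath_rev: "ipath (rev xs) = ipath xs"
proof (induction xs)
  case (Cons a xs)
  show ?case
  proof (cases "xs = []")
    case False
    then show ?thesis using Cons ipath_append[of "rev xs" "[a]"] adj_commute
      by (auto simp: last_rev)
  qed auto
qed auto

text \<open>The right-hand side treats the two arcs alike, although \<open>icyc\<close> cuts the
  cycle at a chosen vertex; invariance under rotation is read off from this symmetry.\<close>

lemma icyc_append:
  assumes "xs \<noteq> []" "ys \<noteq> []"
  shows "icyc (xs @ ys) \<longleftrightarrow> length (xs @ ys) \<ge> 3 \<and> ipath xs \<and> ipath ys \<and> set xs \<inter> set ys = {} \<and>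
    (\<forall>a \<in> set xs. \<forall>b \<in> set ys. adj a b \<longleftrightarrow> a = last xs \<and> b = hd ys \<or> a = hd xs \<and> b = last ys)"
proof -
  obtain a xs' where xs: "xs = a # xs'" using assms(1) by (cases xs) auto
  show ?thesis
  proof (cases "xs' = []")
    case True
    then show ?thesis using xs assms by (auto simp: icyc_def)
  next
    case False
    have h: "hd xs' \<in> set xs'" "last xs' \<in> set xs'" "hd ys \<in> set ys" "last ys \<in> set ys"
      using False assms(2) by auto
    have "icyc (xs @ ys) \<longleftrightarrow> length (xs' @ ys) \<ge> 2 \<and> ipath (xs' @ ys) \<and> a \<notin> set (xs' @ ys) \<and>
      (\<forall>b \<in> set (xs' @ ys). adj a b \<longleftrightarrow> b = hd xs' \<or> b = last ys)"
      using xs False assms(2) by (simp add: icyc_def)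
    also have "\<dots> \<longleftrightarrow> length (xs @ ys) \<ge> 3 \<and> ipath xs \<and> ipath ys \<and> set xs \<inter> set ys = {} \<and>
      (\<forall>a \<in> set xs. \<forall>b \<in> set ys. adj a b \<longleftrightarrow> a = last xs \<and> b = hd ys \<or> a = hd xs \<and> b = last ys)"
      (is "?A = ?B")
    proof
      assume A: ?A
      then have f: "ipath xs'" "ipath ys" "set xs' \<inter> set ys = {}" "a \<notin> set xs'" "a \<notin> set ys"
        "\<And>c b. c \<in> set xs' \<Longrightarrow> b \<in> set ys \<Longrightarrow> adj c b \<longleftrightarrow> c = last xs' \<and> b = hd ys"
        "\<And>b. b \<in> set xs' \<union> set ys \<Longrightarrow> adj a b \<longleftrightarrow> b = hd xs' \<or> b = last ys"
        unfolding ipath_append[OF False assms(2)] by simp_all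
      have n: "hd xs' \<notin> set ys" "last ys \<notin> set xs'" "a \<noteq> last xs'" "a \<noteq> hd xs'"
        using f h by (auto simp: disjoint_iff)
      have "adj c b \<longleftrightarrow> c = last xs \<and> b = hd ys \<or> c = hd xs \<and> b = last ys"
        if "c \<in> set xs" "b \<in> set ys" for c b
      proof (cases "c = a")
        case True
        then show ?thesis using xs False n f(7)[of b] that by auto
      next
        case ca: False
        then show ?thesis using xs False f(6)[of c b] that by auto
      qed
      moreover have "ipath xs" unfolding xs using f n by auto
      moreover have "length (xs @ ys) \<ge> 3" using A xs by simp
      moreover have "set xs \<inter> set ys = {}" using xs f by auto
      ultimately show ?B using f by blast
    next
      assume ?B
      then have f: "length (xs @ ys) \<ge> 3" "ipath xs" "ipath ys" "set xs \<inter> set ys = {}"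
        "\<And>c b. c \<in> set xs \<Longrightarrow> b \<in> set ys \<Longrightarrow> adj c b \<longleftrightarrow> c = last xs \<and> b = hd ys \<or> c = hd xs \<and> b = last ys"
        by blast+
      have g: "ipath xs'" "a \<notin> set xs'" "\<And>b. b \<in> set xs' \<Longrightarrow> adj a b \<longleftrightarrow> b = hd xs'"
        using f(2) xs by auto
      have n: "hd xs' \<notin> set ys" "last ys \<notin> set xs'" "a \<noteq> last xs'" "a \<notin> set ys"
        using f(4) g(2) h xs by (auto simp: disjoint_iff)
      have c: "adj c b \<longleftrightarrow> c = last xs' \<and> b = hd ys" if "c \<in> set xs'" "b \<in> set ys" for c b
        using f(5)[of c b] that xs False g(2) by auto
      have d: "adj a b \<longleftrightarrow> b = hd xs' \<or> b = last ys" if "b \<in> set (xs' @ ys)" for b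
      proof (cases "b \<in> set xs'")
        case True
        then show ?thesis using g(3)[of b] n by auto
      next
        case nb: False
        then show ?thesis using f(5)[of a b] that xs False n by auto
      qed
      have "set xs' \<inter> set ys = {}" using f(4) xs by auto
      then have "ipath (xs' @ ys)" unfolding ipath_append[OF False assms(2)] using g f(3) c by blast
      moreover have "length (xs' @ ys) \<ge> 2" using f(1) xs by simp
      ultimately show ?A using d g n by auto
    qed
    finally show ?thesis .
  qed
qed

lemma icyc_rot:
  assumes "rot cs cs'" "icyc cs" shows "icyc cs'"
proof -
  obtain u v where uv: "cs = u @ v" "cs' = v @ u" using assms(1) by (auto simp: rot_def)
  show ?thesis
  proof (cases "u = [] \<or> v = []")
    case True
    then show ?thesis using uv assms by auto
  next
    case False
    then have ne: "u \<noteq> []" "v \<noteq> []" by auto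
    have "\<forall>a \<in> set u. \<forall>b \<in> set v. adj a b \<longleftrightarrow> a = last u \<and> b = hd v \<or> a = hd u \<and> b = last v"
      using assms(2) unfolding uv icyc_append[OF ne] by blast
    then have "\<forall>a \<in> set v. \<forall>b \<in> set u. adj a b \<longleftrightarrow> a = last v \<and> b = hd u \<or> a = hd v \<and> b = last u"
      using adj_commute by metis
    then show ?thesis using assms(2) unfolding uv icyc_append[OF ne] icyc_append[OF ne(2,1)]
      by (simp add: Int_commute)
  qed
qed

lemma icyc_rev:
  assumes "icyc cs" shows "icyc (rev cs)"
proof -
  obtain a p where cs: "cs = a # p" and p: "length p \<ge> 2" "ipath p" "a \<notin> set p"
    "\<forall>b \<in> set p. adj a b \<longleftrightarrow> b = hd p \<or> b = last p" using assms by (auto simp: icyc_def)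
  have "icyc (a # rev p)" unfolding icyc_def using p
    by (intro exI[of _ a] exI[of _ "rev p"]) (auto simp: ipath_rev hd_rev last_rev)
  moreover have "rot (a # rev p) (rev cs)" using cs rotI[of "[a]" "rev p"] by simp
  ultimately show ?thesis using icyc_rot by blast
qed

lemma icyc_distinct: "icyc cs \<Longrightarrow> distinct cs"
  by (auto simp: icyc_def ipath_distinct)

lemma icyc_length: "icyc cs \<Longrightarrow> length cs \<ge> 3"
  by (auto simp: icyc_def)

lemma icyc_arc: "icyc (xs @ ys) \<Longrightarrow> ys \<noteq> [] \<Longrightarrow> ipath xs"
  using icyc_append by (cases "xs = []") auto

text \<open>With \<open>R\<close> nonempty, \<open>a\<close> and \<open>b\<close> are not joined by
  an edge on the far side of the cycle. So the arc between them is an induced path, and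
  \<open>v\<close>, which sees only its ends, closes it.\<close>

lemma icyc_reroute:
  assumes "icyc (a # M @ b # R)" "R \<noteq> []" "v \<notin> set (a # M @ [b])" "adj v a" "adj v b"
    "\<forall>c \<in> set M. \<not> adj v c"
  shows "icyc (v # a # M @ [b])"
proof -
  have "ipath (a # M @ [b])" using icyc_arc[of "a # M @ [b]" R] assms(1,2) by simp
  then show ?thesis unfolding icyc_def using assms by (intro exI[of _ v] exI[of _ "a # M @ [b]"]) auto
qed

text \<open>Counting along a list makes the number additive under concatenation, so that counts can
  be split along arcs and compared by linear arithmetic.\<close>

definition nbs :: "'a \<Rightarrow> 'a list \<Rightarrow> nat" where
  "nbs x l = length (filter (adj x) l)"

lemma nbs_simps [simp]:
  "nbs x [] = 0" "nbs x (a # l) = (if adj x a then 1 else 0) + nbs x l" "nbs x (l @ l') = nbs x l + nbs x l'"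
  "nbs x (rev l) = nbs x l"
  by (auto simp: nbs_def rev_filter[symmetric])

lemma nbs_0: "nbs x l = 0 \<longleftrightarrow> (\<forall>c \<in> set l. \<not> adj x c)"
  by (auto simp: nbs_def filter_empty_conv)

lemma nbs_rot: "rot l l' \<Longrightarrow> nbs x l = nbs x l'"
  by (simp add: nbs_def rot_filter)

lemma nbs_card: "distinct l \<Longrightarrow> nbs x l = card {c \<in> set l. adj x c}"
  by (simp add: nbs_def length_filter_eq_card)

lemma nbs_split_first:
  assumes "nbs x l \<ge> 1" obtains u c w where "l = u @ c # w" "adj x c" "nbs x u = 0" "nbs x l = 1 + nbs x w"
proof -
  have "\<exists>c \<in> set l. adj x c" using assms nbs_0[of x l] by auto
  then obtain u c w where "l = u @ c # w" "adj x c" "\<forall>d\<in>set u. \<not> adj x d"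
    by (metis split_list_first_prop)
  then show thesis using that nbs_0[of x u] by auto
qed

lemma nbs_split_last:
  assumes "nbs x l \<ge> 1" obtains u c w where "l = u @ c # w" "adj x c" "nbs x w = 0" "nbs x l = 1 + nbs x u"
proof -
  have "\<exists>c \<in> set l. adj x c" using assms nbs_0[of x l] by auto
  then obtain u c w where "l = u @ c # w" "adj x c" "\<forall>d\<in>set w. \<not> adj x d"
    by (metis split_list_last_prop)
  then show thesis using that nbs_0[of x w] by auto
qed

lemma nbs_Suc_first:
  assumes "nbs x l = Suc k" obtains u c w where "l = u @ c # w" "adj x c" "nbs x u = 0" "nbs x w = k"
  using assms nbs_split_first[of x l] by (metis Suc_eq_plus1_left add_left_cancel le_add1 plus_1_eq_Suc)

lemma nbs_Suc_last:
  assumes "nbs x l = Suc k" obtains u c w where "l = u @ c # w" "adj x c" "nbs x w = 0" "nbs x u = k"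
  using assms nbs_split_last[of x l] by (metis Suc_eq_plus1_left add_left_cancel le_add1 plus_1_eq_Suc)

text \<open>
  The ends of the arc \<open>xs\<close> need not be neighbours of \<open>x\<close>; if \<open>x\<close> has at least two neighbours on
  \<open>cs\<close>, then \<open>extend_arc\<close> enlarges \<open>xs\<close> to a sector.
\<close>

definition one_sector :: "'a \<Rightarrow> 'a list \<Rightarrow> 'a set \<Rightarrow> bool" where
  "one_sector x cs T \<longleftrightarrow> (\<exists>xs ys. rot cs (xs @ ys) \<and> T \<subseteq> set xs \<and> nbs x (butlast (tl xs)) = 0)"

lemma one_sector_rot: "rot cs cs' \<Longrightarrow> one_sector x cs' T \<Longrightarrow> one_sector x cs T"
  unfolding one_sector_def using rot_trans by blast

lemma one_sector_rev:
  assumes "one_sector x cs T" shows "one_sector x (rev cs) T"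
proof -
  obtain xs ys where 1: "rot cs (xs @ ys)" "T \<subseteq> set xs" "nbs x (butlast (tl xs)) = 0"
    using assms by (auto simp: one_sector_def)
  have "rot (rev cs) (rev ys @ rev xs)" using rot_rev[OF 1(1)] by simp
  then have "rot (rev cs) (rev xs @ rev ys)" using rotI rot_trans by blast
  then show ?thesis unfolding one_sector_def using 1 butlast_tl_rev by (metis nbs_simps(4) set_rev)
qed

lemma one_sector_mono: "one_sector x cs T \<Longrightarrow> T' \<subseteq> T \<Longrightarrow> one_sector x cs T'"
  unfolding one_sector_def by blast

end

section \<open>Forbidden configurations\<close>

text \<open>The segment ends at the later of the first \<open>p\<close>-element and the first
  \<open>q\<close>-element, and it begins at the last element of the other kind up to there. Nothing
  in between is of either kind; the two orders give the two alternatives.\<close>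

lemma shortest_segment:
  assumes "distinct l" "\<exists>c \<in> set l. p c" "\<exists>c \<in> set l. q c"
  obtains u Z w where "l = u @ Z @ w" "Z \<noteq> []"
    "(\<forall>z \<in> set Z. (p z \<longleftrightarrow> z = hd Z) \<and> (q z \<longleftrightarrow> z = last Z)) \<or>
     (\<forall>z \<in> set Z. (q z \<longleftrightarrow> z = hd Z) \<and> (p z \<longleftrightarrow> z = last Z))"
proof -
  have half: "\<exists>u Z w. l = u @ Z @ w \<and> Z \<noteq> [] \<and> (\<forall>z \<in> set Z. (p z \<longleftrightarrow> z = hd Z) \<and> (q z \<longleftrightarrow> z = last Z))"
    if d: "distinct l" and l: "l = s @ e # w" "q e" "\<forall>c \<in> set s. \<not> q c" and ex: "\<exists>c \<in> set (s @ [e]). p c"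
    for p q s e w
  proof (cases "p e")
    case True
    then show ?thesis using l by (intro exI[of _ s] exI[of _ "[e]"] exI[of _ w]) auto
  next
    case False
    then have "\<exists>c \<in> set s. p c" using ex by auto
    then obtain u f t where s: "s = u @ f # t" "p f" "\<forall>c \<in> set t. \<not> p c"
      by (metis split_list_last_prop)
    then show ?thesis using l d False
      by (intro exI[of _ u] exI[of _ "f # t @ [e]"] exI[of _ w]) auto
  qed
  obtain s e w where l: "l = s @ e # w" "q e" "\<forall>c \<in> set s. \<not> q c"
    using assms(3) by (metis split_list_first_prop)
  obtain s' e' w' where l': "l = s' @ e' # w'" "p e'" "\<forall>c \<in> set s'. \<not> p c"
    using assms(2) by (metis split_list_first_prop)
  have "(\<exists>c \<in> set (s @ [e]). p c) \<or> (\<exists>c \<in> set (s' @ [e']). q c)"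
  proof (rule ccontr)
    assume neg: "\<not> ?thesis"
    from l(1) l'(1) have "s @ e # w = s' @ e' # w'" by simp
    then consider z where "s = s' @ z" "z @ e # w = e' # w'" | z where "s' = s @ z" "e # w = z @ e' # w'"
      by (auto simp: append_eq_append_conv2)
    then show False
    proof cases
      case 1
      then have "e' = e \<or> e' \<in> set z" by (cases z) auto
      then show False using neg 1 l' by auto
    next
      case 2
      then have "e = e' \<or> e \<in> set z" by (cases z) auto
      then show False using neg 2 l by auto
    qed
  qed
  then show thesis
  proof
    assume "\<exists>c \<in> set (s @ [e]). p c"
    from half[OF assms(1) l this] show thesis using that by blast
  next
    assume "\<exists>c \<in> set (s' @ [e']). q c"
    from half[OF assms(1) l' this] show thesis using that by blast
  qed
qed

text \<open>
  Every induced subdivision of \<open>K\<^sub>4\<close> that occurs has a branch vertex joined by two single edges to the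
  cycle through the other three branch vertices, and possibly by a longer path \<open>Z\<close> to the third one.
  The diamond and the bowtie need not be induced here, since the missing edges only create a \<open>K\<^sub>4\<close>
  or a diamond.
\<close>

locale forbidden = sgraph +
  assumes no_wheel3: "icyc H \<Longrightarrow> x \<notin> set H \<Longrightarrow> nbs x H \<noteq> 3"
    and no_wheel2_path: "\<lbrakk>icyc H; x \<notin> set H; nbs x H = 2; t \<in> set H; \<not> adj x t; ipath Z; Z \<noteq> [];
      set Z \<inter> set H = {}; x \<notin> set Z; \<forall>z \<in> set Z. adj x z \<longleftrightarrow> z = hd Z;
      \<forall>z \<in> set Z. \<forall>y \<in> set H. adj z y \<longleftrightarrow> z = last Z \<and> y = t\<rbrakk> \<Longrightarrow> False"
    and no_diamond: "\<lbrakk>adj a b; adj a c; adj b c; adj a d; adj b d; c \<noteq> d\<rbrakk> \<Longrightarrow> False"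
    and no_bowtie: "\<lbrakk>adj v a; adj v b; adj a b; adj v c; adj v d; adj c d; {a, b} \<inter> {c, d} = {}\<rbrakk> \<Longrightarrow> False"
    and no_prism: "\<lbrakk>ipath p; ipath q; ipath r; length p \<ge> 2; length q \<ge> 2; length r \<ge> 2;
      set p \<inter> set q = {}; set p \<inter> set r = {}; set q \<inter> set r = {};
      \<forall>a \<in> set p. \<forall>b \<in> set q. adj a b \<longleftrightarrow> a = hd p \<and> b = hd q \<or> a = last p \<and> b = last q;
      \<forall>a \<in> set p. \<forall>b \<in> set r. adj a b \<longleftrightarrow> a = hd p \<and> b = hd r \<or> a = last p \<and> b = last r;
      \<forall>a \<in> set q. \<forall>b \<in> set r. adj a b \<longleftrightarrow> a = hd q \<and> b = hd r \<or> a = last q \<and> b = last r\<rbrakk> \<Longrightarrow> False"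
begin

text \<open>The cycle through \<open>v\<close> and the stretch carries exactly two neighbours of
  \<open>x\<close>. The third path of the subdivision starts at the last spoke of \<open>R\<close>
  and follows the rim to \<open>a\<close>. It keeps away from \<open>b\<close> because another spoke
  of \<open>R\<close> lies before it, and from \<open>v\<close> because \<open>v\<close> has no
  neighbour in \<open>R\<close>.\<close>

lemma two_nbrs_wheel:
  assumes cyc: "icyc (a # M @ b # R)" and nin: "v \<notin> set (a # M @ b # R)" "x \<notin> set (a # M @ b # R)"
    and vx: "v \<noteq> x" "\<not> adj v x" and v: "adj v a" "adj v b" "\<forall>c \<in> set M \<union> set R. \<not> adj v c"
    and k: "nbs x (a # M @ [b]) = 2" "\<not> adj x a" "nbs x R \<ge> 2"
  shows False
proof -
  obtain R1 u R2 where R: "R = R1 @ u # R2" "adj x u" "nbs x R2 = 0" "nbs x R = 1 + nbs x R1"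
    using nbs_split_last[of x R] k(3) by auto
  then have ne: "R1 \<noteq> []" "R \<noteq> []" using k(3) by auto
  have c: "ipath R" "set (a # M @ [b]) \<inter> set R = {}"
    "\<forall>c\<in>set (a # M @ [b]). \<forall>d\<in>set R. adj c d \<longleftrightarrow> c = b \<and> d = hd R \<or> c = a \<and> d = last R"
    using icyc_append[of "a # M @ [b]" R] cyc ne(2) by auto
  have H: "icyc (v # a # M @ [b])" using icyc_reroute[OF cyc ne(2)] nin v by auto
  have dR: "distinct R" using c(1) ipath_distinct by blast
  have hd: "hd R \<notin> set (u # R2)" using dR R(1) ne(1) by (cases R1) auto
  have ip: "ipath (u # R2)" using c(1) R(1) ipath_sub[of R1 "u # R2" "[]"] by simp
  have x1: "\<forall>z\<in>set (u # R2). adj x z \<longleftrightarrow> z = u" using R(2,3) ip by (auto simp: nbs_0)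
  have x2: "adj z y \<longleftrightarrow> z = last (u # R2) \<and> y = a" if z: "z \<in> set (u # R2)" and y: "y \<in> set (v # a # M @ [b])" for z y
  proof -
    have zR: "z \<in> set R" "last (u # R2) = last R" using z R(1) by auto
    show ?thesis
    proof (cases "y = v")
      case True
      then show ?thesis using v zR nin adj_commute[of z v] by auto
    next
      case False
      then have "y \<in> set (a # M @ [b])" using y by simp
      then have "adj y z \<longleftrightarrow> y = b \<and> z = hd R \<or> y = a \<and> z = last R" using c(3)[rule_format, of y z] zR(1) by blast
      moreover have "z \<noteq> hd R" using hd z by blast
      ultimately show ?thesis using zR(2) adj_commute[of y z] by auto
    qed
  qed
  have xv: "\<not> adj x v" using vx adj_sym by blast
  show False
  proof (rule no_wheel2_path[OF H, of x a "u # R2"])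
    show "nbs x (v # a # M @ [b]) = 2" using k(1) xv by simp
    show "set (u # R2) \<inter> set (v # a # M @ [b]) = {}" using c(2) R(1) nin(1) by auto
    show "\<forall>z\<in>set (u # R2). adj x z \<longleftrightarrow> z = hd (u # R2)" using x1 by simp
    show "\<forall>z\<in>set (u # R2). \<forall>y\<in>set (v # a # M @ [b]). adj z y \<longleftrightarrow> z = last (u # R2) \<and> y = a"
      using x2 by blast
  qed (use nin vx k ip R(1) in auto)
qed

text \<open>The hard case of \<open>wheel_pair\<close>: the outer arc has spokes only at its two
  ends. The shape of the subdivision depends on whether the two spokes on the stretch are
  consecutive on the rim.\<close>

lemma wheel_pair_ends:
  assumes cyc: "icyc (a # M @ b # R)" and nin: "v \<notin> set (a # M @ b # R)" "x \<notin> set (a # M @ b # R)"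
    and vx: "v \<noteq> x" "\<not> adj v x" and v: "adj v a" "adj v b" "\<forall>c \<in> set M. \<not> adj v c"
    and k: "nbs x (a # M @ [b]) = 2" "\<not> adj x b" and vR: "nbs v R \<ge> 2"
    and R: "R = r # R0 @ [r']" "adj x r" "adj x r'" "\<forall>c \<in> set R0. \<not> adj x c"
  shows False
proof -
  have xv: "\<not> adj x v" using vx adj_sym by blast
  have c: "ipath R" "ipath (a # M @ [b])"
    and cr: "\<And>c d. c\<in>set (a # M @ [b]) \<Longrightarrow> d\<in>set R \<Longrightarrow> adj c d \<longleftrightarrow> c = b \<and> d = r \<or> c = a \<and> d = r'"
    using icyc_append[of "a # M @ [b]" R] cyc R(1) by auto
  have H: "icyc (v # a # M @ [b])" using icyc_reroute[OF cyc] nin v R(1) by auto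
  have "nbs x (a # M @ [b]) = Suc 1" using k(1) by simp
  then obtain L1 u1 L where L1: "a # M @ [b] = L1 @ u1 # L" "adj x u1" "nbs x L1 = 0" "nbs x L = 1"
    by (rule nbs_Suc_first)
  have "nbs x L = Suc 0" using L1(4) by simp
  then obtain L2 u2 L3 where L2: "L = L2 @ u2 # L3" "adj x u2" "nbs x L2 = 0" "nbs x L3 = 0"
    by (rule nbs_Suc_first)
  define K where "K = tl (L1 @ [u1])"
  have K: "L1 @ [u1] = a # K" unfolding K_def using L1(1) by (cases L1) auto
  have xK: "\<And>d. d \<in> set (a # K) \<Longrightarrow> adj x d \<longleftrightarrow> d = u1" and u1: "u1 = last (a # K)"
    using L1(2,3) unfolding K[symmetric] by (auto simp: nbs_0)
  have e1: "M @ [b] = K @ L2 @ u2 # L3" using L1(1) L2(1) K by (cases L1) auto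
  have "L3 \<noteq> []"
  proof
    assume "L3 = []"
    then have "last (M @ [b]) = u2" using e1 by simp
    then show False using L2(2) k(2) by simp
  qed
  then obtain L3' b' where L3': "L3 = L3' @ [b']" by (metis rev_exhaust)
  then have M: "M = K @ L2 @ u2 # L3'" and "b' = b" using e1 by auto
  have dist: "distinct (a # K @ L2 @ u2 # L3' @ b # R)" using icyc_distinct[OF cyc] unfolding M by simp
  have rr: "r \<noteq> r'" using dist R by auto
  show False
  proof (cases "L2 = []")
    \<comment> \<open>The branch vertices are \<open>b\<close>, \<open>v\<close>, \<open>r\<close>
      and \<open>x\<close>. The cycle runs from \<open>v\<close> over \<open>a\<close> to
      \<open>u1\<close>, through \<open>x\<close> to \<open>r\<close>, and along \<open>R\<close> to
      the first neighbour \<open>c1\<close> of \<open>v\<close>; \<open>b\<close> reaches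
      \<open>x\<close> by the path back to \<open>u2\<close>. Since \<open>L2\<close> is nonempty,
      that path has no edge to \<open>u1\<close>.\<close>
    case False
    have "nbs v R = Suc (nbs v R - 1)" using vR by simp
    then obtain U c1 U' where U: "R = U @ c1 # U'" "adj v c1" "nbs v U = 0" "nbs v U' = nbs v R - 1"
      by (rule nbs_Suc_first)
    have "U' \<noteq> []" using U(4) vR by auto
    then have "last R = last U'" using U(1) by simp
    then have "last U' = r'" using R(1) by simp
    then have "r' \<in> set U'" using \<open>U' \<noteq> []\<close> by auto
    then have r'U: "r' \<notin> set (U @ [c1])" using U(1) dist by auto
    have hdU: "hd (U @ [c1]) = r" using U(1) R(1) by (cases U) auto
    have Usub: "set (U @ [c1]) \<subseteq> set R" using U(1) by auto
    have ipU: "ipath (U @ [c1])" using c(1) U(1) ipath_sub[of "[]" "U @ [c1]" U'] by simp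
    have ipK: "ipath (a # K)" using c(2) ipath_sub[of "[]" "a # K" "L2 @ u2 # L3' @ [b]"] unfolding M by simp
    have xU: "\<And>d. d \<in> set (U @ [c1]) \<Longrightarrow> adj x d \<longleftrightarrow> d = r"
    proof -
      fix d assume d: "d \<in> set (U @ [c1])"
      then have "d \<in> set R" "d \<noteq> r'" using Usub r'U by auto
      then show "adj x d \<longleftrightarrow> d = r" using R by auto
    qed
    have Ksub: "set (a # K) \<subseteq> set (a # M @ [b])" unfolding M by auto
    have bK: "b \<notin> set (a # K)" using dist by auto
    have no1: "\<And>e d. e \<in> set (a # K) \<Longrightarrow> d \<in> set (U @ [c1]) \<Longrightarrow> \<not> adj e d"
    proof -
      fix e d assume e: "e \<in> set (a # K)" and d: "d \<in> set (U @ [c1])"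
      have "e \<noteq> b" "d \<noteq> r'" using e d bK r'U by auto
      then show "\<not> adj e d" using cr[of e d] e d Ksub Usub by auto
    qed
    have nx: "x \<notin> set (a # K)" "x \<notin> set (U @ [c1])" using nin(2) Ksub Usub by auto
    have nv: "v \<notin> set (a # K)" "v \<notin> set (U @ [c1])" using nin(1) Ksub Usub by auto
    have dj: "set (a # K) \<inter> set (U @ [c1]) = {}" using dist Usub by auto
    have ip1: "ipath (x # U @ [c1])"
      using ipU xU hdU nx(2) by simp
    have "\<forall>e \<in> set (a # K). \<forall>d \<in> set (x # U @ [c1]). adj e d \<longleftrightarrow> e = last (a # K) \<and> d = hd (x # U @ [c1])"
    proof (intro ballI)
      fix e d assume e: "e \<in> set (a # K)" and d: "d \<in> set (x # U @ [c1])"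
      show "adj e d \<longleftrightarrow> e = last (a # K) \<and> d = hd (x # U @ [c1])"
      proof (cases "d = x")
        case True
        then show ?thesis using xK[OF e] u1 adj_commute[of e x] by simp
      next
        case False
        then show ?thesis using no1[OF e, of d] d by simp
      qed
    qed
    moreover have "set (a # K) \<inter> set (x # U @ [c1]) = {}" using dj nx by auto
    ultimately have ip2: "ipath ((a # K) @ x # U @ [c1])"
      using ipK ip1 ipath_append[of "a # K" "x # U @ [c1]"] by blast
    have vK: "\<forall>c \<in> set K. \<not> adj v c" using v(3) unfolding M by auto
    have "\<forall>c \<in> set U. \<not> adj v c" using U(3) by (simp add: nbs_0)
    then have H2: "icyc (v # (a # K) @ x # U @ [c1])"
      unfolding icyc_def using ip2 nv nx vx v(1) vK U(2) 
      by (intro exI[of _ v] exI[of _ "(a # K) @ x # U @ [c1]"]) auto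
    define Z where "Z = rev (u2 # L3')"
    have Zs: "set Z = insert u2 (set L3')" and Zne: "Z \<noteq> []" and lZ: "last Z = u2" unfolding Z_def by auto
    have ipZb: "ipath (u2 # L3' @ [b])" using c(2) ipath_sub[of "a # K @ L2" "u2 # L3' @ [b]" "[]"] unfolding M by simp
    then have ipb: "ipath (b # Z)" unfolding Z_def using ipath_rev[of "u2 # L3' @ [b]"] by simp
    have Zsub: "set Z \<subseteq> set M" using Zs M by auto
    have "ipath (((a # K) @ L2) @ (u2 # L3' @ [b]))" using c(2) unfolding M by simp
    then have cross: "\<forall>e\<in>set ((a # K) @ L2). \<forall>d\<in>set (u2 # L3' @ [b]). adj e d \<longleftrightarrow> e = last ((a # K) @ L2) \<and> d = u2"
      using ipath_append[of "(a # K) @ L2" "u2 # L3' @ [b]"] by simp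
    have "last ((a # K) @ L2) \<in> set L2" using False by simp
    then have "last ((a # K) @ L2) \<notin> set (a # K)" using dist by auto
    then have crK: "\<not> adj e d" if "e \<in> set (a # K)" "d \<in> set (u2 # L3' @ [b])" for e d
    proof -
      have "e \<in> set ((a # K) @ L2)" "e \<noteq> last ((a # K) @ L2)"
        using that(1) \<open>last ((a # K) @ L2) \<notin> set (a # K)\<close> by auto
      then show ?thesis using cross[rule_format, of e d] that(2) by blast
    qed
    have bU: "adj b d \<longleftrightarrow> d = r" if "d \<in> set (U @ [c1])" for d
      using cr[of b d] that Usub bK by auto
    have bb: "nbs b (a # K) = 0" using crK adj_commute by (auto simp: nbs_0)
    have dU: "distinct (U @ [c1])" using ipU ipath_distinct by blast
    have rU: "r \<in> set (U @ [c1])" using hdU by (metis hd_in_set snoc_eq_iff_butlast)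
    have "{d \<in> set (U @ [c1]). adj b d} = {r}" using bU rU by auto
    then have bc: "nbs b (U @ [c1]) = 1" using nbs_card[OF dU] by simp
    have n2: "nbs b (v # (a # K) @ x # U @ [c1]) = 2"
    proof -
      have "nbs b (v # (a # K) @ x # U @ [c1]) = 1 + nbs b (a # K) + 0 + nbs b (U @ [c1])"
        using v(2) k(2) adj_commute[of b] by simp
      then show ?thesis using bb bc by simp
    qed
    have zR: "\<not> adj z d" if "z \<in> set Z" "d \<in> set R" for z d
    proof -
      have "z \<in> set (a # M @ [b])" "z \<noteq> a" "z \<noteq> b" using that Zsub Zs dist by auto
      then show ?thesis using cr that by blast
    qed
    have xZ: "adj x z \<longleftrightarrow> z = u2" if "z \<in> set Z" for z
      using that L2(2,4) L3' Zs by (auto simp: nbs_0)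
    show False
    proof (rule no_wheel2_path[OF H2 _ n2, of x Z])
      show "b \<notin> set (v # (a # K) @ x # U @ [c1])" using nin dist Usub by auto
      show "x \<in> set (v # (a # K) @ x # U @ [c1])" by simp
      show "\<not> adj b x" using k(2) adj_commute by blast
      show "ipath Z" "b \<notin> set Z" using ipb by auto
      show "\<forall>z\<in>set Z. adj b z \<longleftrightarrow> z = hd Z" using ipb by simp
      show "set Z \<inter> set (v # (a # K) @ x # U @ [c1]) = {}"
        using Zsub Zs nin dist Usub by auto
      show "\<forall>z\<in>set Z. \<forall>y\<in>set (v # (a # K) @ x # U @ [c1]). adj z y \<longleftrightarrow> z = last Z \<and> y = x"
      proof (intro ballI)
        fix z y assume z: "z \<in> set Z" and y: "y \<in> set (v # (a # K) @ x # U @ [c1])"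
        from y consider "y = v" | "y \<in> set (a # K)" | "y = x" | "y \<in> set (U @ [c1])" by auto
        then show "adj z y \<longleftrightarrow> z = last Z \<and> y = x"
        proof cases
          case 1
          have "\<not> adj v z" using v(3) z Zsub by auto
          then show ?thesis using 1 vx adj_commute[of z v] by auto
        next
          case 2
          then have "\<not> adj y z" using crK z Zs by auto
          then show ?thesis using 2 nx adj_commute[of z y] by auto
        next
          case 3
          then show ?thesis using xZ[OF z] lZ adj_commute[of z x] by simp
        next
          case 4
          then show ?thesis using zR[OF z] Usub nx by blast
        qed
      qed
    qed (use Zne in auto)
  next
    case True
    have u12: "adj u1 u2"
    proof -
      have "ipath ((a # K) @ u2 # L3' @ [b])" using c(2) unfolding M True by simp
      then show ?thesis using ipath_append[of "a # K" "u2 # L3' @ [b]"] u1 by simp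
    qed
    \<comment> \<open>An end \<open>q\<close> of \<open>R\<close> alone can serve as the third path
      from \<open>x\<close> to the cycle, provided that \<open>v\<close> does not see
      \<open>q\<close> and \<open>x\<close> does not see its rim neighbour \<open>t\<close>. A
      bowtie at \<open>v\<close> and a diamond ensure that one of the two ends qualifies.\<close>
    have one: False if q: "\<not> adj v q" "q \<in> set R" "adj x q" "t \<in> set (a # M @ [b])" "\<not> adj x t"
      "\<And>y. y \<in> set (a # M @ [b]) \<Longrightarrow> adj q y \<longleftrightarrow> y = t" for q t
    proof (rule no_wheel2_path[OF H, of x t "[q]"])
      show "nbs x (v # a # M @ [b]) = 2" using k(1) xv by simp
      show "\<forall>z\<in>set [q]. \<forall>y\<in>set (v # a # M @ [b]). adj z y \<longleftrightarrow> z = last [q] \<and> y = t"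
        using q nin adj_commute[of q v] by auto
      show "set [q] \<inter> set (v # a # M @ [b]) = {}" using q(2) nin dist unfolding M by auto
      show "t \<in> set (v # a # M @ [b])" using q(4) by simp
    qed (use q nin vx in auto)
    have qy: "\<And>y. y \<in> set (a # M @ [b]) \<Longrightarrow> adj r y \<longleftrightarrow> y = b" "\<And>y. y \<in> set (a # M @ [b]) \<Longrightarrow> adj r' y \<longleftrightarrow> y = a"
      using cr R(1) rr adj_commute[of r] adj_commute[of r'] by auto
    show False
    proof (cases "adj v r")
      case False
      then show False using one[of r b] R k(2) qy(1) by auto
    next
      case vr: True
      have br: "adj b r" "adj a r'" using cr[of b r] cr[of a r'] R(1) by auto
      have "\<not> adj v r'"
        using no_bowtie[of v b r a r'] v vr br dist R(1) by auto
      moreover have "\<not> adj x a"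
      proof
        assume "adj x a"
        then have "a = u1" using xK[of a] by simp
        then show False using no_diamond[of x a u2 r'] \<open>adj x a\<close> L2(2) u12 R br dist by auto
      qed
      ultimately show False using one[of r' a] R qy(2) by auto
    qed
  qed
qed
end

context forbidden begin

lemma icyc_mirror: "icyc (a # M @ b # R) \<Longrightarrow> icyc (b # rev M @ a # rev R)"
  using icyc_rev[of "a # M @ b # R"] icyc_rot[of "rev R @ b # rev M @ [a]" "(b # rev M @ [a]) @ rev R"]
    rotI[of "rev R" "b # rev M @ [a]"] by simp

text \<open>The cycle through \<open>v\<close> and the stretch has two neighbours of
  \<open>x\<close>; what is missing is a path from \<open>x\<close> to \<open>v\<close>. The
  interior of \<open>R\<close> contains one as soon as both \<open>x\<close> and \<open>v\<close>
  have neighbours there. Otherwise one of them sees both ends of \<open>R\<close>, and a bowtie or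
  \<open>wheel_pair_ends\<close> applies.\<close>

lemma wheel_pair:
  assumes cyc: "icyc (a # M @ b # R)" and nin: "v \<notin> set (a # M @ b # R)" "x \<notin> set (a # M @ b # R)"
    and vx: "v \<noteq> x" "\<not> adj v x" and v: "adj v a" "adj v b" "\<forall>c \<in> set M. \<not> adj v c"
    and k: "nbs x (a # M @ [b]) = 2" and vR: "nbs v R \<ge> 2" and xR: "nbs x R \<ge> 2"
  shows False
proof -
  have xv: "\<not> adj x v" using vx adj_sym by blast
  obtain r R0 r' where R: "R = r # R0 @ [r']"
  proof (cases R)
    case Nil
    then show ?thesis using vR by simp
  next
    case (Cons r R')
    then show ?thesis using vR that by (cases R' rule: rev_cases) (auto split: if_splits)
  qed
  have c: "ipath R" "ipath (a # M @ [b])"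
    and cr: "\<And>c d. c\<in>set (a # M @ [b]) \<Longrightarrow> d\<in>set R \<Longrightarrow> adj c d \<longleftrightarrow> c = b \<and> d = r \<or> c = a \<and> d = r'"
    using icyc_append[of "a # M @ [b]" R] cyc R by auto
  have H: "icyc (v # a # M @ [b])" using icyc_reroute[OF cyc] nin v R by auto
  have dist: "distinct (a # M @ b # r # R0 @ [r'])" using icyc_distinct[OF cyc] R by simp
  have br: "adj b r" "adj a r'" using cr[of b r] cr[of a r'] R by auto
  have notboth: False if "adj y a" "adj y b" "adj y r" "adj y r'" for y
    using no_bowtie[of y b r a r'] that br dist by auto
  show False
  proof (cases "\<exists>c \<in> set R0. adj v c")
    case False
    then have "adj v r" "adj v r'" using vR unfolding R by (auto simp: nbs_0[of v R0, symmetric] split: if_splits)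
    then show False using notboth v by blast
  next
    case vR0: True
    show False
    proof (cases "\<exists>c \<in> set R0. adj x c")
      case False
      then have rr: "adj x r" "adj x r'" using xR unfolding R by (auto simp: nbs_0[of x R0, symmetric] split: if_splits)
      then consider "\<not> adj x b" | "\<not> adj x a" using notboth by blast
      then show False
      proof cases
        case 1
        then show False using wheel_pair_ends[OF cyc nin vx v k 1 vR R] rr False by blast
      next
        case 2
        have m: "icyc (b # rev M @ a # rev R)" using icyc_mirror[OF cyc] .
        show False
          by (rule wheel_pair_ends[OF m, of v x r' "rev R0" r])
            (use nin vx v k vR 2 rr False R in auto)
      qed
    next
      case xR0: True
      have dR0: "distinct R0" using dist by simp
      obtain u Z w where Z: "R0 = u @ Z @ w" "Z \<noteq> []" and
        hl: "(\<forall>z \<in> set Z. (adj x z \<longleftrightarrow> z = hd Z) \<and> (adj v z \<longleftrightarrow> z = last Z)) \<or>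
         (\<forall>z \<in> set Z. (adj v z \<longleftrightarrow> z = hd Z) \<and> (adj x z \<longleftrightarrow> z = last Z))"
        by (rule shortest_segment[OF dR0 xR0 vR0])
      have ipZ: "ipath Z" using c(1) ipath_sub[of "r # u" Z "w @ [r']"] Z(1) R by simp
      have zH: "\<not> adj z y" if "z \<in> set Z" "y \<in> set (a # M @ [b])" for z y
      proof -
        have "z \<in> set R" "z \<noteq> r" "z \<noteq> r'" using that dist Z(1) R by auto
        then show ?thesis using cr[OF that(2), of z] adj_commute[of z y] by blast
      qed
      have key: False if Y: "ipath Y" "set Y = set Z" "Y \<noteq> []" 
        "\<And>z. z \<in> set Z \<Longrightarrow> adj x z \<longleftrightarrow> z = hd Y" "\<And>z. z \<in> set Z \<Longrightarrow> adj v z \<longleftrightarrow> z = last Y" for Y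
      proof (rule no_wheel2_path[OF H, of x v Y])
        show "nbs x (v # a # M @ [b]) = 2" using k xv by simp
        show "set Y \<inter> set (v # a # M @ [b]) = {}" using Y(2) Z(1) R nin dist by auto
        show "\<forall>z\<in>set Y. \<forall>y\<in>set (v # a # M @ [b]). adj z y \<longleftrightarrow> z = last Y \<and> y = v"
        proof (intro ballI)
          fix z y assume z: "z \<in> set Y" and y: "y \<in> set (v # a # M @ [b])"
          show "adj z y \<longleftrightarrow> z = last Y \<and> y = v"
          proof (cases "y = v")
            case True
            then show ?thesis using Y(2,5) z adj_commute[of z v] by simp
          next
            case False
            then show ?thesis using zH[of z y] Y(2) z y by simp
          qed
        qed
        show "x \<notin> set Y" using Y(2) Z(1) R nin by auto
      qed (use Y nin vx xv in auto)
      from hl show False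
      proof
        assume "\<forall>z \<in> set Z. (adj x z \<longleftrightarrow> z = hd Z) \<and> (adj v z \<longleftrightarrow> z = last Z)"
        then show False using key[of Z] ipZ Z(2) by blast
      next
        assume "\<forall>z \<in> set Z. (adj v z \<longleftrightarrow> z = hd Z) \<and> (adj x z \<longleftrightarrow> z = last Z)"
        then show False using key[of "rev Z"] ipZ Z(2) by (simp add: ipath_rev hd_rev last_rev)
      qed
    qed
  qed
qed

text \<open>The vertex \<open>v\<close> sees both rim neighbours of the spoke \<open>w\<close>. The
  four-cycle \<open>v a w b\<close> carries two neighbours of \<open>x\<close>, namely
  \<open>v\<close> and \<open>w\<close>, and the third path goes from \<open>x\<close> to the first
  spoke in \<open>M\<close> and back to \<open>a\<close>; a further spoke in \<open>M\<close>
  separates it from \<open>b\<close>. Diamonds exclude the unwanted edges.\<close>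

lemma twin_wheel:
  assumes cyc: "icyc (a # M @ b # [w])" and nin: "v \<notin> set (a # M @ b # [w])" "x \<notin> set (a # M @ b # [w])"
    and vx: "adj v x" and v: "adj v a" "adj v b" "\<forall>c \<in> set M. \<not> adj v c"
    and k: "nbs x (a # M @ [b]) \<ge> 3" and xw: "adj x w"
  shows False
proof -
  have c: "ipath (a # M @ [b])"
    and cr: "\<And>c. c\<in>set (a # M @ [b]) \<Longrightarrow> adj c w \<longleftrightarrow> c = b \<or> c = a"
    using icyc_append[of "a # M @ [b]" "[w]"] cyc by auto
  have dist: "distinct (a # M @ [b, w])" using icyc_distinct[OF cyc] by simp
  have "M \<noteq> []" using k by (auto split: if_splits)
  have aw: "adj a w" "adj b w" using cr by auto
  have ab: "\<not> adj a b" using c \<open>M \<noteq> []\<close> dist by (cases M) auto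
  have vw: "\<not> adj v w" using no_diamond[of v w a b] v aw dist adj_commute by auto
  have xab: "\<not> adj x a" "\<not> adj x b"
    using no_diamond[of x a v w] no_diamond[of x b v w] vx v aw xw nin adj_commute by auto
  have "nbs x M = Suc (nbs x M - 1)" using k xab by simp
  then obtain L1 u L2 where L: "M = L1 @ u # L2" "adj x u" "nbs x L1 = 0" "nbs x L2 = nbs x M - 1"
    by (rule nbs_Suc_first)
  have "L2 \<noteq> []" using L(4) k xab by auto
  have H: "icyc [v, a, w, b]" unfolding icyc_def
    using v aw vw ab dist nin adj_commute by (intro exI[of _ v] exI[of _ "[a, w, b]"]) auto
  define Z where "Z = rev (L1 @ [u])"
  have ipa: "ipath (a # L1 @ [u])" using c ipath_sub[of "[]" "a # L1 @ [u]" "L2 @ [b]"] L by simp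
  have ipZ: "ipath Z" unfolding Z_def using ipa ipath_rev[of "L1 @ [u]"] by simp
  have Zs: "set Z = insert u (set L1)" "hd Z = u" "Z \<noteq> []" unfolding Z_def by auto
  have lZ: "last Z = hd (L1 @ [u])" unfolding Z_def by (simp add: last_rev)
  have "ipath ((a # L1 @ [u]) @ L2 @ [b])" using c L by simp
  then have bZ: "\<not> adj z b" if "z \<in> set Z" for z
    using ipath_append[of "a # L1 @ [u]" "L2 @ [b]"] that Zs \<open>L2 \<noteq> []\<close> dist L by auto
  show False
  proof (rule no_wheel2_path[OF H, of x a Z])
    show "nbs x [v, a, w, b] = 2" using vx xw xab adj_commute[of x v] by simp
    show "\<forall>z\<in>set Z. adj x z \<longleftrightarrow> z = hd Z" using Zs L(2,3) by (auto simp: nbs_0)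
    show "\<forall>z\<in>set Z. \<forall>y\<in>set [v, a, w, b]. adj z y \<longleftrightarrow> z = last Z \<and> y = a"
    proof
      fix z assume z: "z \<in> set Z"
      then have zM: "z \<in> set M" using Zs L by auto
      have "\<not> adj z v" using v(3) zM adj_sym by blast
      moreover have "\<not> adj z w" using cr[of z] zM dist by auto
      moreover have "adj z a \<longleftrightarrow> z = last Z" using ipa z Zs lZ adj_commute[of z a] by auto
      ultimately show "\<forall>y\<in>set [v, a, w, b]. adj z y \<longleftrightarrow> z = last Z \<and> y = a"
        using bZ[OF z] z zM dist nin by auto
    qed
    show "set Z \<inter> set [v, a, w, b] = {}" using Zs L dist nin by auto
    show "x \<notin> set Z" using Zs L nin by auto
    show "x \<notin> set [v, a, w, b]" using nin vx by auto
  qed (use ipZ Zs xab in auto)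
qed
end

section \<open>Rerouted wheels\<close>

lemma rot_unique:
  assumes "distinct l" "rot l (a # u)" "rot l (a # w)" shows "u = w"
proof -
  have "rot (a # u) (a # w)" using assms rot_sym rot_trans by blast
  then obtain p q where pq: "a # u = p @ q" "a # w = q @ p" by (auto simp: rot_def)
  have "distinct (a # u)" using assms(1,2) rot_distinct by blast
  then show ?thesis using pq by (cases p; cases q) auto
qed

lemma rot_locate:
  assumes "rot l (xs @ R)"
  obtains (lin) P1 P2 where "l = P1 @ xs @ P2" "R = P2 @ P1"
    | (wrap) V W where "l = W @ R @ V" "xs = V @ W" "V \<noteq> []" "W \<noteq> []"
proof -
  obtain U V where l: "l = U @ V" "xs @ R = V @ U" using assms by (auto simp: rot_def)
  from l(2) consider Z where "xs = V @ Z" "Z @ R = U" | Z where "V = xs @ Z" "R = Z @ U"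
    by (auto simp: append_eq_append_conv2)
  then show thesis
  proof cases
    case 1
    then show thesis using l lin[of "[]" R] lin[of R "[]"] wrap[of Z V] by (cases "V = []"; cases "Z = []") auto
  next
    case 2
    then show thesis using l lin[of U Z] by simp
  qed
qed

lemma mem_arc_between:
  assumes "a \<in> set xs" "b \<in> set xs" "a \<noteq> b"
  obtains X1 X2 X3 where "xs = X1 @ a # X2 @ b # X3" | X1 X2 X3 where "xs = X1 @ b # X2 @ a # X3"
proof -
  obtain U V where xs: "xs = U @ a # V" using split_list[OF assms(1)] by blast
  then consider "b \<in> set U" | "b \<in> set V" using assms by auto
  then show thesis
  proof cases
    case 1
    then show thesis using split_list[OF 1] xs that(2) by (metis append.assoc append_Cons)
  next
    case 2
    then show thesis using split_list[OF 2] xs that(1) by metis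
  qed
qed

section \<open>Walks inside induced cycles, and vertices that are not proper\<close>

context sgraph begin

fun walk :: "'a list \<Rightarrow> bool" where
  "walk [] = True"
| "walk [a] = True"
| "walk (a # b # xs) = (adj a b \<and> walk (b # xs))"

lemma ipath_walk: "ipath xs \<Longrightarrow> walk xs"
  by (induction xs rule: walk.induct) auto

text \<open>The induction prepends a vertex. It must be a rim neighbour of the present head, and one
  of the two rim neighbours is already used unless the path is a single vertex. Only there is the
  direction still free, which is why \<open>rev cs\<close> appears.\<close>

lemma walk_in_icyc:
  assumes "icyc cs" "walk s" "distinct s" "s \<noteq> []" "set s \<subseteq> set cs"
  shows "\<exists>ds Y. (ds = cs \<or> ds = rev cs) \<and> rot ds (s @ Y)"
  using assms(2-5)
proof (induction s)
  case (Cons a s)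
  show ?case
  proof (cases "s = []")
    case True
    then obtain Y where "rot cs (a # Y)" using Cons.prems rot_start[of a cs] by auto
    then show ?thesis using True by auto
  next
    case False
    have as: "adj a (hd s)" "walk s" using Cons.prems(1) False by (cases s; auto)+
    have "distinct s" "set s \<subseteq> set cs" using Cons.prems by auto
    then obtain ds Y where ds: "ds = cs \<or> ds = rev cs" "rot ds (s @ Y)"
      using Cons.IH[OF as(2)] False by blast
    have cyc: "icyc (s @ Y)" using ds icyc_rot icyc_rev assms(1) by blast
    have aY: "a \<in> set Y"
    proof -
      have "set ds = set cs" using ds(1) by auto
      then have "a \<in> set (s @ Y)" using rot_set[OF ds(2)] Cons.prems(4) by auto
      then show ?thesis using Cons.prems(2) by auto
    qed
    then have Yne: "Y \<noteq> []" by auto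
    have "adj (hd s) a \<longleftrightarrow> hd s = last s \<and> a = hd Y \<or> hd s = hd s \<and> a = last Y"
      using cyc icyc_append[OF False Yne] aY False hd_in_set by blast
    then have "hd s = last s \<and> a = hd Y \<or> a = last Y" using as(1) adj_commute by blast
    then consider "a = last Y" | "hd s = last s" "a = hd Y" by blast
    then show ?thesis
    proof cases
      case 1
      then have "s @ Y = (s @ butlast Y) @ [a]" using Yne by simp
      then have "rot (s @ Y) ((a # s) @ butlast Y)" using rotI[of "s @ butlast Y" "[a]"] by simp
      then show ?thesis using ds rot_trans by blast
    next
      case 2
      obtain h where h: "s = [h]" using 2(1) False \<open>distinct s\<close>
        by (cases s) (auto split: if_splits)
      have Y: "Y = a # tl Y" using 2 Yne by simp
      have "rot (rev ds) (rev (s @ Y))" using ds(2) rot_rev by blast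
      moreover have "rev (s @ Y) = rev (tl Y) @ [a, h]" using h by (subst Y) simp
      ultimately have "rot (rev ds) ([a, h] @ rev (tl Y))" using rotI rot_trans by metis
      then have "rot (rev ds) ((a # s) @ rev (tl Y))" using h by simp
      moreover have "rev ds = cs \<or> rev ds = rev cs" using ds(1) by auto
      ultimately show ?thesis by blast
    qed
  qed
qed auto

lemma nbs_icyc_self:
  assumes "icyc cs" "v \<in> set cs" shows "nbs v cs = 2"
proof -
  obtain p where r: "rot cs (v # p)" using rot_start[OF assms(2)] by blast
  then have "icyc (v # p)" using assms(1) icyc_rot by blast
  then have p: "length p \<ge> 2" "ipath p" "\<forall>b\<in>set p. adj v b \<longleftrightarrow> b = hd p \<or> b = last p"
    by (auto simp: icyc_def)
  then have dp: "distinct p" "p \<noteq> []" using ipath_distinct by auto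
  have "hd p \<noteq> last p" using p(1) dp by (cases p) (auto split: if_splits)
  moreover have "{b \<in> set p. adj v b} = {hd p, last p}" using p(3) dp(2) hd_in_set last_in_set by blast
  ultimately have "nbs v p = 2" using nbs_card[OF dp(1)] by simp
  then show ?thesis using nbs_rot[OF r] by simp
qed

lemma nbs_subset: "distinct l \<Longrightarrow> set l \<subseteq> set l' \<Longrightarrow> distinct l' \<Longrightarrow> nbs v l \<le> nbs v l'"
  by (auto simp: nbs_card intro!: card_mono)

text \<open>The abstract setting has no vertex set. This is harmless: an element without neighbours
  on the rim is never improper.\<close>

definition improper :: "'a \<Rightarrow> 'a list \<Rightarrow> 'a \<Rightarrow> bool" where
  "improper x cs v \<longleftrightarrow> v \<notin> set cs \<and> v \<noteq> x \<and>
     \<not> (one_sector x cs {c \<in> set cs. adj v c} \<and> (2 < nbs v cs \<longrightarrow> adj v x))"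

lemma improper_rot:
  assumes "rot cs cs'" "improper x cs v" shows "improper x cs' v"
  using assms one_sector_rot[OF assms(1)] rot_set[OF assms(1)] nbs_rot[OF assms(1), of v]
  unfolding improper_def by auto

lemma improper_rev:
  assumes "improper x cs v" shows "improper x (rev cs) v"
  using assms one_sector_rev[of x "rev cs" "{c \<in> set cs. adj v c}"] unfolding improper_def by auto

end

section \<open>Wheels with the fewest spokes and the reroutings of their rims\<close>

locale min_wheel = forbidden +
  fixes x :: 'a and cs :: "'a list"
  assumes cyc: "icyc cs" and xcs: "x \<notin> set cs" and spokes3: "nbs x cs \<ge> 3"
    and proper: "\<not> improper x cs v"
    and minimal: "\<lbrakk>icyc cs'; x \<notin> set cs'; 3 \<le> nbs x cs'; nbs x cs' < nbs x cs\<rbrakk> \<Longrightarrow> \<exists>v. improper x cs' v"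
begin

lemma spokes4: "nbs x cs \<ge> 4"
  using spokes3 no_wheel3[OF cyc xcs] by simp

text \<open>
  The wheels obtained by rerouting: a piece \<open>A\<close> of the old rim closed up by a path \<open>Q\<close> with at most
  one spoke besides its two end vertices. This slack at the ends makes the family stable under
  rerouting through one more vertex, and it still forces two consecutive sectors of the new wheel
  to lie in \<open>A\<close> up to their far ends, which is what excludes a vertex with neighbours inside every sector.
\<close>

definition arc_wheel :: "'a list \<Rightarrow> 'a list \<Rightarrow> bool" where
  "arc_wheel A Q \<longleftrightarrow> icyc (A @ Q) \<and> x \<notin> set (A @ Q) \<and> A \<noteq> [] \<and> Q \<noteq> [] \<and> set A \<subseteq> set cs \<and>
     3 \<le> nbs x (A @ Q) \<and> nbs x (A @ Q) < nbs x cs \<and> nbs x (butlast (tl Q)) \<le> 1"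

lemma rot_rev_parts: "rot (rev (A @ Q)) (rev A @ rev Q)"
  using rotI[of "rev Q" "rev A"] by simp

lemma arc_wheel_rev:
  assumes "arc_wheel A Q" shows "arc_wheel (rev A) (rev Q)"
proof -
  have "icyc (rev A @ rev Q)"
    using assms icyc_rot[OF rot_rev_parts] icyc_rev unfolding arc_wheel_def by blast
  then show ?thesis using assms unfolding arc_wheel_def by (auto simp: butlast_tl_rev)
qed

text \<open>The arc \<open>A\<close> still lies on the old rim, where properness of the old wheel
  bounds the number of neighbours; a vertex of the old rim has just its two rim neighbours.\<close>

lemma nbs_arc_nonadj:
  assumes "arc_wheel A Q" "v \<notin> set (A @ Q)" "v \<noteq> x" "\<not> adj v x"
  shows "nbs v A \<le> 2"
proof -
  have A: "distinct A" "set A \<subseteq> set cs" using assms(1) icyc_distinct[of "A @ Q"] by (auto simp: arc_wheel_def)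
  have le: "nbs v A \<le> nbs v cs" using nbs_subset A icyc_distinct[OF cyc] by blast
  show ?thesis
  proof (cases "v \<in> set cs")
    case True
    then show ?thesis using nbs_icyc_self[OF cyc True] le by simp
  next
    case False
    then have "nbs v cs \<le> 2" using proper[of v] assms by (auto simp: improper_def)
    then show ?thesis using le by simp
  qed
qed

text \<open>For \<open>v\<close> off the old rim, properness of the old wheel puts \<open>a\<close>
  and \<open>b\<close> into one sector of \<open>cs\<close>. If the piece of it between them were
  not \<open>A2\<close>, it would contain everything outside \<open>A\<close>, so \<open>A\<close>
  would carry all the spokes, too many for a rerouted wheel. For \<open>v\<close> on the old rim but
  outside \<open>A\<close>, the two neighbours are the ends of \<open>A\<close>, and counting spokes
  makes \<open>v\<close> proper for the new wheel.\<close>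

lemma nbs_between:
  assumes f: "arc_wheel A Q" and imp: "improper x (A @ Q) v" and A: "A = A1 @ a # A2 @ b # A3"
    and v: "adj v a" "adj v b"
  shows "nbs x A2 = 0"
proof -
  have vn: "v \<notin> set (A @ Q)" "v \<noteq> x" using imp by (auto simp: improper_def)
  have icAQ: "icyc (A @ Q)" "A \<noteq> []" "Q \<noteq> []" "set A \<subseteq> set cs" using f by (auto simp: arc_wheel_def)
  have ipA: "ipath A" using icAQ icyc_arc by blast
  obtain ds Y where ds: "ds = cs \<or> ds = rev cs" "rot ds (A @ Y)"
    using walk_in_icyc[OF cyc ipath_walk[OF ipA] ipath_distinct[OF ipA]] icAQ by blast
  have icY: "icyc (A @ Y)" and dds: "distinct ds" and sds: "set ds = set cs" and nds: "nbs x ds = nbs x cs"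
    using ds icyc_rot icyc_rev cyc icyc_distinct by auto
  have dAY: "distinct (A @ Y)" using icY icyc_distinct by blast
  have n: "nbs x cs = nbs x A + nbs x Y" using nds nbs_rot[OF ds(2), of x] by simp
  have lt: "nbs x A + nbs x Q < nbs x cs" using f by (simp add: arc_wheel_def)
  show ?thesis
  proof (cases "v \<in> set cs")
    case True
    then have vY: "v \<in> set Y" using rot_set[OF ds(2)] sds vn by auto
    then have Yne: "Y \<noteq> []" by auto
    have cr: "\<And>c. c \<in> set A \<Longrightarrow> adj c v \<longleftrightarrow> c = last A \<and> v = hd Y \<or> c = hd A \<and> v = last Y"
      using icY icyc_append[OF icAQ(2) Yne] vY by blast
    have aA: "a \<in> set A" "b \<in> set A" using A by auto
    have "a \<noteq> last A" using dAY A by (cases A3 rule: rev_cases) auto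
    then have a: "a = hd A" "v = last Y" using cr[OF aA(1)] v(1) adj_commute by blast+
    have "b \<noteq> hd A" using dAY A by (cases A1) auto
    then have b: "b = last A" "v = hd Y" using cr[OF aA(2)] v(2) adj_commute by blast+
    have "A1 = []" using a(1) dAY A by (cases A1) auto
    moreover have "A3 = []" using b(1) dAY A by (cases A3 rule: rev_cases) auto
    moreover have "Y = [v]" using a(2) b(2) dAY Yne by (cases Y) (auto split: if_splits)
    \<comment> \<open>\<open>A\<close> omits only \<open>v\<close> from the old rim. So the drop in
      the number of spokes forces \<open>v\<close> to be a spoke and \<open>Q\<close> to have
      none.\<close>
    ultimately have q: "A = a # A2 @ [b]" "nbs x Q = 0" "adj x v" using A n lt by (auto split: if_splits)
    have "rot (A @ Q) ((b # Q @ [a]) @ A2)" using q(1) rotI[of "a # A2" "b # Q"] by simp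
    moreover have "\<not> adj v c" if "c \<in> set A2" for c
    proof -
      have "c \<in> set A" "c \<noteq> a" "c \<noteq> b" using q(1) dAY that by auto
      then show ?thesis using cr[of c] a(1) b(1) adj_commute[of v c] by blast
    qed
    then have "{c \<in> set (A @ Q). adj v c} \<subseteq> set (b # Q @ [a])" using q(1) by auto
    moreover have "nbs x (butlast (tl (b # Q @ [a]))) = 0" using q(2) by simp
    ultimately have "one_sector x (A @ Q) {c \<in> set (A @ Q). adj v c}"
      unfolding one_sector_def by blast
    then show ?thesis using imp q(3) adj_commute[of x v] by (auto simp: improper_def)
  next
    case False
    then have "one_sector x cs {c \<in> set cs. adj v c}" using proper[of v] vn by (auto simp: improper_def)
    then have "one_sector x ds {c \<in> set cs. adj v c}" using ds(1) one_sector_rev by blast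
    then obtain xs ys where xs: "rot ds (xs @ ys)" "{c \<in> set cs. adj v c} \<subseteq> set xs" "nbs x (butlast (tl xs)) = 0"
      by (auto simp: one_sector_def)
    have ab: "a \<in> set xs" "b \<in> set xs" "a \<noteq> b" using xs(2) v A icAQ(4) dAY by auto
    have rA: "rot ds (a # A2 @ b # A3 @ Y @ A1)"
      using rot_trans[OF ds(2), of "(a # A2 @ b # A3 @ Y) @ A1"] rotI[of A1 "a # A2 @ b # A3 @ Y"] A by simp
    have mid: "nbs x X2 = 0" if "xs = X1 @ c # X2 @ d # X3" for X1 c X2 d X3
    proof -
      have "set X2 \<subseteq> set (butlast (tl xs))" using that
        by (cases X1; cases X3 rule: rev_cases) (auto simp: butlast_append)
      then show ?thesis using xs(3) by (auto simp: nbs_0)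
    qed
    from ab show ?thesis
    proof (rule mem_arc_between)
      fix X1 X2 X3 assume X: "xs = X1 @ a # X2 @ b # X3"
      have "rot ds (a # X2 @ b # X3 @ ys @ X1)"
        using rot_trans[OF xs(1), of "(a # X2 @ b # X3 @ ys) @ X1"] rotI[of X1 "a # X2 @ b # X3 @ ys"] X by simp
      then have eq: "A2 @ b # A3 @ Y @ A1 = X2 @ b # X3 @ ys @ X1" using rot_unique[OF dds rA] by simp
      have "distinct (A2 @ b # A3 @ Y @ A1)" using rA rot_distinct dds by fastforce
      then have "A2 = X2" using eq by (auto simp: append_eq_append_conv2 append_eq_Cons_conv Cons_eq_append_conv)
      then show ?thesis using mid[OF X] by simp
    next
      fix X1 X2 X3 assume X: "xs = X1 @ b # X2 @ a # X3"
      have "rot ds (a # X3 @ ys @ X1 @ b # X2)"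
        using rot_trans[OF xs(1), of "(a # X3 @ ys) @ X1 @ b # X2"] rotI[of "X1 @ b # X2" "a # X3 @ ys"] X by simp
      then have eq: "A2 @ b # A3 @ Y @ A1 = (X3 @ ys @ X1) @ b # X2" using rot_unique[OF dds rA] by simp
      have "distinct (A2 @ b # A3 @ Y @ A1)" using rA rot_distinct dds by fastforce
      then have "A3 @ Y @ A1 = X2" using eq by (auto simp: append_eq_append_conv2 append_eq_Cons_conv Cons_eq_append_conv)
      then have "nbs x Y = 0" using mid[OF X] by auto
      then show ?thesis using n lt by simp
    qed
  qed
qed
end

section \<open>A smallest rerouted wheel and a vertex that is not proper for it\<close>

locale min_rerouted = min_wheel +
  fixes A Q :: "'a list" and v :: 'a
  assumes arc_wheel: "arc_wheel A Q"
    and best: "\<lbrakk>arc_wheel A' Q'; nbs x (A' @ Q') < nbs x (A @ Q) \<or>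
      nbs x (A' @ Q') = nbs x (A @ Q) \<and> length (A' @ Q') < length (A @ Q)\<rbrakk> \<Longrightarrow> False"
    and imp: "improper x (A @ Q) v"
begin

lemma basic: "icyc (A @ Q)" "x \<notin> set (A @ Q)" "A \<noteq> []" "Q \<noteq> []" "set A \<subseteq> set cs"
  "nbs x (A @ Q) < nbs x cs" "nbs x (butlast (tl Q)) \<le> 1" "v \<notin> set (A @ Q)" "v \<noteq> x"
  using arc_wheel imp by (auto simp: arc_wheel_def improper_def)

lemma n4: "nbs x (A @ Q) \<ge> 4"
  using arc_wheel no_wheel3[OF basic(1,2)] by (simp add: arc_wheel_def)

lemma bad_rev: "min_rerouted adj x cs (rev A) (rev Q) v"
proof unfold_locales
  show "arc_wheel (rev A) (rev Q)" using arc_wheel_rev[OF arc_wheel] .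
  show "improper x (rev A @ rev Q) v"
    using improper_rot[OF rot_rev_parts improper_rev[OF imp]] .
qed (use best in auto)

text \<open>The sectors that the cycle has with \<open>v\<close> in the role of the centre, called
  stretches above; \<open>R\<close> is the rest of the cycle.\<close>

definition vsector :: "'a \<Rightarrow> 'a list \<Rightarrow> 'a \<Rightarrow> 'a list \<Rightarrow> bool" where
  "vsector a M b R \<longleftrightarrow> rot (A @ Q) (a # M @ b # R) \<and> adj v a \<and> adj v b \<and> (\<forall>c \<in> set M. \<not> adj v c)"

lemma vsector_basic:
  assumes "vsector a M b R"
  shows "icyc (a # M @ b # R)" "v \<notin> set (a # M @ b # R)" "x \<notin> set (a # M @ b # R)"
    "nbs x (A @ Q) = nbs x (a # M @ [b]) + nbs x R" "length (A @ Q) = length M + 2 + length R"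
    "nbs v (A @ Q) = 2 + nbs v R" "adj v a" "adj v b" "\<forall>c \<in> set M. \<not> adj v c"
    "a \<in> set (A @ Q)" "b \<in> set (A @ Q)" "a \<noteq> b"
proof -
  have r: "rot (A @ Q) (a # M @ b # R)" and v: "adj v a" "adj v b" "\<forall>c \<in> set M. \<not> adj v c"
    using assms by (auto simp: vsector_def)
  show ic: "icyc (a # M @ b # R)" using icyc_rot[OF r basic(1)] .
  show "v \<notin> set (a # M @ b # R)" "x \<notin> set (a # M @ b # R)" "a \<in> set (A @ Q)" "b \<in> set (A @ Q)"
    using rot_set[OF r] basic by auto
  show "nbs x (A @ Q) = nbs x (a # M @ [b]) + nbs x R" using nbs_rot[OF r, of x] by simp
  show "length (A @ Q) = length M + 2 + length R" using rot_length[OF r] by simp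
  have "nbs v M = 0" using v by (simp add: nbs_0)
  then show "nbs v (A @ Q) = 2 + nbs v R" using nbs_rot[OF r, of v] v by simp
  show "a \<noteq> b" using icyc_distinct[OF ic] by auto
qed (use assms in \<open>auto simp: vsector_def\<close>)

text \<open>With one more spoke than this on the stretch, the cycle closed up through
  \<open>v\<close> has at least three spokes. The two cases differ by the spoke \<open>v\<close>
  itself.\<close>

definition bound :: nat where "bound = (if adj v x then 1 else 2)"

text \<open>
  A vertex adjacent to \<open>x\<close> may replace a single spoke and thus keep the number of spokes; then the new
  rim is shorter unless the vertex is a twin of that spoke.
\<close>

lemma reroute:
  assumes s: "vsector a M b R" and R: "R \<noteq> []"
    and hyp: "nbs x (a # M @ [b]) < nbs x (A @ Q) \<or> \<not> adj v x \<and> length R \<ge> 2"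
    and new: "rot (v # a # M @ [b]) (A' @ Q')" "A' \<noteq> []" "Q' \<noteq> []" "set A' \<subseteq> set cs"
      "nbs x (butlast (tl Q')) \<le> 1"
  shows "nbs x (a # M @ [b]) \<le> bound"
proof (rule ccontr)
  note b = vsector_basic[OF s]
  let ?k = "nbs x (a # M @ [b])"
  assume neg: "\<not> ?k \<le> bound"
  have ic: "icyc (v # a # M @ [b])" using icyc_reroute[OF b(1) R] b by auto
  have nx: "x \<notin> set (v # a # M @ [b])" using b(3) basic(9) by auto
  have k: "nbs x (v # a # M @ [b]) = (if adj v x then 1 else 0) + ?k"
    using adj_commute[of v x] by simp
  have "nbs x (v # a # M @ [b]) \<ge> 3" using neg k unfolding bound_def
    by (cases "adj v x") (simp_all del: nbs_simps)
  then have k4: "nbs x (v # a # M @ [b]) \<ge> 4" using no_wheel3[OF ic nx] by linarith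
  have le: "?k \<le> nbs x (A @ Q)" using b(4) by simp
  have le': "nbs x (v # a # M @ [b]) \<le> nbs x (A @ Q)" using k hyp le by (auto split: if_splits)
  have nk: "nbs x (A' @ Q') = nbs x (v # a # M @ [b])" "length (A' @ Q') = length M + 3"
    using nbs_rot[OF new(1), of x] rot_length[OF new(1)] by auto
  have f: "arc_wheel A' Q'"
    unfolding arc_wheel_def using icyc_rot[OF new(1) ic] rot_set[OF new(1)] nx new nk k4 le' basic(6) by auto
  have "nbs x (A' @ Q') = nbs x (A @ Q)" "\<not> length (A' @ Q') < length (A @ Q)"
    using best[OF f] nk(1) le' by (metis le_neq_implies_less)+
  then have eq: "nbs x (v # a # M @ [b]) = nbs x (A @ Q)" "length R \<le> 1"
    using nk b(5) by auto
  then have vx: "adj v x" "?k + 1 = nbs x (A @ Q)" using hyp k by (auto split: if_splits)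
  obtain w where w: "R = [w]" using eq(2) R by (cases R) auto
  have "nbs x R = 1" using vx(2) b(4) by linarith
  then have xw: "adj x w" using w by (simp split: if_splits)
  have k3: "?k \<ge> 3" using k k4 vx(1) by (simp del: nbs_simps)
  show False
    using twin_wheel[OF b(1)[unfolded w] b(2)[unfolded w] b(3)[unfolded w] vx(1) b(7,8,9) k3 xw] .
qed

lemma vsector_k: "vsector a M b R \<Longrightarrow> R = [] \<Longrightarrow> nbs x (a # M @ [b]) = nbs x (A @ Q)"
  using vsector_basic(4)[of a M b R] by simp

lemma bound_A:
  assumes s: "vsector a M b R" and R: "R \<noteq> []"
    and hyp: "nbs x (a # M @ [b]) < nbs x (A @ Q) \<or> \<not> adj v x \<and> length R \<ge> 2"
    and loc: "A = P1 @ (a # M @ [b]) @ P2"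
  shows "nbs x (a # M @ [b]) \<le> bound"
  by (rule reroute[OF s R hyp, of "a # M @ [b]" "[v]"])
    (use rotI[of "[v]" "a # M @ [b]"] loc basic(5) in auto)

text \<open>\<open>Q\<close> has at most three spokes, and no wheel has exactly three. A stretch
  beyond the bound must therefore be all of \<open>Q\<close>, with spokes at both ends, and
  \<open>v\<close> must be the fourth spoke; then \<open>a\<close>, \<open>b\<close>,
  \<open>v\<close> and \<open>x\<close> give a diamond.\<close>

lemma bound_Q:
  assumes s: "vsector a M b R" and loc: "Q = P1 @ (a # M @ [b]) @ P2"
  shows "nbs x (a # M @ [b]) \<le> bound"
proof (rule ccontr)
  note b = vsector_basic[OF s]
  let ?k = "nbs x (a # M @ [b])"
  assume neg: "\<not> ?k \<le> bound"
  have R: "R \<noteq> []"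
  proof
    assume "R = []"
    then have "length A = 0" using b(5) loc by simp
    then show False using basic(3) by simp
  qed
  have ic: "icyc (v # a # M @ [b])" using icyc_reroute[OF b(1) R] b by auto
  have nx: "x \<notin> set (v # a # M @ [b])" using b(3) basic(9) by auto
  have k: "nbs x (v # a # M @ [b]) = (if adj v x then 1 else 0) + ?k"
    using adj_commute[of v x] by simp
  have "nbs x (v # a # M @ [b]) \<ge> 3" using neg k unfolding bound_def
    by (cases "adj v x") (simp_all del: nbs_simps)
  then have k4: "nbs x (v # a # M @ [b]) \<ge> 4" using no_wheel3[OF ic nx] by linarith
  then have k3: "?k \<ge> 3" using k by (auto split: if_splits)
  have "P1 = []"
  proof (rule ccontr)
    assume "P1 \<noteq> []"
    then have "tl Q = tl P1 @ a # M @ b # P2" using loc by simp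
    moreover have "nbs x (tl Q) \<le> nbs x (butlast (tl Q)) + 1"
      by (cases "tl Q" rule: rev_cases) auto
    ultimately have "nbs x (tl P1 @ a # M @ b # P2) \<le> 2" using basic(7) by simp
    then show False using k3 by simp
  qed
  moreover have "P2 = []"
  proof (rule ccontr)
    assume "P2 \<noteq> []"
    then have "butlast Q = P1 @ a # M @ b # butlast P2" using loc by (simp add: butlast_append)
    moreover have "nbs x (butlast Q) \<le> nbs x (butlast (tl Q)) + 1"
      by (cases Q) auto
    ultimately have "nbs x (P1 @ a # M @ b # butlast P2) \<le> 2" using basic(7) by simp
    then show False using k3 by simp
  qed
  ultimately have "Q = a # M @ [b]" using loc by simp
  then have "nbs x M \<le> 1" using basic(7) by simp
  then have ab: "adj x a" "adj x b" and "?k = 3" using k3 by (auto split: if_splits)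
  then have "adj v x" using k k4 by (auto split: if_splits)
  then show False using no_diamond[of v x a b] b ab by auto
qed

text \<open>The new path consists of the part of \<open>Q\<close> in the stretch followed by
  \<open>v\<close>, so \<open>b\<close> becomes an inner vertex. This can break the limit of one
  inner spoke only if \<open>b\<close> is a spoke at the end of \<open>Q\<close>.\<close>

lemma bound_AQ:
  assumes s: "vsector a M b R" and R: "R \<noteq> []"
    and hyp: "nbs x (a # M @ [b]) < nbs x (A @ Q) \<or> \<not> adj v x \<and> length R \<ge> 2 \<and> nbs v (A @ Q) \<ge> 4"
    and loc: "A = P1 @ a # M1" "Q = M2 @ b # P2" "M = M1 @ M2"
  shows "nbs x (a # M @ [b]) \<le> bound"
proof (cases "P2 = [] \<and> adj x b")
  case False
  have "nbs x (tl (M2 @ [b])) \<le> 1"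
  proof (cases "M2 = []")
    case True
    then show ?thesis by simp
  next
    case ne: False
    show ?thesis
    proof (cases P2 rule: rev_cases)
      case Nil
      then show ?thesis using False basic(7) ne loc(2) by (simp add: butlast_append)
    next
      case (snoc P p)
      then have "butlast (tl Q) = tl M2 @ b # P" using ne loc(2) by (simp add: butlast_append)
      then show ?thesis using basic(7) ne by simp
    qed
  qed
  then have "nbs x (butlast (tl (M2 @ [b, v]))) \<le> 1" by (cases M2) (auto simp: butlast_append)
  moreover have "rot (v # a # M @ [b]) ((a # M1) @ M2 @ [b, v])"
    using rotI[of "[v]" "a # M @ [b]"] loc(3) by simp
  ultimately show ?thesis
    using reroute[OF s R, of "a # M1" "M2 @ [b, v]"] hyp loc(1) basic(5) by auto
next
  \<comment> \<open>The rerouted path would have the two inner spokes \<open>b\<close> and an old one, so the sector of \<open>v\<close> on the other side of \<open>b\<close> is used instead.\<close>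
  case exc: True
  note b = vsector_basic[OF s]
  let ?k = "nbs x (a # M @ [b])"
  show ?thesis
  proof (rule ccontr)
    assume neg: "\<not> ?k \<le> bound"
    have b2: "bound \<le> 2" "bound \<ge> 1" unfolding bound_def by auto
    have Q: "Q = M2 @ [b]" using loc(2) exc by simp
    have "\<exists>c \<in> set (P1 @ [a]). adj v c" using b(7) by auto
    then obtain P' a1 P'' where P: "P1 @ [a] = P' @ a1 # P''" "adj v a1" "\<forall>c \<in> set P'. \<not> adj v c"
      by (metis split_list_first_prop)
    have AQ: "A @ Q = P' @ a1 # P'' @ M1 @ M2 @ [b]"
      using loc(1) Q P(1) by (metis append.assoc append_Cons append_Nil)
    have s1: "vsector b P' a1 (P'' @ M1 @ M2)"
      unfolding vsector_def AQ using rotI[of "P' @ a1 # P'' @ M1 @ M2" "[b]"] P b(8) by simp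
    note b1 = vsector_basic[OF s1]
    have k3: "nbs x (a # M) \<ge> bound" using neg exc by simp
    have kM: "?k = nbs x (a # M) + 1" using exc by simp
    \<comment> \<open>\<open>nbs_between\<close> excludes spokes strictly between \<open>a1\<close>
      and \<open>a\<close>, so \<open>a\<close> is the only one that can count.\<close>
    have mid: "nbs x P'' = (if P'' = [] then 0 else if adj x a then 1 else 0)"
    proof (cases P'' rule: rev_cases)
      case (snoc P3 a')
      then have "P1 @ [a] = (P' @ a1 # P3) @ [a']" using P(1) by simp
      then have a': "P1 = P' @ a1 # P3" "a' = a" by auto
      then have "A = P' @ a1 # P3 @ a # M1" using loc(1) by simp
      then have "nbs x P3 = 0" using nbs_between[OF arc_wheel imp _ P(2) b(7)] by blast
      then show ?thesis using snoc a' by simp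
    qed simp
    have one: "P'' = [] \<Longrightarrow> a1 = a \<and> P' = P1" using P(1) by auto
    have aP: "adj x a \<Longrightarrow> P'' = [] \<Longrightarrow> adj x a1" using one by auto
    have n': "nbs x (A @ Q) = nbs x (b # P' @ [a1]) + nbs x P'' + nbs x M" using b1(4) loc(3) by simp
    have lt1: "nbs x (b # P' @ [a1]) < nbs x (A @ Q)"
    proof (rule ccontr)
      assume "\<not> ?thesis"
      then have z: "nbs x P'' = 0" "nbs x M = 0" using n' by auto
      then have "nbs x (a # M) \<le> 1" by simp
      then have "bound = 1" "adj x a" using k3 b2 z by (auto split: if_splits)
      then have "P'' = []" using mid z by (auto split: if_splits)
      then have "adj v x" "adj x a" "a1 = a" using \<open>bound = 1\<close> \<open>adj x a\<close> one unfolding bound_def by (auto split: if_splits)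
      then show False using no_diamond[of v x a b] b exc by auto
    qed
    have ne1: "P'' @ M1 @ M2 \<noteq> []"
    proof
      assume "P'' @ M1 @ M2 = []"
      then show False using vsector_k[OF s1] lt1 by simp
    qed
    have set1: "set (P' @ [a1]) \<subseteq> set cs"
    proof -
      have "set (P' @ [a1]) \<subseteq> set (P1 @ [a])" unfolding P(1) by auto
      then show ?thesis using loc(1) basic(5) by auto
    qed
    have k1: "nbs x (b # P' @ [a1]) \<le> bound"
    proof (rule reroute[OF s1 ne1, of "P' @ [a1]" "[v, b]"])
      show "rot (v # b # P' @ [a1]) ((P' @ [a1]) @ [v, b])" using rotI[of "[v, b]" "P' @ [a1]"] by simp
    qed (use lt1 set1 in auto)
    show False
    proof (cases "adj v x")
      case True
      then have z: "nbs x P' = 0" "\<not> adj x a1" using k1 exc unfolding bound_def by (auto split: if_splits)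
      then have "?k = nbs x (A @ Q)" using n' mid aP exc by (auto split: if_splits)
      then show False using hyp True by simp
    next
      case False
      \<comment> \<open>At most two neighbours of \<open>v\<close> lie in \<open>A\<close>, and only
        \<open>b\<close> in \<open>Q\<close>. Three in all are impossible, so there are exactly two,
        \<open>a1\<close> is \<open>a\<close>, and \<open>two_nbrs_wheel\<close> applies to the
        stretch on the other side of \<open>b\<close>.\<close>
      have "nbs v (A @ Q) = nbs v A + nbs v Q" by simp
      also have "nbs v Q = 1" using Q b(8,9) loc(3) nbs_0[of v M2] by simp
      finally have "nbs v (A @ Q) \<le> 3" using nbs_arc_nonadj[OF arc_wheel basic(8,9) False] by simp
      moreover have "nbs v (A @ Q) \<noteq> 3" using no_wheel3[OF basic(1,8)] .
      ultimately have N2: "nbs v (A @ Q) = 2" using b(6) by simp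
      then have lt: "?k < nbs x (A @ Q)" using hyp by simp
      have "nbs v (P'' @ M1 @ M2) = 0" using b1(6) N2 by simp
      then have "P'' = []"
        using P(1) b(7) by (cases P'' rule: rev_cases) (auto split: if_splits)
      then have eq: "a1 = a" "P' = P1" using one by auto
      have k1': "nbs x (b # P1 @ [a]) \<le> 2" using k1 eq b2 by simp
      have "nbs x (A @ Q) = 1 + nbs x P1 + nbs x (a # M)"
        using n' eq \<open>P'' = []\<close> exc by simp
      then have p1: "nbs x P1 \<ge> 1" using lt kM by simp
      then have fin: "nbs x P1 = 1" "\<not> adj x a" using k1' exc by (auto split: if_splits)
      have M2: "nbs x M \<ge> 2" using neg kM fin False unfolding bound_def by simp
      have ic: "icyc (b # P1 @ a # M)" using b1(1) eq \<open>P'' = []\<close> loc(3) by simp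
      have ic2: "icyc (a # rev P1 @ b # rev M)" using icyc_mirror[OF ic] .
      show False
        by (rule two_nbrs_wheel[OF ic2, of v x])
          (use b1 b eq \<open>P'' = []\<close> loc(3) False basic(9) fin exc M2 in auto)
    qed
  qed
qed

lemma vsector_mirror:
  assumes "vsector a M b R" shows "min_rerouted.vsector adj (rev A) (rev Q) v b (rev M) a (rev R)"
proof -
  interpret r: min_rerouted adj x cs "rev A" "rev Q" v by (rule bad_rev)
  have "rot (A @ Q) (a # M @ b # R)" using assms by (simp add: vsector_def)
  then have "rot (rev (A @ Q)) (rev R @ b # rev M @ [a])" using rot_rev by fastforce
  then have "rot (rev A @ rev Q) (rev R @ b # rev M @ [a])"
    using rot_trans rot_sym rot_rev_parts by metis
  then have "rot (rev A @ rev Q) ((b # rev M @ [a]) @ rev R)" using rot_trans rotI by metis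
  then show ?thesis using assms by (simp add: r.vsector_def vsector_def)
qed

lemma bound_QA:
  assumes s: "vsector a M b R" and R: "R \<noteq> []"
    and hyp: "nbs x (a # M @ [b]) < nbs x (A @ Q) \<or> \<not> adj v x \<and> length R \<ge> 2 \<and> nbs v (A @ Q) \<ge> 4"
    and loc: "A = M2 @ b # P1" "Q = P2 @ a # M1" "M = M1 @ M2"
  shows "nbs x (a # M @ [b]) \<le> bound"
proof -
  interpret r: min_rerouted adj x cs "rev A" "rev Q" v by (rule bad_rev)
  have "nbs x (b # rev M @ [a]) \<le> r.bound"
  proof (rule r.bound_AQ[OF vsector_mirror[OF s], of "rev P1" "rev M2" "rev M1" "rev P2"])
    show "nbs x (b # rev M @ [a]) < nbs x (rev A @ rev Q) \<or>
      \<not> adj v x \<and> 2 \<le> length (rev R) \<and> 4 \<le> nbs v (rev A @ rev Q)" using hyp by auto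
  qed (use R loc in auto)
  then show ?thesis unfolding r.bound_def bound_def by simp
qed

text \<open>All of \<open>A\<close> survives, and \<open>v\<close> replaces the piece
  \<open>R\<close> in the middle of the path. The limit of one inner spoke is kept because
  \<open>R\<close> contains a spoke whenever \<open>v\<close> is one.\<close>

lemma bound_QAQ:
  assumes s: "vsector a M b R" and R: "R \<noteq> []"
    and hyp: "nbs x (a # M @ [b]) < nbs x (A @ Q) \<or> \<not> adj v x \<and> length R \<ge> 2"
    and loc: "Q = M2 @ b # R @ a # M1" "M = M1 @ A @ M2"
  shows "nbs x (a # M @ [b]) \<le> bound"
proof (rule reroute[OF s R hyp, of A "M2 @ b # v # a # M1"])
  show "rot (v # a # M @ [b]) (A @ M2 @ b # v # a # M1)"
    using rotI[of "v # a # M1" "A @ M2 @ [b]"] loc(2) by simp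
  have "butlast (tl (M2 @ b # v # a # M1)) = tl (M2 @ [b]) @ v # butlast (a # M1)"
    by (cases M2) (auto simp: butlast_append)
  moreover have "butlast (tl Q) = tl (M2 @ [b]) @ R @ butlast (a # M1)"
    unfolding loc by (cases M2) (auto simp: butlast_append)
  moreover have "adj x v \<Longrightarrow> nbs x R \<ge> 1"
    using hyp vsector_basic(4)[OF s] adj_commute[of x v] by auto
  ultimately show "nbs x (butlast (tl (M2 @ b # v # a # M1))) \<le> 1"
    using basic(7) by (auto split: if_splits)
qed (use basic in auto)

text \<open>This position does not occur. By \<open>nbs_between\<close> the rest \<open>R\<close>, a
  piece of \<open>A\<close>, has no spoke, so only the second alternative of the hypothesis remains;
  but then \<open>v\<close> would have four neighbours in \<open>A\<close>, where it has at most
  two.\<close>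

lemma bound_AQA:
  assumes s: "vsector a M b R"
    and hyp: "nbs x (a # M @ [b]) < nbs x (A @ Q) \<or> \<not> adj v x \<and> length R \<ge> 2 \<and> nbs v (A @ Q) \<ge> 4"
    and loc: "A = M2 @ b # R @ a # M1" "M = M1 @ Q @ M2"
  shows False
proof -
  note b = vsector_basic[OF s]
  have "nbs x R = 0" using nbs_between[OF arc_wheel imp loc(1) b(8,7)] .
  then have "nbs x (a # M @ [b]) = nbs x (A @ Q)" using b(4) by simp
  then have "\<not> adj v x" "nbs v (A @ Q) \<ge> 4" using hyp by auto
  moreover have "nbs v Q = 0" using b(9) loc(2) by (auto simp: nbs_0)
  ultimately show False using nbs_arc_nonadj[OF arc_wheel basic(8,9)] by simp
qed

text \<open>The cases are the positions of the stretch relative to the cut into \<open>A\<close> and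
  \<open>Q\<close>. The second alternative of the hypothesis admits a stretch that contains every
  spoke; rerouting then gains in length only.\<close>

lemma vsector_bound:
  assumes s: "vsector a M b R" and R: "R \<noteq> []"
    and hyp: "nbs x (a # M @ [b]) < nbs x (A @ Q) \<or> \<not> adj v x \<and> length R \<ge> 2 \<and> nbs v (A @ Q) \<ge> 4"
  shows "nbs x (a # M @ [b]) \<le> bound"
proof -
  have hyp': "nbs x (a # M @ [b]) < nbs x (A @ Q) \<or> \<not> adj v x \<and> length R \<ge> 2" using hyp by blast
  have "rot (A @ Q) ((a # M @ [b]) @ R)" using s by (simp add: vsector_def)
  then show ?thesis
  proof (cases rule: rot_locate)
    case (lin P1 P2)
    from lin(1) consider Z where "A = P1 @ Z" "Z @ Q = (a # M @ [b]) @ P2"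
      | Z where "P1 = A @ Z" "Q = Z @ (a # M @ [b]) @ P2"
      by (auto simp: append_eq_append_conv2)
    then show ?thesis
    proof cases
      case 1
      from 1(2) consider Y where "Z = (a # M @ [b]) @ Y" | Y where "a # M @ [b] = Z @ Y" "Q = Y @ P2"
        unfolding append_eq_append_conv2 by metis
      then show ?thesis
      proof cases
        case (1 Y)
        then show ?thesis using bound_A[OF s R hyp', of P1 Y] \<open>A = P1 @ Z\<close> by simp
      next
        case (2 Y)
        show ?thesis
        proof (cases "Z = [] \<or> Y = []")
          case True
          then show ?thesis
            using 2 bound_Q[OF s, of "[]" P2] bound_A[OF s R hyp', of P1 "[]"] \<open>A = P1 @ Z\<close> by auto
        next
          case False
          then obtain M1 M2 where "Z = a # M1" "Y = M2 @ [b]" "M = M1 @ M2"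
            using 2(1) by (cases Z; cases Y rule: rev_cases) auto
          then show ?thesis using bound_AQ[OF s R hyp, of P1 M1 M2 P2] 2(2) \<open>A = P1 @ Z\<close> by simp
        qed
      qed
    next
      case (2 Z)
      then show ?thesis using bound_Q[OF s] by blast
    qed
  next
    case (wrap V W)
    obtain M1 M2 where VW: "V = a # M1" "W = M2 @ [b]" "M = M1 @ M2"
      using wrap(2-4) by (cases V; cases W rule: rev_cases) auto
    from wrap(1) consider Z where "A = W @ Z" "Z @ Q = R @ V" | Z where "W = A @ Z" "Q = Z @ R @ V"
      by (auto simp: append_eq_append_conv2)
    then show ?thesis
    proof cases
      case 1
      from 1(2) consider Y where "Z = R @ Y" "V = Y @ Q" | Y where "R = Z @ Y" "Q = Y @ V"
        by (auto simp: append_eq_append_conv2)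
      then show ?thesis
      proof cases
        case (1 Y)
        show ?thesis
        proof (cases Y)
          case Nil
          then show ?thesis using bound_QA[OF s R hyp, of M2 R "[]" M1] 1 VW \<open>A = W @ Z\<close> by simp
        next
          case (Cons a' M1')
          then have "a' = a" "M1 = M1' @ Q" using 1 VW by auto
          then show ?thesis using bound_AQA[OF s hyp, of M2 M1'] 1 VW Cons \<open>A = W @ Z\<close> by simp
        qed
      next
        case (2 Y)
        then show ?thesis using bound_QA[OF s R hyp, of M2 Z Y M1] VW \<open>A = W @ Z\<close> by simp
      qed
    next
      case (2 Z)
      show ?thesis
      proof (cases Z rule: rev_cases)
        case Nil
        then have "A = M2 @ [b]" "Q = R @ a # M1" using 2 VW by auto
        then show ?thesis using bound_QA[OF s R hyp _ _ VW(3), of "[]" R] by blast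
      next
        case (snoc Z' b')
        then have "b' = b" "M2 = A @ Z'" using 2 VW by auto
        then show ?thesis using bound_QAQ[OF s R hyp', of Z' M1] 2 VW snoc by simp
      qed
    qed
  qed
qed
end

section \<open>A stretch with exactly two spokes exists and is impossible\<close>

context min_rerouted begin

text \<open>If all neighbours of \<open>v\<close> lay in one sector, \<open>v\<close> would fail to
  be proper only by having at least four neighbours without being adjacent to \<open>x\<close>. The
  stretch from the last of them round to the first contains every spoke, and the cycle closed up by
  \<open>v\<close> is shorter, against \<open>vsector_bound\<close>.\<close>

lemma not_one_sector: "\<not> one_sector x (A @ Q) {c \<in> set (A @ Q). adj v c}"
proof
  assume os: "one_sector x (A @ Q) {c \<in> set (A @ Q). adj v c}"
  then have vx: "\<not> adj v x" "nbs v (A @ Q) > 2" using imp by (auto simp: improper_def)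
  then have N4: "nbs v (A @ Q) \<ge> 4" using no_wheel3[OF basic(1,8)] by linarith
  obtain xs ys where xs: "rot (A @ Q) (xs @ ys)" "{c \<in> set (A @ Q). adj v c} \<subseteq> set xs"
      "nbs x (butlast (tl xs)) = 0"
    using os by (auto simp: one_sector_def)
  have d: "distinct (xs @ ys)" using rot_distinct[OF xs(1)] icyc_distinct[OF basic(1)] by blast
  have ys: "nbs v ys = 0"
  proof -
    have "\<not> adj v c" if "c \<in> set ys" for c
      using that xs(2) d rot_set[OF xs(1)] by auto
    then show ?thesis by (simp add: nbs_0)
  qed
  have N: "nbs v xs = nbs v (A @ Q)" using nbs_rot[OF xs(1), of v] ys by simp
  have "nbs v xs = Suc (nbs v xs - 1)" using N N4 by simp
  then obtain X1 a W where X1: "xs = X1 @ a # W" "adj v a" "nbs v X1 = 0" "nbs v W = nbs v xs - 1"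
    by (rule nbs_Suc_first)
  have "nbs v W = Suc (nbs v xs - 2)" using X1(4) N N4 by simp
  then obtain X2 b X3 where X2: "W = X2 @ b # X3" "adj v b" "nbs v X3 = 0" "nbs v X2 = nbs v xs - 2"
    by (rule nbs_Suc_last)
  have X: "xs = X1 @ a # X2 @ b # X3" using X1(1) X2(1) by simp
  have "rot (xs @ ys) (b # (X3 @ ys @ X1) @ a # X2)"
    using rotI[of "X1 @ a # X2" "b # X3 @ ys"] X by simp
  then have s: "vsector b (X3 @ ys @ X1) a X2"
    unfolding vsector_def using rot_trans[OF xs(1)] X1(2,3) X2(2,3) ys by (auto simp: nbs_0)
  have "nbs v X2 \<ge> 2" using X2(4) N N4 by simp
  then have "length X2 \<ge> 2" unfolding nbs_def using length_filter_le[of "adj v" X2] by linarith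
  have "set X2 \<subseteq> set (butlast (tl xs))" using X
    by (cases X1; cases X3 rule: rev_cases) (auto simp: butlast_append)
  then have "nbs x X2 = 0" using xs(3) by (auto simp: nbs_0)
  then have "nbs x (b # (X3 @ ys @ X1) @ [a]) = nbs x (A @ Q)" using vsector_basic(4)[OF s] by linarith
  moreover have "nbs x (b # (X3 @ ys @ X1) @ [a]) \<le> bound"
    by (rule vsector_bound[OF s]) (use \<open>length X2 \<ge> 2\<close> vx N4 in auto)
  ultimately show False using n4 unfolding bound_def by (simp split: if_splits)
qed

text \<open>A stretch with every spoke would leave all neighbours of \<open>v\<close> in one sector.
  So each stretch misses a spoke, and \<open>vsector_bound\<close> applies by its first
  alternative.\<close>

lemma vsector_small:
  assumes s: "vsector a M b R" shows "R \<noteq> []" "nbs x (a # M @ [b]) \<le> bound"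
proof -
  note b = vsector_basic[OF s]
  have lt: "nbs x (a # M @ [b]) < nbs x (A @ Q)"
  proof (rule ccontr)
    assume "\<not> ?thesis"
    then have z: "nbs x R = 0" using b(4) by linarith
    have r: "rot (A @ Q) (a # M @ b # R)" using s by (simp add: vsector_def)
    have "rot (a # M @ b # R) ((b # R @ [a]) @ M)" using rotI[of "a # M" "b # R"] by simp
    then have "rot (A @ Q) ((b # R @ [a]) @ M)" using r rot_trans by blast
    moreover have "{c \<in> set (A @ Q). adj v c} \<subseteq> set (b # R @ [a])"
      using rot_set[OF r] b(9) by auto
    moreover have "nbs x (butlast (tl (b # R @ [a]))) = 0" using z by simp
    ultimately show False using not_one_sector unfolding one_sector_def by blast
  qed
  then show R: "R \<noteq> []" using vsector_k[OF s] by fastforce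
  show "nbs x (a # M @ [b]) \<le> bound" using vsector_bound[OF s R] lt by blast
qed

lemma nbs_v_ge2: "nbs v (A @ Q) \<ge> 2"
proof (rule ccontr)
  assume "\<not> ?thesis"
  then have le: "nbs v (A @ Q) \<le> 1" by simp
  obtain c where c: "c \<in> set (A @ Q)" "{d \<in> set (A @ Q). adj v d} \<subseteq> {c}"
  proof (cases "nbs v (A @ Q) = 0")
    case True
    then show ?thesis using that[of "hd A"] basic(3) by (auto simp: nbs_0)
  next
    case False
    then have "nbs v (A @ Q) = Suc 0" using le by linarith
    then obtain u c w where "A @ Q = u @ c # w" "adj v c" "nbs v u = 0" "nbs v w = 0"
      by (rule nbs_Suc_first)
    then show ?thesis using that[of c] by (auto simp: nbs_0)
  qed
  obtain ys where "rot (A @ Q) ([c] @ ys)" using rot_start[OF c(1)] by auto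
  then have "one_sector x (A @ Q) {d \<in> set (A @ Q). adj v d}"
    unfolding one_sector_def using c(2) by (intro exI[of _ "[c]"] exI[of _ ys]) auto
  then show False using not_one_sector by blast
qed

lemma spokes_in_vsec:
  assumes r: "rot (A @ Q) (z # T @ u # W)" and "adj x z" "adj x u" "\<forall>c \<in> set T. \<not> adj v c"
  obtains a M b R where "vsector a M b R" "nbs x (a # M @ [b]) \<ge> 2"
proof -
  have "rot (A @ Q) ((z # T @ [u]) @ W)" using r by simp
  moreover have "2 \<le> length (filter (adj v) (A @ Q))" using nbs_v_ge2 by (simp only: nbs_def)
  ultimately obtain a M b R L1 L2 where *: "rot (A @ Q) (a # M @ b # R)" "adj v a" "adj v b"
    "\<forall>c \<in> set M. \<not> adj v c" "a # M @ [b] = L1 @ (z # T @ [u]) @ L2"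
    using assms(4) by (elim extend_arc[of _ _ W "adj v"]) auto
  have "nbs x (a # M @ [b]) \<ge> 2" unfolding *(5) using assms(2,3) by simp
  then show thesis using that[of a M b R] * by (auto simp: vsector_def)
qed

text \<open>Otherwise every sector of the cycle has a neighbour of \<open>v\<close> in its interior.
  \<open>Q\<close> has at most three spokes, and it gets beyond one only by spokes at its ends; so
  some two consecutive sectors have their interiors and their common spoke in \<open>A\<close>,
  contrary to \<open>nbs_between\<close>.\<close>

lemma ex_vsec2:
  obtains a M b R where "vsector a M b R" "nbs x (a # M @ [b]) \<ge> 2"
proof (rule ccontr)
  assume neg: "\<not> thesis"
  note goal = that
  have inT: "\<exists>c \<in> set T. adj v c" if "rot (A @ Q) (z # T @ u # W)" "adj x z" "adj x u" for z T u W
    using spokes_in_vsec[OF that] goal neg by blast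
  have btw: False if A: "A = B0 @ T1 @ u # T2 @ B3" "adj x u" "\<exists>c \<in> set T1. adj v c" "\<exists>c \<in> set T2. adj v c"
    for B0 T1 u T2 B3
  proof -
    obtain c1 S1 S2 where 1: "T1 = S1 @ c1 # S2" "adj v c1" using A(3) split_list by metis
    obtain c2 S3 S4 where 2: "T2 = S3 @ c2 # S4" "adj v c2" using A(4) split_list by metis
    have "A = (B0 @ S1) @ c1 # (S2 @ u # S3) @ c2 # (S4 @ B3)" using A(1) 1 2 by simp
    from nbs_between[OF arc_wheel imp this 1(2) 2(2)] show False using A(2) by simp
  qed
  have qs: "nbs x Q \<le> (if adj x (hd Q) then 1 else 0) + 1 + (if adj x (last Q) then 1 else 0)"
    "nbs x Q \<ge> 2 \<Longrightarrow> adj x (hd Q) \<or> adj x (last Q)" "nbs x Q \<ge> 3 \<Longrightarrow> adj x (hd Q) \<and> adj x (last Q)"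
    "nbs x Q \<le> 3"
  proof -
    show 1: "nbs x Q \<le> (if adj x (hd Q) then 1 else 0) + 1 + (if adj x (last Q) then 1 else 0)"
    proof (cases "tl Q" rule: rev_cases)
      case Nil
      then show ?thesis using basic(4) by (cases Q) auto
    next
      case (snoc Q' q)
      then obtain h where Q: "Q = h # Q' @ [q]" using basic(4) by (cases Q) auto
      moreover have "nbs x Q' \<le> 1" using basic(7) snoc by simp
      ultimately show ?thesis by simp
    qed
    then show "nbs x Q \<ge> 2 \<Longrightarrow> adj x (hd Q) \<or> adj x (last Q)" "nbs x Q \<ge> 3 \<Longrightarrow> adj x (hd Q) \<and> adj x (last Q)"
      "nbs x Q \<le> 3"
      by (auto split: if_splits)
  qed
  obtain h Q' where Qh: "Q = h # Q'" using basic(4) by (cases Q) auto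
  obtain l Q'' where Ql: "Q = Q'' @ [l]" using basic(4) by (cases Q rule: rev_cases) auto
  have hl: "h = hd Q" unfolding Qh by simp
  have ll: "l = last Q" unfolding Ql by simp
  have n: "nbs x A + nbs x Q \<ge> 4" using n4 by simp
  then have "nbs x A \<ge> 1" using qs(4) by linarith
  then have "nbs x A = Suc (nbs x A - 1)" by simp
  then obtain X1 s W where X1: "A = X1 @ s # W" "adj x s" "nbs x X1 = 0" "nbs x W = nbs x A - 1"
    by (rule nbs_Suc_first)
  have left: "\<exists>c \<in> set X1. adj v c" if "adj x (last Q)"
  proof -
    have "adj x l" unfolding ll by (fact that)
    then show ?thesis
      by (intro inT[of l X1 s "W @ Q''"]) (use rotI[of "A @ Q''" "[l]"] X1(1,2) Ql in auto)
  qed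
  \<comment> \<open>The cases are one, two, or at least three spokes on \<open>A\<close>. With fewer
    than three, spokes at the ends of \<open>Q\<close> serve as outer ends of the two
    sectors.\<close>
  show False
  proof (cases "nbs x W = 0")
    case True
    then have "nbs x Q \<ge> 3" using X1(4) n by linarith
    then have hq: "adj x (hd Q)" "adj x (last Q)" using qs(3) by auto
    have "adj x h" unfolding hl by (fact hq)
    then have "\<exists>c \<in> set W. adj v c"
      by (intro inT[of s W h "Q' @ X1"]) (use rotI[of X1 "s # W @ Q"] X1(1,2) Qh in auto)
    then show False using btw[of "[]" X1 s W "[]"] left[OF hq(2)] X1(1,2) by simp
  next
    case False
    then have "nbs x W = Suc (nbs x W - 1)" by simp
    then obtain X2 t V where X2: "W = X2 @ t # V" "adj x t" "nbs x X2 = 0" "nbs x V = nbs x W - 1"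
      by (rule nbs_Suc_first)
    have mid: "\<exists>c \<in> set X2. adj v c"
      by (rule inT[of s X2 t "V @ Q @ X1"]) (use rotI[of X1 "s # W @ Q"] X1(1,2) X2(1,2) in auto)
    show False
    proof (cases "nbs x V = 0")
      case True
      then have "nbs x Q \<ge> 2" using X1(4) X2(4) n by linarith
      then consider "adj x (hd Q)" | "adj x (last Q)" using qs(2) by auto
      then show False
      proof cases
        case 1
        have "adj x h" unfolding hl by (fact 1)
        then have "\<exists>c \<in> set V. adj v c"
          by (intro inT[of t V h "Q' @ X1 @ s # X2"])
            (use rotI[of "X1 @ s # X2" "t # V @ Q"] X1(1,2) X2(1,2) Qh in auto)
        then show False using btw[of "X1 @ [s]" X2 t V "[]"] mid X1(1,2) X2(1,2) by simp
      next
        case 2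
        then show False using btw[of "[]" X1 s X2 "t # V"] left mid X1(1,2) X2(1,2) by simp
      qed
    next
      case False
      then have "nbs x V = Suc (nbs x V - 1)" by simp
      then obtain X3 w U where X3: "V = X3 @ w # U" "adj x w" "nbs x X3 = 0" "nbs x U = nbs x V - 1"
        by (rule nbs_Suc_first)
      have "\<exists>c \<in> set X3. adj v c"
        by (rule inT[of t X3 w "U @ Q @ X1 @ s # X2"])
          (use rotI[of "X1 @ s # X2" "t # V @ Q"] X1(1,2) X2(1,2) X3(1,2) in auto)
      then show False using btw[of "X1 @ [s]" X2 t X3 "w # U"] mid X1(1,2) X2(1,2) X3(1,2) by simp
    qed
  qed
qed

lemma contradiction: False
proof -
  obtain a M b R where s: "vsector a M b R" and k2: "nbs x (a # M @ [b]) \<ge> 2" by (rule ex_vsec2)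
  note b = vsector_basic[OF s]
  have "nbs x (a # M @ [b]) \<le> bound" using vsector_small[OF s] by blast
  then have k: "nbs x (a # M @ [b]) = 2" and vx: "\<not> adj v x"
    using k2 unfolding bound_def by (auto simp del: nbs_simps split: if_splits)
  have xR: "nbs x R \<ge> 2" using b(4) k n4 by linarith
  have "nbs v (A @ Q) \<noteq> 3" using no_wheel3[OF basic(1,8)] .
  then consider "nbs v R \<ge> 2" | "nbs v R = 0" using b(6) by linarith
  then show False
  proof cases
    case 1
    then show False using wheel_pair[OF b(1-3) basic(9) vx b(7-9) k _ xR] by blast
  next
    case 2
    have r: "rot (A @ Q) (a # M @ b # R)" using s by (simp add: vsector_def)
    have "rot (a # M @ b # R) (b # R @ a # M)" using rotI[of "a # M" "b # R"] by simp
    then have s2: "vsector b R a M" unfolding vsector_def using rot_trans[OF r] b 2 by (auto simp: nbs_0)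
    have k': "nbs x (b # R @ [a]) \<le> 2" using vsector_small(2)[OF s2] vx unfolding bound_def by simp
    \<comment> \<open>The two stretches share \<open>a\<close> and \<open>b\<close>. Each has at
      most two spokes and the cycle at least four, so no spoke may be counted twice.\<close>
    have "nbs x (a # M @ [b]) + nbs x (b # R @ [a]) = nbs x (A @ Q) + (if adj x a then 1 else 0) + (if adj x b then 1 else 0)"
      using b(4) by simp
    then have "\<not> adj x a" using k k' n4 by (auto simp del: nbs_simps split: if_splits)
    then show False
      using two_nbrs_wheel[OF b(1-3) basic(9) vx b(7,8) _ k _ xR] b(9) 2 by (auto simp: nbs_0)
  qed
qed
end

context min_wheel begin

theorem no_fam: "\<not> arc_wheel A Q"
proof
  assume f: "arc_wheel A Q"
  define r :: "(('a list \<times> 'a list) \<times> ('a list \<times> 'a list)) set" where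
    "r = measures [\<lambda>(A, Q). nbs x (A @ Q), \<lambda>(A, Q). length (A @ Q)]"
  have "wf r" unfolding r_def by simp
  moreover have "(A, Q) \<in> {(A, Q). arc_wheel A Q}" using f by simp
  ultimately obtain AQ where m: "AQ \<in> {(A, Q). arc_wheel A Q}" "\<And>y. (y, AQ) \<in> r \<Longrightarrow> y \<notin> {(A, Q). arc_wheel A Q}"
    by (rule wfE_min) blast
  obtain A' Q' where AQ: "AQ = (A', Q')" by (cases AQ)
  have f': "arc_wheel A' Q'" using m(1) AQ by simp
  have best: "False" if "arc_wheel B S" "nbs x (B @ S) < nbs x (A' @ Q') \<or>
      nbs x (B @ S) = nbs x (A' @ Q') \<and> length (B @ S) < length (A' @ Q')" for B S
    using m(2)[of "(B, S)"] that unfolding AQ r_def by auto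
  obtain v where "improper x (A' @ Q') v" using minimal[of "A' @ Q'"] f' unfolding arc_wheel_def by blast
  then interpret min_rerouted adj x cs A' Q' v
  proof unfold_locales
    show "arc_wheel A' Q'" by (fact f')
    show False if "arc_wheel B S" "nbs x (B @ S) < nbs x (A' @ Q') \<or>
      nbs x (B @ S) = nbs x (A' @ Q') \<and> length (B @ S) < length (A' @ Q')" for B S
      using best[OF that] .
  qed
  show False by (rule contradiction)
qed
end

section \<open>Sectors and gaps\<close>

lemma distinct_split_eq:
  assumes "P @ c # S = P' @ c # S'" "distinct (P @ c # S)" shows "P = P' \<and> S = S'"
proof -
  have "c \<notin> set P" "c \<notin> set S" using assms(2) by auto
  then show ?thesis using assms(1) by (simp add: append_Cons_eq_iff)
qed

lemma first_split_eq:
  assumes "P @ c # S = P' @ c' # S'" "q c" "q c'" "\<forall>d \<in> set P. \<not> q d" "\<forall>d \<in> set P'. \<not> q d"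
  shows "P = P' \<and> c = c' \<and> S = S'"
  using assms(1) unfolding append_eq_append_conv2
proof (elim exE disjE conjE)
  fix us assume us: "P @ us = P'" "c # S = us @ c' # S'"
  then have "us = []" using assms(2,5) by (cases us) auto
  then show ?thesis using us by simp
next
  fix us assume us: "P = P' @ us" "us @ c # S = c' # S'"
  then have "us = []" using assms(3,4) by (cases us) auto
  then show ?thesis using us by simp
qed

section \<open>Induced connections inside walks\<close>

context sgraph begin

lemma walk_append: "walk (xs @ ys) \<Longrightarrow> walk xs \<and> walk ys"
proof (induction xs rule: walk.induct)
  case (2 a)
  then show ?case by (cases ys) auto
qed auto

lemma walk_ipath:
  assumes "walk P" "P \<noteq> []"
  shows "\<exists>P'. ipath P' \<and> P' \<noteq> [] \<and> hd P' = hd P \<and> last P' = last P \<and> set P' \<subseteq> set P"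
  using assms
proof (induction P rule: walk.induct)
  case (2 a)
  then show ?case by (intro exI[of _ "[a]"]) auto
next
  case (3 a b xs)
  then obtain P' where P: "ipath P'" "P' \<noteq> []" "hd P' = b" "last P' = last (b # xs)" "set P' \<subseteq> set (b # xs)"
    by auto
  show ?case
  proof (cases "a \<in> set P'")
    case True
    then obtain U V where "P' = U @ a # V" using split_list by metis
    then show ?thesis using P ipath_sub[of U "a # V" "[]"] by (intro exI[of _ "a # V"]) auto
  next
    case False
    have "\<exists>c \<in> set P'. adj a c" using 3(2) P(2,3) hd_in_set by force
    then obtain U c V where P': "P' = U @ c # V" "adj a c" "\<forall>d \<in> set V. \<not> adj a d"
      by (metis split_list_last_prop)
    have "ipath (c # V)" using P(1) P'(1) ipath_sub[of U "c # V" "[]"] by simp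
    then have "ipath (a # c # V)" using P' False by auto
    then show ?thesis using P P' by (intro exI[of _ "a # c # V"]) auto
  qed
qed auto

text \<open>The connection is found inside an arbitrary walk: it is first shortened to an induced
  path, and then a shortest segment seen by both \<open>c\<close> and \<open>c'\<close> is
  taken.\<close>

lemma walk_connect:
  assumes "walk P" "p \<in> set P" "q \<in> set P" "adj c p" "adj c' q"
  obtains P' where "ipath P'" "P' \<noteq> []" "set P' \<subseteq> set P"
    "\<forall>p \<in> set P'. adj c p \<longleftrightarrow> p = hd P'" "\<forall>p \<in> set P'. adj c' p \<longleftrightarrow> p = last P'"
proof -
  have sub: "\<exists>W. walk W \<and> W \<noteq> [] \<and> {hd W, last W} = {p, q} \<and> set W \<subseteq> set P"
  proof (cases "p = q")
    case True
    then show ?thesis using assms(2) by (intro exI[of _ "[p]"]) auto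
  next
    case False
    have w: "walk Y" if "P = X @ Y @ Z" for X Y Z
      using assms(1) that walk_append by metis
    from assms(2,3) False show ?thesis
    proof (rule mem_arc_between)
      fix X1 X2 X3 assume "P = X1 @ p # X2 @ q # X3"
      then show ?thesis using w[of X1 "p # X2 @ [q]" X3] by (intro exI[of _ "p # X2 @ [q]"]) auto
    next
      fix X1 X2 X3 assume "P = X1 @ q # X2 @ p # X3"
      then show ?thesis using w[of X1 "q # X2 @ [p]" X3] by (intro exI[of _ "q # X2 @ [p]"]) auto
    qed
  qed
  then obtain W where W: "walk W" "W \<noteq> []" "{hd W, last W} = {p, q}" "set W \<subseteq> set P" by blast
  obtain W' where W': "ipath W'" "W' \<noteq> []" "hd W' = hd W" "last W' = last W" "set W' \<subseteq> set W"
    using walk_ipath[OF W(1,2)] by blast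
  have "hd W' \<in> set W'" "last W' \<in> set W'" using W'(2) by auto
  then have pq: "p \<in> set W'" "q \<in> set W'" using W(3) W'(3,4) by (auto simp: doubleton_eq_iff)
  have ex: "\<exists>z \<in> set W'. adj c z" "\<exists>z \<in> set W'. adj c' z" using pq assms(4,5) by auto
  obtain u Z w where Z: "W' = u @ Z @ w" "Z \<noteq> []" and
    hl: "(\<forall>z \<in> set Z. (adj c z \<longleftrightarrow> z = hd Z) \<and> (adj c' z \<longleftrightarrow> z = last Z)) \<or>
     (\<forall>z \<in> set Z. (adj c' z \<longleftrightarrow> z = hd Z) \<and> (adj c z \<longleftrightarrow> z = last Z))"
    by (rule shortest_segment[OF ipath_distinct[OF W'(1)] ex])
  have ipZ: "ipath Z" using W'(1) Z(1) ipath_sub by blast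
  have sub: "set Z \<subseteq> set P" using Z(1) W'(5) W(4) by auto
  from hl show thesis
  proof
    assume "\<forall>z \<in> set Z. (adj c z \<longleftrightarrow> z = hd Z) \<and> (adj c' z \<longleftrightarrow> z = last Z)"
    then show thesis using that[of Z] ipZ Z(2) sub by blast
  next
    assume "\<forall>z \<in> set Z. (adj c' z \<longleftrightarrow> z = hd Z) \<and> (adj c z \<longleftrightarrow> z = last Z)"
    then show thesis using that[of "rev Z"] ipZ Z(2) sub by (simp add: ipath_rev hd_rev last_rev)
  qed
qed

lemma icyc_arc_cross:
  assumes "icyc (a # M @ b # R)" "R \<noteq> []" "c \<in> set (a # M @ [b])" "d \<in> set R"
  shows "adj c d \<longleftrightarrow> c = b \<and> d = hd R \<or> c = a \<and> d = last R"
proof -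
  have "icyc ((a # M @ [b]) @ R)" using assms(1) by simp
  then have "adj c d \<longleftrightarrow> c = last (a # M @ [b]) \<and> d = hd R \<or> c = hd (a # M @ [b]) \<and> d = last R"
    using icyc_append[of "a # M @ [b]" R] assms(2-) by blast
  then show ?thesis by simp
qed

lemma icyc_arc_path:
  assumes "icyc (c # B @ c' # R)" "R \<noteq> []" "ipath P'" "P' \<noteq> []" "set P' \<inter> set (c # B @ [c']) = {}"
    "\<forall>p \<in> set P'. adj c p \<longleftrightarrow> p = hd P'" "\<forall>p \<in> set P'. adj c' p \<longleftrightarrow> p = last P'"
    "\<forall>b \<in> set B. \<forall>p \<in> set P'. \<not> adj b p"
  shows "icyc ((c # B @ [c']) @ rev P')"
proof -
  have ip: "ipath (c # B @ [c'])" using icyc_arc[of "c # B @ [c']" R] assms(1,2) by simp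
  have d: "distinct (c # B @ [c'])" using ip ipath_distinct by blast
  have ne: "c # B @ [c'] \<noteq> []" "rev P' \<noteq> []" using assms(4) by auto
  have "adj a b \<longleftrightarrow> a = last (c # B @ [c']) \<and> b = hd (rev P') \<or> a = hd (c # B @ [c']) \<and> b = last (rev P')"
    if "a \<in> set (c # B @ [c'])" "b \<in> set (rev P')" for a b
  proof -
    have b: "b \<in> set P'" "hd (rev P') = last P'" "last (rev P') = hd P'" using that(2) assms(4) by (auto simp: hd_rev last_rev)
    from that(1) consider "a = c" | "a \<in> set B" | "a = c'" by auto
    then show ?thesis
    proof cases
      case 1
      then show ?thesis using assms(6) b d by auto
    next
      case 2
      then show ?thesis using assms(8) b d by auto
    next
      case 3
      then show ?thesis using assms(7) b d by auto
    qed
  qed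
  moreover have "length ((c # B @ [c']) @ rev P') \<ge> 3" using assms(4) by (cases P') auto
  moreover have "set (c # B @ [c']) \<inter> set (rev P') = {}" using assms(5) by auto
  moreover have "ipath (rev P')" using assms(3) by (simp add: ipath_rev)
  ultimately show ?thesis unfolding icyc_append[OF ne] using ip by blast
qed

end

section \<open>Sectors as sets and their Helly property\<close>

context min_wheel begin

abbreviation os :: "'a set \<Rightarrow> bool" where "os \<equiv> one_sector x cs"

definition next_spoke :: "'a \<Rightarrow> 'a \<Rightarrow> bool" where
  "next_spoke a b \<longleftrightarrow> (\<exists>M R. rot cs (a # M @ b # R) \<and> nbs x M = 0 \<and> adj x a \<and> adj x b)"

lemma distinct_cs: "distinct cs"
  using icyc_distinct[OF cyc] .

lemma rot_dist: "rot cs l \<Longrightarrow> distinct l"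
  using rot_distinct distinct_cs by blast

lemma next_spoke_unique:
  assumes "next_spoke a b" "next_spoke a b'" shows "b = b'"
proof -
  obtain M R M' R' where 1: "rot cs (a # M @ b # R)" "nbs x M = 0" "rot cs (a # M' @ b' # R')" "nbs x M' = 0"
    "adj x b" "adj x b'"
    using assms unfolding next_spoke_def by blast
  have "M @ b # R = M' @ b' # R'" using rot_unique[OF distinct_cs 1(1,3)] .
  then have "M = M' \<and> b = b' \<and> R = R'"
    by (rule first_split_eq[of _ _ _ _ _ _ "adj x"]) (use 1 in \<open>auto simp: nbs_0\<close>)
  then show ?thesis by blast
qed

lemma nxt_unique':
  assumes "next_spoke a b" "next_spoke a' b" shows "a = a'"
proof -
  obtain M R M' R' where 1: "rot cs (a # M @ b # R)" "nbs x M = 0" "rot cs (a' # M' @ b # R')" "nbs x M' = 0"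
    "adj x a" "adj x a'"
    using assms unfolding next_spoke_def by blast
  have "rot (a # M @ b # R) (b # R @ a # M)" "rot (a' # M' @ b # R') (b # R' @ a' # M')"
    using rotI[of "a # M" "b # R"] rotI[of "a' # M'" "b # R'"] by simp_all
  then have "R @ a # M = R' @ a' # M'" using rot_unique[OF distinct_cs] rot_trans 1 by metis
  then have "rev (R @ a # M) = rev (R' @ a' # M')" by (rule arg_cong)
  then have "rev M @ a # rev R = rev M' @ a' # rev R'" by simp
  then have "rev M = rev M' \<and> a = a' \<and> rev R = rev R'"
    by (rule first_split_eq[of _ _ _ _ _ _ "adj x"]) (use 1 in \<open>auto simp: nbs_0\<close>)
  then show ?thesis by blast
qed

text \<open>Three consecutive spokes that close up cyclically would be all the spokes, but there are
  at least four.\<close>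

lemma next_spoke_triangle:
  assumes "next_spoke a b" "next_spoke b c" "next_spoke c a" "a \<noteq> c" "b \<noteq> c" shows False
proof -
  obtain M R where 1: "rot cs (a # M @ b # R)" "nbs x M = 0" "adj x a" "adj x b"
    using assms(1) unfolding next_spoke_def by blast
  obtain M' R' where 2: "rot cs (b # M' @ c # R')" "nbs x M' = 0" "adj x c"
    using assms(2) unfolding next_spoke_def by blast
  obtain M'' R'' where 3: "rot cs (c # M'' @ a # R'')" "nbs x M'' = 0"
    using assms(3) unfolding next_spoke_def by blast
  have r: "rot cs (b # R @ a # M)" using rot_trans[OF 1(1)] rotI[of "a # M" "b # R"] by simp
  then have e: "R @ a # M = M' @ c # R'" using rot_unique[OF distinct_cs r 2(1)] by simp
  have "c \<in> set (R @ a # M)" unfolding e by simp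
  moreover have "c \<notin> set M" using 1(2) 2(3) by (auto simp: nbs_0)
  ultimately obtain R1 R2 where R: "R = R1 @ c # R2" using assms(4) split_list by fastforce
  have "distinct (R1 @ c # R2 @ a # M)" using rot_dist[OF r] R by simp
  moreover have "R1 @ c # R2 @ a # M = M' @ c # R'" using e R by simp
  ultimately have "R1 = M'" using distinct_split_eq by metis
  then have n1: "nbs x R1 = 0" using 2(2) by simp
  have r2: "rot cs (c # R2 @ a # M @ b # R1)"
    using rot_trans[OF 1(1)] rotI[of "a # M @ b # R1" "c # R2"] R by simp
  then have "R2 @ a # M @ b # R1 = M'' @ a # R''" using rot_unique[OF distinct_cs r2 3(1)] by simp
  moreover have "distinct (R2 @ a # M @ b # R1)" using rot_dist[OF r2] by simp
  ultimately have "R2 = M''" using distinct_split_eq by metis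
  then have "nbs x R2 = 0" using 3(2) by simp
  then have "nbs x cs = 3" using nbs_rot[OF 1(1), of x] R n1 1 2(3) by simp
  then show False using spokes4 by simp
qed

lemma os_spokes:
  assumes "os {a, b}" "a \<noteq> b" "adj x a" "adj x b" "a \<in> set cs" "b \<in> set cs"
  shows "next_spoke a b \<or> next_spoke b a"
proof -
  obtain xs ys where xs: "rot cs (xs @ ys)" "{a, b} \<subseteq> set xs" "nbs x (butlast (tl xs)) = 0"
    using assms(1) unfolding one_sector_def by blast
  have key: "next_spoke c d" if X: "xs = X1 @ c # X2 @ d # X3" "adj x c" "adj x d" for X1 c X2 d X3
  proof -
    have "set X2 \<subseteq> set (butlast (tl xs))" using X(1)
      by (cases X1; cases X3 rule: rev_cases) (auto simp: butlast_append)
    then have "nbs x X2 = 0" using xs(3) by (auto simp: nbs_0)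
    moreover have "rot cs (c # X2 @ d # X3 @ ys @ X1)"
      using rot_trans[OF xs(1)] rotI[of X1 "c # X2 @ d # X3 @ ys"] X(1) by simp
    ultimately show ?thesis unfolding next_spoke_def using X by blast
  qed
  show ?thesis
    by (rule mem_arc_between[of a xs b]) (use xs(2) assms key in auto)
qed

lemma sector_of_nonspoke:
  assumes "e \<in> set cs" "\<not> adj x e"
  obtains a M1 M2 b R where "rot cs (a # M1 @ e # M2 @ b # R)" "adj x a" "adj x b" "nbs x M1 = 0" "nbs x M2 = 0"
proof -
  obtain Y where Y: "rot cs (e # Y)" using rot_start[OF assms(1)] by blast
  have n: "nbs x Y \<ge> 4" using nbs_rot[OF Y, of x] assms(2) spokes4 by simp
  then have "nbs x Y = Suc (nbs x Y - 1)" by simp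
  then obtain M2 b W where 1: "Y = M2 @ b # W" "adj x b" "nbs x M2 = 0" "nbs x W = nbs x Y - 1"
    by (rule nbs_Suc_first)
  then have "nbs x W = Suc (nbs x W - 1)" using n by linarith
  then obtain R a M1 where 2: "W = R @ a # M1" "adj x a" "nbs x M1 = 0" by (rule nbs_Suc_last)
  have "rot (e # Y) (a # M1 @ e # M2 @ b # R)"
    using rotI[of "e # M2 @ b # R" "a # M1"] 1(1) 2(1) by simp
  then show thesis using that[of a M1 M2 b R] rot_trans[OF Y] 1(2,3) 2(2,3) by blast
qed

text \<open>A rim vertex that is not a spoke lies in just one sector, because the nearest spokes on
  either side are determined. Whatever shares a sector with it lies there.\<close>

lemma os_nonspoke:
  assumes r: "rot cs (a # M1 @ e # M2 @ b # R)" "adj x a" "adj x b" "nbs x M1 = 0" "nbs x M2 = 0" "\<not> adj x e"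
    and os: "os {e, e'}"
  shows "e' \<in> set (a # M1 @ e # M2 @ [b])"
proof -
  obtain xs ys where xs: "rot cs (xs @ ys)" "{e, e'} \<subseteq> set xs" "nbs x (butlast (tl xs)) = 0"
    using os unfolding one_sector_def by blast
  have ne: "xs \<noteq> []" using xs(2) by auto
  have sp: "2 \<le> length (filter (adj x) cs)" using spokes4 by (simp add: nbs_def)
  have int: "\<forall>c \<in> set (butlast (tl xs)). \<not> adj x c" using xs(3) by (simp add: nbs_0)
  obtain a' M b' R' L1 L2 where E: "rot cs (a' # M @ b' # R')" "adj x a'" "adj x b'"
    "\<forall>c \<in> set M. \<not> adj x c" "a' # M @ [b'] = L1 @ xs @ L2"
    by (rule extend_arc[OF xs(1) ne int sp]) blast
  have sub: "{e, e'} \<subseteq> set (a' # M @ [b'])" using xs(2) unfolding E(5) by auto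
  then have "e \<in> set M" using assms(6) E(2,3) by auto
  then obtain N1 N2 where M: "M = N1 @ e # N2" using split_list by metis
  have r1: "rot cs (e # M2 @ b # R @ a # M1)"
    using rot_trans[OF r(1)] rotI[of "a # M1" "e # M2 @ b # R"] by simp
  have r2: "rot cs (e # N2 @ b' # R' @ a' # N1)"
    using rot_trans[OF E(1)] rotI[of "a' # N1" "e # N2 @ b' # R'"] M by simp
  have "M2 @ b # R @ a # M1 = N2 @ b' # R' @ a' # N1" using rot_unique[OF distinct_cs r1 r2] .
  then have "M2 = N2 \<and> b = b' \<and> R @ a # M1 = R' @ a' # N1"
    by (rule first_split_eq[of _ _ _ _ _ _ "adj x"]) (use assms E M in \<open>auto simp: nbs_0\<close>)
  then have e2: "M2 = N2" "b = b'" "R @ a # M1 = R' @ a' # N1" by auto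
  have "rev M1 @ a # rev R = rev N1 @ a' # rev R'"
    using arg_cong[OF e2(3), of rev] by simp
  then have "rev M1 = rev N1 \<and> a = a' \<and> rev R = rev R'"
    by (rule first_split_eq[of _ _ _ _ _ _ "adj x"]) (use assms E M in \<open>auto simp: nbs_0\<close>)
  then have "M1 = N1" "a = a'" by auto
  then show ?thesis using sub M e2 by auto
qed

lemma os_arc:
  assumes "rot cs (a # M @ b # R)" "nbs x M = 0" "T \<subseteq> set (a # M @ [b])" shows "os T"
  unfolding one_sector_def using assms by (intro exI[of _ "a # M @ [b]"] exI[of _ R]) auto

text \<open>A non-spoke in \<open>T\<close> determines the sector for all other members. If
  \<open>T\<close> consists of spokes, a third member would make three pairwise consecutive spokes,
  which \<open>next_spoke_triangle\<close> excludes.\<close>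

lemma helly:
  assumes "T \<subseteq> set cs" and pw: "\<And>c d. c \<in> T \<Longrightarrow> d \<in> T \<Longrightarrow> os {c, d}"
  shows "os T"
proof (cases "\<exists>e \<in> T. \<not> adj x e")
  case True
  then obtain e where e: "e \<in> T" "\<not> adj x e" by blast
  then obtain a M1 M2 b R where r: "rot cs (a # M1 @ e # M2 @ b # R)" "adj x a" "adj x b" "nbs x M1 = 0" "nbs x M2 = 0"
    using sector_of_nonspoke assms(1) by blast
  have "T \<subseteq> set (a # M1 @ e # M2 @ [b])"
    using os_nonspoke[OF r e(2)] pw[OF e(1)] by blast
  then show ?thesis using os_arc[of a "M1 @ e # M2" b R T] r e(2) by simp
next
  case False
  then have sp: "\<And>c. c \<in> T \<Longrightarrow> adj x c" by blast
  have n: "next_spoke c d \<or> next_spoke d c" if "c \<in> T" "d \<in> T" "c \<noteq> d" for c d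
    using os_spokes[OF pw[OF that(1,2)] that(3)] sp that assms(1) by blast
  show ?thesis
  proof (cases "\<exists>c d e. c \<in> T \<and> d \<in> T \<and> e \<in> T \<and> c \<noteq> d \<and> d \<noteq> e \<and> c \<noteq> e")
    case True
    then obtain c d e where t: "c \<in> T" "d \<in> T" "e \<in> T" "c \<noteq> d" "d \<noteq> e" "c \<noteq> e" by blast
    have tri: False if "next_spoke c d" "c \<in> T" "d \<in> T" "e \<in> T" "c \<noteq> d" "d \<noteq> e" "c \<noteq> e" for c d e
    proof -
      have "\<not> next_spoke c e" using next_spoke_unique that by blast
      then have "next_spoke e c" using n that by blast
      have "\<not> next_spoke e d" using nxt_unique' that by blast
      then have "next_spoke d e" using n that by blast
      then show False using next_spoke_triangle that \<open>next_spoke e c\<close> by blast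
    qed
    have "next_spoke c d \<or> next_spoke d c" using n t by blast
    then show ?thesis using tri[of c d e] tri[of d c e] t by blast
  next
    case False
    then obtain c d where "T \<subseteq> {c, d}" "T = {} \<or> c \<in> T \<and> d \<in> T" by blast
    then show ?thesis
    proof (cases "T = {}")
      case True
      then show ?thesis unfolding one_sector_def by (intro exI[of _ "[]"] exI[of _ cs]) auto
    next
      case False
      then show ?thesis using \<open>T \<subseteq> {c, d}\<close> \<open>T = {} \<or> c \<in> T \<and> d \<in> T\<close> pw one_sector_mono by blast
    qed
  qed
qed

text \<open>The properties of a sector that do not refer to its position on the rim.\<close>

definition sector_like :: "'a set \<Rightarrow> bool" where
  "sector_like S \<longleftrightarrow> S \<subseteq> set cs \<and> card {c \<in> S. adj x c} \<le> 2 \<and>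
     (\<forall>e \<in> S. \<not> adj x e \<longrightarrow> (\<forall>e' \<in> set cs. adj e e' \<longrightarrow> e' \<in> S))"

lemma os_secset:
  assumes "os T" obtains S where "sector_like S" "T \<subseteq> S"
proof -
  obtain xs ys where xs: "rot cs (xs @ ys)" "T \<subseteq> set xs" "nbs x (butlast (tl xs)) = 0"
    using assms unfolding one_sector_def by blast
  show thesis
  proof (cases "xs = []")
    case True
    then show thesis using that[of "{}"] xs(2) by (simp add: sector_like_def)
  next
    case ne: False
    have sp: "2 \<le> length (filter (adj x) cs)" using spokes4 by (simp add: nbs_def)
    have int: "\<forall>c \<in> set (butlast (tl xs)). \<not> adj x c" using xs(3) by (simp add: nbs_0)
    obtain a M b R L1 L2 where E: "rot cs (a # M @ b # R)" "adj x a" "adj x b"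
      "\<forall>c \<in> set M. \<not> adj x c" "a # M @ [b] = L1 @ xs @ L2"
      by (rule extend_arc[OF xs(1) ne int sp]) blast
    have n: "nbs x cs = 2 + nbs x R" using nbs_rot[OF E(1), of x] E(2-4) nbs_0[of x M] by simp
    have Rne: "R \<noteq> []" using n spokes4 by auto
    note cr = icyc_arc_cross[OF icyc_rot[OF E(1) cyc] Rne]
    have set: "set cs = set (a # M @ [b]) \<union> set R" using rot_set[OF E(1)] by auto
    have "sector_like (set (a # M @ [b]))"
      unfolding sector_like_def
    proof (intro conjI ballI impI)
      show "set (a # M @ [b]) \<subseteq> set cs" using set by blast
      have "{c \<in> set (a # M @ [b]). adj x c} \<subseteq> {a, b}" using E(4) by auto
      then show "card {c \<in> set (a # M @ [b]). adj x c} \<le> 2"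
        by (metis card_2_iff card_mono dual_order.refl finite.emptyI finite.insertI insert_absorb2 is_singletonI is_singleton_altdef le_trans one_le_numeral)
      fix e e' assume e: "e \<in> set (a # M @ [b])" "\<not> adj x e" "e' \<in> set cs" "adj e e'"
      show "e' \<in> set (a # M @ [b])"
      proof (rule ccontr)
        assume "e' \<notin> set (a # M @ [b])"
        then have "e' \<in> set R" using e(3) set by blast
        then have "e = b \<or> e = a" using cr[OF e(1)] e(4) by blast
        then show False using e(2) E(2,3) by blast
      qed
    qed
    moreover have "T \<subseteq> set (a # M @ [b])" using xs(2) unfolding E(5) by auto
    ultimately show thesis using that by blast
  qed
qed

text \<open>Along the rim a \<open>sector_like\<close> set can be left only through a spoke, since
  it is closed under rim neighbours of its non-spokes. Arguments of this kind replace bookkeeping of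
  positions on the cyclic list.\<close>

lemma sector_like_walk:
  assumes "sector_like S" "walk l" "set l \<subseteq> set cs" "l \<noteq> []" "hd l \<in> S" "\<forall>e \<in> set (butlast l). \<not> adj x e"
  shows "last l \<in> S"
  using assms(2-6)
proof (induction l rule: walk.induct)
  case (3 a b l)
  then have "b \<in> S" using assms(1) unfolding sector_like_def by auto
  then show ?case using 3 by auto
qed auto

text \<open>Here the exclusion of \<open>arc_wheel\<close> enters the study of paths: the gap closed
  up through \<open>P'\<close> is a rerouted rim.\<close>

lemma gap_bound:
  assumes r: "rot cs (c # B @ c' # R)" and P: "ipath P'" "P' \<noteq> []" "set P' \<inter> set cs = {}" "x \<notin> set P'"
    "\<forall>p \<in> set P'. adj c p \<longleftrightarrow> p = hd P'" "\<forall>p \<in> set P'. adj c' p \<longleftrightarrow> p = last P'"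
    "\<forall>b \<in> set B. \<forall>p \<in> set P'. \<not> adj b p" "nbs x P' \<le> 1"
    and k: "3 \<le> nbs x (c # B @ [c']) + nbs x P'" "nbs x (c # B @ [c']) + nbs x P' < nbs x cs"
  shows False
proof -
  have ic: "icyc (c # B @ c' # R)" using icyc_rot[OF r cyc] .
  have sub: "set (c # B @ [c']) \<subseteq> set cs" using rot_set[OF r] by auto
  have R: "R \<noteq> []"
  proof
    assume "R = []"
    then show False using nbs_rot[OF r, of x] k(2) by simp
  qed
  have ic2: "icyc ((c # B @ [c']) @ rev P')"
    by (rule icyc_arc_path[OF ic R P(1,2) _ P(5-7)]) (use P(3) sub in auto)
  have "nbs x (butlast (tl (rev P'))) \<le> nbs x P'"
  proof -
    have "nbs x (tl (rev P')) \<le> nbs x (rev P')" by (cases "rev P'") auto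
    moreover have "nbs x (butlast (tl (rev P'))) \<le> nbs x (tl (rev P'))"
      by (cases "tl (rev P')" rule: rev_cases) auto
    ultimately show ?thesis by simp
  qed
  then have "arc_wheel (c # B @ [c']) (rev P')"
    unfolding arc_wheel_def using ic2 sub P xcs k by auto
  then show False using no_fam by blast
qed

end

section \<open>Paths attached to a proper wheel\<close>

context forbidden begin

lemma no_wheel2_rev_path:
  assumes H: "icyc H" "x \<notin> set H" "nbs x H = 2" "t \<in> set H" "\<not> adj x t"
    and U: "ipath (U @ [u])" "set (U @ [u]) \<inter> set H = {}" "x \<notin> set (U @ [u])" "adj x u" "nbs x U = 0"
    and e: "\<And>g y. g \<in> set (U @ [u]) \<Longrightarrow> y \<in> set H \<Longrightarrow> adj g y \<longleftrightarrow> g = hd (U @ [u]) \<and> y = t"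
  shows False
proof (rule no_wheel2_path[OF H(1-5), of "rev (U @ [u])"])
  show "\<forall>z\<in>set (rev (U @ [u])). adj x z \<longleftrightarrow> z = hd (rev (U @ [u]))"
    using U(1,4,5) by (auto simp: nbs_0)
  have "last (rev (U @ [u])) = hd (U @ [u])" by (simp add: last_rev del: rev_append)
  then show "\<forall>z\<in>set (rev (U @ [u])). \<forall>y\<in>set H. adj z y \<longleftrightarrow> z = last (rev (U @ [u])) \<and> y = t"
    using e by (metis set_rev)
  show "ipath (rev (U @ [u]))" using U(1) by (simp only: ipath_rev)
qed (use U in auto)

end

context min_wheel begin

text \<open>
  A path whose two ends attach in the opposite arcs \<open>D\<close> and \<open>E\<close> of a rim with four spokes, two of
  them on either side.
\<close>

definition layout :: "'a list \<Rightarrow> 'a list \<Rightarrow> 'a list \<Rightarrow> 'a list \<Rightarrow> 'a list \<Rightarrow> bool" where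
  "layout D Y E Y' P \<longleftrightarrow> rot cs (D @ Y @ E @ Y') \<and> D \<noteq> [] \<and> E \<noteq> [] \<and>
     ipath P \<and> length P \<ge> 2 \<and> set P \<inter> set cs = {} \<and> x \<notin> set P \<and> nbs x P = 0 \<and>
     (\<forall>p \<in> set P. \<forall>c \<in> set cs. adj p c \<longleftrightarrow>
        p = hd P \<and> (c = hd D \<or> c = last D) \<or> p = last P \<and> (c = hd E \<or> c = last E)) \<and>
     nbs x (last D # Y @ [hd E]) = 2 \<and> nbs x (last E # Y' @ [hd D]) = 2 \<and>
     (length D = 1 \<longrightarrow> \<not> adj x (hd D)) \<and> (length E = 1 \<longrightarrow> \<not> adj x (hd E))"

lemma layout_swap: "layout D Y E Y' P \<Longrightarrow> layout E Y' D Y (rev P)"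
proof -
  assume l: "layout D Y E Y' P"
  then have "rot cs (D @ Y @ E @ Y')" by (simp add: layout_def)
  then have "rot cs (E @ Y' @ D @ Y)" using rot_trans rotI[of "D @ Y" "E @ Y'"] by fastforce
  moreover have "hd (rev P) = last P" "last (rev P) = hd P" by (auto simp: hd_rev last_rev)
  ultimately show ?thesis using l unfolding layout_def by (auto simp: ipath_rev)
qed

text \<open>The cycle uses \<open>P\<close> and the side \<open>Y'\<close> of the rim. It has two
  spokes and leaves the side \<open>Y\<close> free for the third path of a subdivision.\<close>

lemma layout_cycle:
  assumes l: "layout D Y E Y' P" and D: "D = a # D'" and E: "E = E' @ [b']" and ne: "D' @ Y @ E' \<noteq> []"
  shows "rot cs (b' # Y' @ a # D' @ Y @ E')" "icyc ((b' # Y' @ [a]) @ P)" "nbs x ((b' # Y' @ [a]) @ P) = 2"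
    "x \<notin> set ((b' # Y' @ [a]) @ P)"
proof -
  have r0: "rot cs (D @ Y @ E @ Y')" and P: "ipath P" "length P \<ge> 2" "set P \<inter> set cs = {}" "x \<notin> set P" "nbs x P = 0"
    and attach: "\<And>p c. p \<in> set P \<Longrightarrow> c \<in> set cs \<Longrightarrow> adj p c \<longleftrightarrow>
        p = hd P \<and> (c = hd D \<or> c = last D) \<or> p = last P \<and> (c = hd E \<or> c = last E)"
    and k2: "nbs x (last E # Y' @ [hd D]) = 2"
    using l unfolding layout_def by blast+
  show r: "rot cs (b' # Y' @ a # D' @ Y @ E')"
    using rot_trans[OF r0] rotI[of "a # D' @ Y @ E'" "b' # Y'"] D E by simp
  have d: "distinct (b' # Y' @ a # D' @ Y @ E')" using rot_dist[OF r] .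
  have s: "set cs = set (b' # Y' @ a # D' @ Y @ E')" using rot_set[OF r] .
  have Pne: "P \<noteq> []" using P(2) by auto
  have lD: "last D \<in> set (a # D')" "hd D = a" using D last_in_set[of D] by auto
  have hE: "hd E \<in> set (E' @ [b'])" "last E = b'" using E hd_in_set[of E] by auto
  have ab: "adj b' p \<longleftrightarrow> p = last P" if "p \<in> set P" for p
  proof -
    have "b' \<in> set cs" "b' \<noteq> a" "b' \<noteq> last D" using s d lD by auto
    then show ?thesis using attach[OF that, of b'] hE lD adj_commute[of b' p] by blast
  qed
  have aa: "adj a p \<longleftrightarrow> p = hd P" if "p \<in> set P" for p
  proof -
    have "a \<in> set cs" "a \<noteq> b'" "a \<noteq> hd E" using s d hE by auto
    then show ?thesis using attach[OF that, of a] hE lD adj_commute[of a p] by blast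
  qed
  have aY: "\<not> adj c p" if "p \<in> set P" "c \<in> set Y'" for p c
  proof -
    have "c \<in> set cs" "c \<noteq> a" "c \<noteq> b'" "c \<noteq> last D" "c \<noteq> hd E" using s d that lD hE by auto
    then show ?thesis using attach[OF that(1), of c] hE lD adj_commute[of c p] by blast
  qed
  have "icyc ((b' # Y' @ [a]) @ rev (rev P))"
  proof (rule icyc_arc_path[OF icyc_rot[OF r cyc] ne])
    show "ipath (rev P)" using P(1) by (simp add: ipath_rev)
    show "set (rev P) \<inter> set (b' # Y' @ [a]) = {}" using P(3) s by auto
    show "\<forall>p\<in>set (rev P). adj b' p \<longleftrightarrow> p = hd (rev P)" using ab by (simp add: hd_rev)
    show "\<forall>p\<in>set (rev P). adj a p \<longleftrightarrow> p = last (rev P)" using aa by (simp add: last_rev)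
    show "\<forall>b\<in>set Y'. \<forall>p\<in>set (rev P). \<not> adj b p" using aY by simp
  qed (use Pne in auto)
  then show "icyc ((b' # Y' @ [a]) @ P)" by simp
  show "nbs x ((b' # Y' @ [a]) @ P) = 2" using k2 lD hE P(5) by simp
  show "x \<notin> set ((b' # Y' @ [a]) @ P)" using xcs s P(4) by auto
qed

text \<open>The third path runs from the first spoke on the free side back towards \<open>D\<close>.
  It ends at the only vertex of \<open>D\<close>, or, if \<open>D\<close> has at least three
  vertices, at \<open>hd P\<close> by way of \<open>last D\<close>. With exactly two vertices,
  \<open>last D\<close> would see both \<open>a\<close> and \<open>hd P\<close>, and the path would
  attach twice.\<close>

lemma layout_first:
  assumes l: "layout D Y E Y' P" and D: "length D \<noteq> 2" shows False
proof -
  have r0: "rot cs (D @ Y @ E @ Y')" and ne: "D \<noteq> []" "E \<noteq> []"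
    and P: "ipath P" "length P \<ge> 2" "set P \<inter> set cs = {}" "x \<notin> set P" "nbs x P = 0"
    and attach: "\<And>p c. p \<in> set P \<Longrightarrow> c \<in> set cs \<Longrightarrow> adj p c \<longleftrightarrow>
        p = hd P \<and> (c = hd D \<or> c = last D) \<or> p = last P \<and> (c = hd E \<or> c = last E)"
    and k1: "nbs x (last D # Y @ [hd E]) = 2"
    and sD: "length D = 1 \<longrightarrow> \<not> adj x (hd D)" and sE: "length E = 1 \<longrightarrow> \<not> adj x (hd E)"
    using l unfolding layout_def by blast+
  obtain a D' where D': "D = a # D'" using ne by (cases D) auto
  obtain E' b' where E': "E = E' @ [b']" using ne by (cases E rule: rev_cases) auto
  have Pne: "P \<noteq> []" using P(2) by auto
  define G where "G = (if D' = [] then Y else last D # Y)"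
  have nG: "nbs x G + (if adj x (hd E) then 1 else 0) = 2"
    using k1 sD D' unfolding G_def by (cases "D' = []") auto
  have "nbs x G \<ge> 1" using nG by (auto split: if_splits)
  then have "nbs x G = Suc (nbs x G - 1)" by simp
  then obtain U u W where U: "G = U @ u # W" "adj x u" "nbs x U = 0" "nbs x W = nbs x G - 1"
    by (rule nbs_Suc_first)
  obtain D0 where D0: "D' @ Y = D0 @ G" "D' = [] \<longrightarrow> D0 = []" "D' \<noteq> [] \<longrightarrow> D0 \<noteq> [] \<and> last D \<notin> set (a # D0)"
  proof (cases D' rule: rev_cases)
    case Nil
    then show ?thesis using that[of "[]"] by (simp add: G_def)
  next
    case (snoc D0 d)
    have "D0 \<noteq> []" using D D' snoc by (cases D0) auto
    moreover have "last D = d" using D' snoc by simp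
    moreover have "distinct (a # D0 @ [d])" using rot_dist[OF r0] D' snoc by auto
    ultimately show ?thesis using that[of D0] snoc by (auto simp: G_def)
  qed
  have rne: "D' @ Y @ E' \<noteq> []" using D0(1) U(1) by (metis Nil_is_append_conv list.distinct(1) append.assoc)
  note c = layout_cycle[OF l D' E' rne]
  have R: "D' @ Y @ E' = D0 @ U @ u # W @ E'" using D0(1) U(1) by (metis append.assoc append_Cons)
  have d: "distinct (b' # Y' @ a # D0 @ U @ u # W @ E')" using rot_dist[OF c(1)] R by simp
  have s: "set cs = set (b' # Y' @ a # D0 @ U @ u # W @ E')" using rot_set[OF c(1)] R by simp
  have ic: "icyc (b' # Y' @ a # D' @ Y @ E')" using icyc_rot[OF c(1) cyc] .
  have "D' @ Y @ E' \<noteq> []" by fact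
  then have "ipath (D' @ Y @ E')"
    using ic icyc_append[of "b' # Y' @ [a]" "D' @ Y @ E'"] by simp
  then have ipU: "ipath (U @ [u])" unfolding R using ipath_sub[of D0 "U @ [u]" "W @ E'"] by simp
  \<comment> \<open>Part of the rim must separate the spoke \<open>u\<close> from \<open>b'\<close>.
    If \<open>E\<close> is a single vertex, that vertex is no spoke, so \<open>G\<close> has a
    second spoke after \<open>u\<close>.\<close>
  have WE: "W @ E' \<noteq> []"
  proof
    assume "W @ E' = []"
    then have "W = []" "length E = 1" using E' by auto
    then have "\<not> adj x (hd E)" "nbs x G = 1" using sE U by auto
    then show False using nG by simp
  qed
  have lR: "last (D' @ Y @ E') \<notin> set (U @ [u])"
  proof -
    have "D' @ Y @ E' = (D0 @ U @ [u]) @ (W @ E')" using R by simp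
    then have "last (D' @ Y @ E') = last (W @ E')" using last_appendR[OF WE] by metis
    then have "last (D' @ Y @ E') \<in> set (W @ E')" using WE last_in_set by metis
    then show ?thesis using d by auto
  qed
  have cr: "adj g y \<longleftrightarrow> y = a \<and> g = hd (D' @ Y @ E')" if "g \<in> set (U @ [u])" "y \<in> set (b' # Y' @ [a])" for g y
  proof -
    have "g \<in> set (D' @ Y @ E')" unfolding R using that(1) by auto
    then have "adj y g \<longleftrightarrow> y = a \<and> g = hd (D' @ Y @ E') \<or> y = b' \<and> g = last (D' @ Y @ E')"
      using icyc_arc_cross[OF ic rne that(2)] by blast
    moreover have "g \<noteq> last (D' @ Y @ E')" using lR that(1) by blast
    ultimately show ?thesis using adj_commute[of y g] by blast
  qed
  have hdE: "hd E \<notin> set (U @ [u])" "last E \<notin> set (U @ [u])"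
    using E' d hd_in_set[of E] by auto
  have UP: "adj g p \<longleftrightarrow> p = hd P \<and> (g = hd D \<or> g = last D)" if "g \<in> set (U @ [u])" "p \<in> set P" for g p
  proof -
    have "g \<in> set cs" "g \<noteq> hd E" "g \<noteq> last E" using that s hdE by auto
    then show ?thesis using attach[OF that(2), of g] adj_commute[of p g] by blast
  qed
  have hdD: "hd D \<notin> set (U @ [u])" using D' d by auto
  have common: "ipath (U @ [u])" "set (U @ [u]) \<inter> set ((b' # Y' @ [a]) @ P) = {}" "x \<notin> set (U @ [u])"
    using ipU d s P(3) xcs by auto
  show False
  proof (cases "D' = []")
    case True
    have hR: "hd (D' @ Y @ E') = hd (U @ [u])" unfolding R using D0(2) True by (cases U) auto
    have lD: "last D = a" "hd D = a" using D' True by auto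
    have e: "adj g y \<longleftrightarrow> g = hd (U @ [u]) \<and> y = a" if "g \<in> set (U @ [u])" "y \<in> set ((b' # Y' @ [a]) @ P)" for g y
    proof (cases "y \<in> set P")
      case yP: True
      have "y \<noteq> a" using yP P(3) s by auto
      then show ?thesis using UP[OF that(1) yP] hdD lD that(1) by metis
    next
      case False
      then have "y \<in> set (b' # Y' @ [a])" using that(2) by simp
      then show ?thesis using cr[OF that(1)] hR by metis
    qed
    have "\<not> adj x a" using sD D' True by simp
    then show False
      using no_wheel2_rev_path[OF c(2,4,3), of a U u] common U(2,3) e by auto
  next
    case False
    have D0': "D0 \<noteq> []" "last D \<notin> set (a # D0)" using D0(3) False by auto
    have hR: "hd (D' @ Y @ E') = hd D0" unfolding R using D0' by simp
    have hU: "hd (U @ [u]) = last D" using U(1) False unfolding G_def by (cases U) auto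
    have "hd D0 \<in> set D0" using D0'(1) by simp
    moreover have "set D0 \<inter> set (U @ [u]) = {}" using d by auto
    ultimately have hd0: "hd D0 \<notin> set (U @ [u])" by blast
    have e: "adj g y \<longleftrightarrow> g = hd (U @ [u]) \<and> y = hd P" if "g \<in> set (U @ [u])" "y \<in> set ((b' # Y' @ [a]) @ P)" for g y
    proof (cases "y \<in> set P")
      case yP: True
      have "g \<noteq> hd D" using hdD that(1) by metis
      then show ?thesis using UP[OF that(1) yP] hU by metis
    next
      case yn: False
      then have "y \<in> set (b' # Y' @ [a])" using that(2) by simp
      then have "\<not> adj g y" using cr[OF that(1), of y] hR hd0 that(1) by metis
      then show ?thesis using yn Pne hd_in_set by metis
    qed
    have "\<not> adj x (hd P)" using P(5) Pne by (simp add: nbs_0)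
    then show False
      using no_wheel2_rev_path[OF c(2,4,3), of "hd P" U u] common U(2,3) e Pne by auto
  qed
qed

text \<open>The three paths of the prism are \<open>P\<close> and the two sides of the rim; the
  triangles are formed by the ends of \<open>P\<close> with \<open>D\<close> and with
  \<open>E\<close>.\<close>

lemma layout_prism:
  assumes l: "layout D Y E Y' P" and "length D = 2" "length E = 2" shows False
proof -
  have r0: "rot cs (D @ Y @ E @ Y')"
    and P: "ipath P" "length P \<ge> 2" "set P \<inter> set cs = {}" "x \<notin> set P" "nbs x P = 0"
    and attach: "\<And>p c. p \<in> set P \<Longrightarrow> c \<in> set cs \<Longrightarrow> adj p c \<longleftrightarrow>
        p = hd P \<and> (c = hd D \<or> c = last D) \<or> p = last P \<and> (c = hd E \<or> c = last E)"
    using l unfolding layout_def by blast+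
  obtain a a' where D: "D = [a, a']" using assms(2) by (auto simp: length_Suc_conv numeral_2_eq_2)
  obtain b b' where E: "E = [b, b']" using assms(3) by (auto simp: length_Suc_conv numeral_2_eq_2)
  have r: "rot cs (a' # Y @ b # b' # Y' @ [a])"
    using rot_trans[OF r0] rotI[of "[a]" "a' # Y @ b # b' # Y'"] D E by simp
  have ic: "icyc (a' # Y @ b # b' # Y' @ [a])" using icyc_rot[OF r cyc] .
  have d: "distinct (a' # Y @ b # b' # Y' @ [a])" using rot_dist[OF r] .
  have s: "set cs = set (a' # Y @ b # b' # Y' @ [a])" using rot_set[OF r] .
  define q where "q = a' # Y @ [b]"
  define t where "t = a # rev Y' @ [b']"
  have t: "t = rev (b' # Y' @ [a])" unfolding t_def by simp
  have "icyc (q @ (b' # Y' @ [a]))" using ic unfolding q_def by simp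
  then have ipq: "ipath q" "ipath (b' # Y' @ [a])"
    using icyc_append[of q "b' # Y' @ [a]"] unfolding q_def by auto
  have ipt: "ipath t" unfolding t using ipq(2) by (simp only: ipath_rev)
  have qt: "\<forall>c\<in>set q. \<forall>d\<in>set t. adj c d \<longleftrightarrow> c = hd q \<and> d = hd t \<or> c = last q \<and> d = last t"
  proof (intro ballI)
    fix c e assume ce: "c \<in> set q" "e \<in> set t"
    have "e \<in> set (b' # Y' @ [a])" using ce(2) t by auto
    then have "adj c e \<longleftrightarrow> c = b \<and> e = b' \<or> c = a' \<and> e = a"
      using icyc_arc_cross[OF ic _ ce(1)[unfolded q_def], of e] by simp
    then show "adj c e \<longleftrightarrow> c = hd q \<and> e = hd t \<or> c = last q \<and> e = last t"
      unfolding q_def t_def by auto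
  qed
  have Pq: "\<forall>p\<in>set P. \<forall>c\<in>set q. adj p c \<longleftrightarrow> p = hd P \<and> c = hd q \<or> p = last P \<and> c = last q"
  proof (intro ballI)
    fix p c assume pc: "p \<in> set P" "c \<in> set q"
    have "c \<in> set cs" "c \<noteq> a" "c \<noteq> b'" using pc(2) s d unfolding q_def by auto
    then show "adj p c \<longleftrightarrow> p = hd P \<and> c = hd q \<or> p = last P \<and> c = last q"
      using attach[OF pc(1), of c] D E unfolding q_def by simp
  qed
  have Pt: "\<forall>p\<in>set P. \<forall>c\<in>set t. adj p c \<longleftrightarrow> p = hd P \<and> c = hd t \<or> p = last P \<and> c = last t"
  proof (intro ballI)
    fix p c assume pc: "p \<in> set P" "c \<in> set t"
    have "c \<in> set cs" "c \<noteq> a'" "c \<noteq> b" using pc(2) s d unfolding t_def by auto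
    then show "adj p c \<longleftrightarrow> p = hd P \<and> c = hd t \<or> p = last P \<and> c = last t"
      using attach[OF pc(1), of c] D E unfolding t_def by simp
  qed
  have "set q \<inter> set t = {}" using d unfolding q_def t_def by auto
  moreover have "set P \<inter> set q = {}" "set P \<inter> set t = {}" using P(3) s unfolding q_def t_def by auto
  moreover have "length q \<ge> 2" "length t \<ge> 2" unfolding q_def t_def by auto
  ultimately show False using no_prism[OF P(1) ipq(1) ipt P(2)] Pq Pt qt by blast
qed

lemma no_layout: "\<not> layout D Y E Y' P"
  using layout_first layout_prism layout_swap by blast

end

context sgraph begin

lemma walk_glue: "walk xs \<Longrightarrow> walk ys \<Longrightarrow> xs \<noteq> [] \<Longrightarrow> ys \<noteq> [] \<Longrightarrow> adj (last xs) (hd ys) \<Longrightarrow> walk (xs @ ys)"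
proof (induction xs rule: walk.induct)
  case (2 a)
  then show ?case by (cases ys) auto
qed auto

lemma walk_rev: "walk xs \<Longrightarrow> walk (rev xs)"
proof (induction xs rule: walk.induct)
  case (3 a b xs)
  have "walk (rev (b # xs) @ [a])"
    by (rule walk_glue) (use 3 adj_commute[of a b] in \<open>auto simp: last_rev\<close>)
  then show ?case by simp
qed auto

lemma walk_glue_tl: "walk xs \<Longrightarrow> walk ys \<Longrightarrow> xs \<noteq> [] \<Longrightarrow> ys \<noteq> [] \<Longrightarrow> last xs = hd ys \<Longrightarrow> walk (xs @ tl ys)"
proof (cases "tl ys = []")
  case False
  assume *: "walk xs" "walk ys" "xs \<noteq> []" "ys \<noteq> []" "last xs = hd ys"
  then obtain a b zs where "ys = a # b # zs" using False by (cases ys; cases "tl ys") auto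
  then show ?thesis using * walk_glue[of xs "tl ys"] by auto
qed auto

end

section \<open>Attachments of a path without a neighbour of the centre\<close>

context min_wheel begin

definition attach :: "'a list \<Rightarrow> 'a set" where
  "attach P = {c \<in> set cs. \<exists>p \<in> set P. adj p c}"

definition off_wheel :: "'a list \<Rightarrow> bool" where
  "off_wheel P \<longleftrightarrow> set P \<inter> set cs = {} \<and> x \<notin> set P"

lemma os_pair_arc:
  assumes r: "rot cs (b # M @ b' # W)" and os: "os {b, b'}"
  shows "nbs x M = 0 \<or> nbs x W = 0"
proof -
  obtain xs ys where xs: "rot cs (xs @ ys)" "{b, b'} \<subseteq> set xs" "nbs x (butlast (tl xs)) = 0"
    using os unfolding one_sector_def by blast
  have bb: "b \<noteq> b'" using rot_dist[OF r] by auto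
  have mid: "nbs x X2 = 0" "rot cs (c # X2 @ d # X3 @ ys @ X1)" if X: "xs = X1 @ c # X2 @ d # X3" for X1 c X2 d X3
  proof -
    have "set X2 \<subseteq> set (butlast (tl xs))" using X
      by (cases X1; cases X3 rule: rev_cases) (auto simp: butlast_append)
    then show "nbs x X2 = 0" using xs(3) by (auto simp: nbs_0)
    show "rot cs (c # X2 @ d # X3 @ ys @ X1)"
      using rot_trans[OF xs(1)] rotI[of X1 "c # X2 @ d # X3 @ ys"] X by simp
  qed
  have mem: "b \<in> set xs" "b' \<in> set xs" using xs(2) by auto
  from mem bb show ?thesis
  proof (rule mem_arc_between)
    fix X1 X2 X3 assume X: "xs = X1 @ b # X2 @ b' # X3"
    have e: "M @ b' # W = X2 @ b' # X3 @ ys @ X1" using rot_unique[OF distinct_cs r mid(2)[OF X]] .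
    have "distinct (M @ b' # W)" using rot_dist[OF r] by simp
    then have "M = X2" using distinct_split_eq[OF e] by blast
    then show ?thesis using mid(1)[OF X] by simp
  next
    fix X1 X2 X3 assume X: "xs = X1 @ b' # X2 @ b # X3"
    have r': "rot cs (b' # W @ b # M)" using rot_trans[OF r] rotI[of "b # M" "b' # W"] by simp
    have e: "W @ b # M = X2 @ b # X3 @ ys @ X1" using rot_unique[OF distinct_cs r' mid(2)[OF X]] .
    have "distinct (W @ b # M)" using rot_dist[OF r'] by simp
    then have "W = X2" using distinct_split_eq[OF e] by blast
    then show ?thesis using mid(1)[OF X] by simp
  qed
qed

lemma gap_connect:
  assumes P: "walk P" "off_wheel P" "nbs x P \<le> 1" "distinct P"
    and r: "rot cs (c # B @ c' # R)" "c \<in> attach P" "c' \<in> attach P" "\<forall>b \<in> set B. b \<notin> attach P"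
  obtains P' where "ipath P'" "P' \<noteq> []" "set P' \<subseteq> set P" "c \<in> attach P'" "c' \<in> attach P'"
    "\<not> (3 \<le> nbs x (c # B @ [c']) + nbs x P' \<and> nbs x (c # B @ [c']) + nbs x P' < nbs x cs)"
proof -
  obtain p q where pq: "p \<in> set P" "q \<in> set P" "adj c p" "adj c' q"
    using r(2,3) adj_commute unfolding attach_def by blast
  obtain P' where P': "ipath P'" "P' \<noteq> []" "set P' \<subseteq> set P"
    "\<forall>p \<in> set P'. adj c p \<longleftrightarrow> p = hd P'" "\<forall>p \<in> set P'. adj c' p \<longleftrightarrow> p = last P'"
    by (rule walk_connect[OF P(1) pq])
  have sub: "set (c # B @ [c']) \<subseteq> set cs" using rot_set[OF r(1)] by auto
  have hl: "hd P' \<in> set P'" "last P' \<in> set P'" using P'(2) by auto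
  have "adj (hd P') c" "adj (last P') c'"
    using hl P'(4,5) adj_commute[of _ c] adj_commute[of _ c'] by simp_all
  then have a: "c \<in> attach P'" "c' \<in> attach P'" using hl sub unfolding attach_def by auto
  have nb: "\<forall>b \<in> set B. \<forall>p \<in> set P'. \<not> adj b p"
  proof (intro ballI notI)
    fix b p assume "b \<in> set B" "p \<in> set P'" "adj b p"
    then have "b \<in> attach P" using P'(3) sub adj_commute[of b p] unfolding attach_def by auto
    then show False using r(4) \<open>b \<in> set B\<close> by blast
  qed
  have "nbs x P' \<le> 1" using nbs_subset[OF ipath_distinct[OF P'(1)] P'(3) P(4), of x] P(3) by simp
  moreover have "set P' \<inter> set cs = {}" "x \<notin> set P'" using P'(3) P(2) unfolding off_wheel_def by auto
  ultimately have "\<not> (3 \<le> nbs x (c # B @ [c']) + nbs x P' \<and> nbs x (c # B @ [c']) + nbs x P' < nbs x cs)"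
    using gap_bound[OF r(1) P'(1,2) _ _ P'(4,5) nb] by blast
  then show thesis using that P' a by blast
qed

lemma arc_att_complement:
  assumes r: "rot cs (c # B @ c' # R)" and nB: "\<forall>b \<in> set B. b \<notin> T" and T: "T \<subseteq> set cs"
  shows "rot cs ((c' # R @ [c]) @ B)" "T \<subseteq> set (c' # R @ [c])" "nbs x cs = nbs x (c # B @ [c']) + nbs x R"
proof -
  show "rot cs ((c' # R @ [c]) @ B)" using rot_trans[OF r] rotI[of "c # B" "c' # R"] by simp
  show "T \<subseteq> set (c' # R @ [c])" using T nB rot_set[OF r] by auto
  show "nbs x cs = nbs x (c # B @ [c']) + nbs x R" using nbs_rot[OF r, of x] by simp
qed

text \<open>By \<open>gap_connect\<close> a gap with three or more spokes must contain all of them.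
  Then the complementary arc has no inner spoke, and it would hold all attachments in one
  sector.\<close>

lemma free_gap:
  assumes P: "walk P" "off_wheel P" "nbs x P = 0" "distinct P" "\<not> os (attach P)"
    and r: "rot cs (c # B @ c' # R)" "c \<in> attach P" "c' \<in> attach P" "\<forall>b \<in> set B. b \<notin> attach P"
  shows "nbs x (c # B @ [c']) \<le> 2"
proof (rule ccontr)
  assume neg: "\<not> ?thesis"
  obtain P' where P': "set P' \<subseteq> set P"
    "\<not> (3 \<le> nbs x (c # B @ [c']) + nbs x P' \<and> nbs x (c # B @ [c']) + nbs x P' < nbs x cs)"
    using gap_connect[OF P(1,2) _ P(4) r] P(3) by auto
  have "nbs x P' = 0" using P(3) P'(1) by (auto simp: nbs_0)
  moreover have T: "attach P \<subseteq> set cs" by (auto simp: attach_def)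
  note co = arc_att_complement[OF r(1,4) T]
  ultimately have "nbs x R = 0" using P'(2) neg co(3) by linarith
  then have "os (attach P)" unfolding one_sector_def using co(1,2)
    by (intro exI[of _ "c' # R @ [c]"] exI[of _ B]) auto
  then show False using P(5) by blast
qed

lemma card_att_two:
  assumes "c \<in> T" "c' \<in> T" "c \<noteq> c'" "T \<subseteq> set cs"
  shows "2 \<le> length (filter (\<lambda>c. c \<in> T) cs)"
proof -
  have "card {c, c'} \<le> card {d \<in> set cs. d \<in> T}" by (rule card_mono) (use assms in auto)
  then show ?thesis using length_filter_eq_card[OF distinct_cs, of "\<lambda>c. c \<in> T"] assms(3) by simp
qed

text \<open>Next to a spoke outside \<open>S1 \<union> S2\<close>, neither adjacent sector has an
  attachment in its interior, because the \<open>sector_like\<close> set containing it would reach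
  the spoke. So some gap contains three spokes, against \<open>free_gap\<close>.\<close>

lemma spoke_covered:
  assumes P: "walk P" "off_wheel P" "nbs x P = 0" "distinct P" "\<not> os (attach P)"
    and cc: "c \<in> attach P" "c' \<in> attach P" "c \<noteq> c'"
    and S: "sector_like S1" "sector_like S2" "attach P \<subseteq> S1 \<union> S2"
    and u: "u \<in> set cs" "adj x u"
  shows "u \<in> S1 \<union> S2"
proof (rule ccontr)
  assume nu: "u \<notin> S1 \<union> S2"
  obtain Y where Y: "rot cs (u # Y)" using rot_start[OF u(1)] by blast
  have n: "nbs x Y \<ge> 3" using nbs_rot[OF Y, of x] u(2) spokes4 by simp
  then have "nbs x Y = Suc (nbs x Y - 1)" by simp
  then obtain T2 z2 W where 1: "Y = T2 @ z2 # W" "adj x z2" "nbs x T2 = 0" "nbs x W = nbs x Y - 1"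
    by (rule nbs_Suc_first)
  then have "nbs x W = Suc (nbs x W - 1)" using n by linarith
  then obtain R z1 T1 where 2: "W = R @ z1 # T1" "adj x z1" "nbs x T1 = 0" "nbs x R = nbs x W - 1"
    by (rule nbs_Suc_last)
  have Rne: "R \<noteq> []" using 1(4) 2(4) n by auto
  have r: "rot cs ((z1 # T1 @ u # T2 @ [z2]) @ R)"
    using rot_trans[OF Y] rotI[of "u # T2 @ z2 # R" "z1 # T1"] 1(1) 2(1) by simp
  have ip: "ipath (z1 # T1 @ u # T2 @ [z2])" using icyc_arc[OF icyc_rot[OF r cyc] Rne] .
  have sub: "set (z1 # T1 @ u # T2 @ [z2]) \<subseteq> set cs" using rot_set[OF r] by auto
  have none: "e \<notin> attach P" if "e \<in> set (T1 @ u # T2)" for e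
  proof
    assume eP: "e \<in> attach P"
    then obtain S where S': "sector_like S" "e \<in> S" "u \<notin> S" using S nu by blast
    then have "e \<noteq> u" by blast
    then consider "e \<in> set T1" | "e \<in> set T2" using \<open>e \<in> set (T1 @ u # T2)\<close> by auto
    then show False
    proof cases
      case 1
      then obtain U V where T1: "T1 = U @ e # V" using split_list by metis
      have w: "walk (e # V @ [u])"
        using ipath_walk[OF ipath_sub[of "z1 # U" "e # V @ [u]" "T2 @ [z2]"]] ip T1 by simp
      have "last (e # V @ [u]) \<in> S"
        by (rule sector_like_walk[OF S'(1) w]) (use sub T1 S'(2) 2(3) in \<open>auto simp: nbs_0\<close>)
      then show False using S'(3) by simp
    next
      case 2
      then obtain U V where T2: "T2 = U @ e # V" using split_list by metis
      have "ipath (u # U @ [e])" using ipath_sub[of "z1 # T1" "u # U @ [e]" "V @ [z2]"] ip T2 by simp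
      then have "ipath (rev (u # U @ [e]))" by (simp only: ipath_rev)
      then have w: "walk (e # rev U @ [u])" using ipath_walk by simp
      have "last (e # rev U @ [u]) \<in> S"
        by (rule sector_like_walk[OF S'(1) w]) (use sub T2 S'(2) \<open>nbs x T2 = 0\<close> in \<open>auto simp: nbs_0\<close>)
      then show False using S'(3) by simp
    qed
  qed
  have sT: "attach P \<subseteq> set cs" by (auto simp: attach_def)
  have int: "\<forall>e \<in> set (butlast (tl (z1 # T1 @ u # T2 @ [z2]))). e \<notin> attach P"
    using none by (auto simp: butlast_append)
  obtain a M b R' L1 L2 where E: "rot cs (a # M @ b # R')" "a \<in> attach P" "b \<in> attach P"
    "\<forall>c \<in> set M. c \<notin> attach P" "a # M @ [b] = L1 @ (z1 # T1 @ u # T2 @ [z2]) @ L2"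
    by (rule extend_arc[OF r _ int card_att_two[OF cc sT]]) auto
  have "nbs x (a # M @ [b]) \<ge> 3" unfolding E(5) using u(2) 1(2) 2(2) by simp
  then show False using free_gap[OF P E(1-4)] by simp
qed

text \<open>Properness leaves at most two neighbours, in one sector. \<open>D\<close> takes the
  spoke-free way between them and is a single vertex if there is only one.\<close>

lemma two_arms:
  assumes "v \<notin> set cs" "v \<noteq> x" "\<not> adj v x" "nbs v cs \<ge> 1"
  obtains D R where "rot cs (D @ R)" "D \<noteq> []" "\<forall>c \<in> set cs. adj v c \<longleftrightarrow> c = hd D \<or> c = last D"
    "nbs x (butlast (tl D)) = 0"
proof -
  have pr: "os {c \<in> set cs. adj v c}" "nbs v cs \<le> 2"
    using proper[of v] assms(1-3) unfolding improper_def by auto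
  consider "nbs v cs = Suc 0" | "nbs v cs = Suc 1" using pr(2) assms(4) by linarith
  then show thesis
  proof cases
    case 1
    then obtain u c w where c: "cs = u @ c # w" "adj v c" "nbs v u = 0" "nbs v w = 0" by (rule nbs_Suc_first)
    have "rot cs ([c] @ w @ u)" using c(1) rotI[of u "c # w"] by simp
    then show thesis using that[of "[c]" "w @ u"] c by (auto simp: nbs_0)
  next
    case 2
    then obtain u c w where c: "cs = u @ c # w" "adj v c" "nbs v u = 0" "nbs v w = 1" by (rule nbs_Suc_first)
    then have "nbs v w = Suc 0" by simp
    then obtain u' d w' where d: "w = u' @ d # w'" "adj v d" "nbs v u' = 0" "nbs v w' = 0" by (rule nbs_Suc_first)
    have N: "\<forall>e \<in> set cs. adj v e \<longleftrightarrow> e = c \<or> e = d" using c d by (auto simp: nbs_0)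
    have r: "rot cs (c # u' @ d # w' @ u)" using c(1) d(1) rotI[of u "c # u' @ d # w'"] by simp
    have r': "rot cs (d # (w' @ u) @ c # u')" using rot_trans[OF r] rotI[of "c # u'" "d # w' @ u"] by simp
    have "os {c, d}" by (rule one_sector_mono[OF pr(1)]) (use c d in auto)
    then have "nbs x u' = 0 \<or> nbs x (w' @ u) = 0" by (rule os_pair_arc[OF r])
    then show thesis
    proof
      assume "nbs x u' = 0"
      then show thesis using that[of "c # u' @ [d]" "w' @ u"] r N by auto
    next
      assume "nbs x (w' @ u) = 0"
      then show thesis using that[of "d # (w' @ u) @ [c]" u'] r' N by (auto simp: butlast_append)
    qed
  qed
qed


text \<open>For a shortest path whose ends attach without a common sector, the attachments of
  \<open>butlast P\<close> share one sector, and so do those of \<open>tl P\<close>. Two sectors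
  have at most four spokes but must cover all of them, so they are disjoint and only the two end
  vertices of the path attach at all. What remains is a \<open>layout\<close>.\<close>

lemma free_pair:
  assumes W: "walk W" "off_wheel W" "nbs x W = 0" "c \<in> attach W" "c' \<in> attach W"
  shows "os {c, c'}"
proof (rule ccontr)
  assume neg: "\<not> os {c, c'}"
  define bad where "bad P \<longleftrightarrow> ipath P \<and> P \<noteq> [] \<and> off_wheel P \<and> nbs x P = 0 \<and>
    (\<exists>d d'. d \<in> set cs \<and> d' \<in> set cs \<and> adj (hd P) d \<and> adj (last P) d' \<and> \<not> os {d, d'})" for P
  have "\<exists>P. bad P"
  proof -
    obtain p q where pq: "p \<in> set W" "q \<in> set W" "adj c p" "adj c' q"
      using W(4,5) adj_commute unfolding attach_def by blast
    obtain P' where P': "ipath P'" "P' \<noteq> []" "set P' \<subseteq> set W"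
      "\<forall>p \<in> set P'. adj c p \<longleftrightarrow> p = hd P'" "\<forall>p \<in> set P'. adj c' p \<longleftrightarrow> p = last P'"
      by (rule walk_connect[OF W(1) pq])
    have "adj (hd P') c" "adj (last P') c'"
      using P'(2,4,5) adj_commute[of _ c] adj_commute[of _ c'] by simp_all
    moreover have "c \<in> set cs" "c' \<in> set cs" using W(4,5) by (auto simp: attach_def)
    moreover have "off_wheel P'" "nbs x P' = 0" using W(2,3) P'(3) by (auto simp: off_wheel_def nbs_0)
    ultimately have "bad P'" unfolding bad_def using P'(1,2) neg by blast
    then show ?thesis by blast
  qed
  then obtain P where P: "bad P" "\<And>P'. bad P' \<Longrightarrow> length P \<le> length P'"
    using ex_has_least_nat[of bad _ length] by blast
  obtain d d' where ip: "ipath P" "P \<noteq> []" "off_wheel P" "nbs x P = 0"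
    and d: "d \<in> set cs" "d' \<in> set cs" "adj (hd P) d" "adj (last P) d'" "\<not> os {d, d'}"
    using P(1) unfolding bad_def by blast
  have hl: "hd P \<in> set P" "last P \<in> set P" using ip(2) by auto
  have vP: "p \<notin> set cs" "p \<noteq> x" "\<not> adj p x" if "p \<in> set P" for p
    using that ip(3,4) adj_commute[of p x] by (auto simp: off_wheel_def nbs_0)
  have same: "os {e, e'}" if "p \<in> set P" "e \<in> set cs" "e' \<in> set cs" "adj p e" "adj p e'" for p e e'
    using proper[of p] vP[OF that(1)] that one_sector_mono[of x cs "{c \<in> set cs. adj p c}" "{e, e'}"]
    unfolding improper_def by auto
  have sub: "os {e, e'}" if Q: "P = X @ Q @ Z" "X @ Z \<noteq> []" "Q \<noteq> []" and e: "e \<in> set cs" "e' \<in> set cs"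
    "adj (hd Q) e" "adj (last Q) e'" for X Q Z e e'
  proof (rule ccontr)
    assume "\<not> os {e, e'}"
    moreover have "ipath Q" "off_wheel Q" "nbs x Q = 0"
      using ip Q(1) ipath_sub[of X Q Z] by (auto simp: off_wheel_def)
    ultimately have "bad Q" unfolding bad_def using Q(3) e by blast
    then show False using P(2)[of Q] Q by (cases X; cases Z) auto
  qed
  have len: "length P \<ge> 2"
  proof (rule ccontr)
    assume "\<not> ?thesis"
    then obtain p where "P = [p]" using ip(2) by (cases P; cases "tl P") auto
    then show False using same[of p d d'] d by auto
  qed
  have hl': "hd P \<noteq> last P" using len ipath_distinct[OF ip(1)] by (cases P) auto
  have pair: "os {e, e'}" if pq: "p \<in> set P" "q \<in> set P" "e \<in> set cs" "e' \<in> set cs" "adj p e" "adj q e'"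
    and ne: "{p, q} \<noteq> {hd P, last P}" for p q e e'
  proof (cases "p = q")
    case True
    then show ?thesis using same pq by blast
  next
    case False
    from pq(1,2) False show ?thesis
    proof (rule mem_arc_between)
      fix X1 X2 X3 assume X: "P = X1 @ p # X2 @ q # X3"
      have "X1 @ X3 \<noteq> []" using ne X by auto
      then show ?thesis using sub[of X1 "p # X2 @ [q]" X3 e e'] X pq by simp
    next
      fix X1 X2 X3 assume X: "P = X1 @ q # X2 @ p # X3"
      have "X1 @ X3 \<noteq> []" using ne X by auto
      then have "os {e', e}" using sub[of X1 "q # X2 @ [p]" X3 e' e] X pq by simp
      then show ?thesis by (simp add: insert_commute)
    qed
  qed
  have attsub: "attach Q \<subseteq> set cs" for Q by (auto simp: attach_def)
  have "os (attach (butlast P))"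
  proof (rule helly[OF attsub])
    fix e e' assume "e \<in> attach (butlast P)" "e' \<in> attach (butlast P)"
    then obtain p q where pq: "p \<in> set (butlast P)" "q \<in> set (butlast P)" "adj p e" "adj q e'" "e \<in> set cs" "e' \<in> set cs"
      by (auto simp: attach_def)
    have "last P \<notin> set (butlast P)" using ipath_distinct[OF ip(1)] ip(2)
      by (metis append_butlast_last_id distinct_butlast not_distinct_conv_prefix)
    then have "{p, q} \<noteq> {hd P, last P}" using pq(1,2) by (auto simp: doubleton_eq_iff)
    then show "os {e, e'}" using pair[of p q e e'] pq in_set_butlastD by metis
  qed
  then obtain S1 where S1: "sector_like S1" "attach (butlast P) \<subseteq> S1" by (rule os_secset)
  have "os (attach (tl P))"
  proof (rule helly[OF attsub])
    fix e e' assume "e \<in> attach (tl P)" "e' \<in> attach (tl P)"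
    then obtain p q where pq: "p \<in> set (tl P)" "q \<in> set (tl P)" "adj p e" "adj q e'" "e \<in> set cs" "e' \<in> set cs"
      by (auto simp: attach_def)
    have "hd P \<notin> set (tl P)" using ipath_distinct[OF ip(1)] ip(2) by (cases P) auto
    then have "{p, q} \<noteq> {hd P, last P}" using pq(1,2) by (auto simp: doubleton_eq_iff)
    moreover have "p \<in> set P" "q \<in> set P" using pq ip(2) by (auto simp: list.set_sel(2))
    ultimately show "os {e, e'}" using pair[of p q e e'] pq by metis
  qed
  then obtain S2 where S2: "sector_like S2" "attach (tl P) \<subseteq> S2" by (rule os_secset)
  have hin: "p \<in> set (butlast P)" if "p \<in> set P" "p \<noteq> last P" for p
    using that ip(2) by (metis append_butlast_last_id Un_iff empty_iff insert_iff list.set(1) list.simps(15) set_append)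
  have tin: "p \<in> set (tl P)" if "p \<in> set P" "p \<noteq> hd P" for p
    using that ip(2) by (cases P) auto
  have D1: "e \<in> S1" if "e \<in> set cs" "adj p e" "p \<in> set P" "p \<noteq> last P" for p e
    using S1(2) hin[OF that(3,4)] that unfolding attach_def by blast
  have D2: "e \<in> S2" if "e \<in> set cs" "adj p e" "p \<in> set P" "p \<noteq> hd P" for p e
    using S2(2) tin[OF that(3,4)] that unfolding attach_def by blast
  have T: "attach P \<subseteq> S1 \<union> S2" using D1 D2 hl' unfolding attach_def by blast
  have dd: "d \<in> attach P" "d' \<in> attach P" using d hl unfolding attach_def by auto
  have nos: "\<not> os (attach P)" using one_sector_mono[of x cs "attach P" "{d, d'}"] dd d(5) by auto
  have ddne: "d \<noteq> d'"
  proof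
    assume "d = d'"
    obtain Y where "rot cs ([d] @ Y)" using rot_start[OF d(1)] by auto
    then have "os {d, d'}" unfolding one_sector_def using \<open>d = d'\<close> by (intro exI[of _ "[d]"] exI[of _ Y]) auto
    then show False using d(5) by blast
  qed
  note Pf = ipath_walk[OF ip(1)] ip(3,4) ipath_distinct[OF ip(1)] nos
  define Sp where "Sp = {c \<in> set cs. adj x c}"
  have cSp: "card Sp = nbs x cs" unfolding Sp_def using nbs_card[OF distinct_cs] by simp
  have cov: "Sp \<subseteq> S1 \<union> S2"
    using spoke_covered[OF Pf dd ddne S1(1) S2(1) T] unfolding Sp_def by blast
  have fin: "finite Sp" unfolding Sp_def by simp
  have c12: "card (S1 \<inter> Sp) \<le> 2" "card (S2 \<inter> Sp) \<le> 2"
  proof -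
    have "S1 \<inter> Sp = {c \<in> S1. adj x c}" "S2 \<inter> Sp = {c \<in> S2. adj x c}"
      using S1(1) S2(1) unfolding Sp_def sector_like_def by auto
    then show "card (S1 \<inter> Sp) \<le> 2" "card (S2 \<inter> Sp) \<le> 2" using S1(1) S2(1) by (auto simp: sector_like_def)
  qed
  have "Sp = (S1 \<inter> Sp) \<union> (S2 \<inter> Sp)" using cov by blast
  then have "card Sp + card ((S1 \<inter> Sp) \<inter> (S2 \<inter> Sp)) = card (S1 \<inter> Sp) + card (S2 \<inter> Sp)"
    using card_Un_Int[of "S1 \<inter> Sp" "S2 \<inter> Sp"] fin by simp
  then have "card ((S1 \<inter> Sp) \<inter> (S2 \<inter> Sp)) = 0" using c12 cSp spokes4 by linarith
  then have noSp: "S1 \<inter> S2 \<inter> Sp = {}" using fin by auto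
  \<comment> \<open>A common non-spoke would lead along the rim to a common spoke, and the count has
    just excluded those.\<close>
  have disj: "e \<notin> S2" if "e \<in> S1" for e
  proof
    assume "e \<in> S2"
    have ecs: "e \<in> set cs" using that S1(1) by (auto simp: sector_like_def)
    have "\<not> adj x e" using noSp that \<open>e \<in> S2\<close> ecs unfolding Sp_def by blast
    then obtain a M1 M2 b R where r: "rot cs (a # M1 @ e # M2 @ b # R)" "adj x a" "adj x b" "nbs x M1 = 0" "nbs x M2 = 0"
      using sector_of_nonspoke[OF ecs] by blast
    have "icyc ((e # M2 @ [b]) @ R @ a # M1)"
      using icyc_rot[OF _ cyc] rot_trans[OF r(1)] rotI[of "a # M1" "e # M2 @ b # R"] by simp
    then have w: "walk (e # M2 @ [b])" using ipath_walk icyc_arc by blast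
    have sb: "set (e # M2 @ [b]) \<subseteq> set cs" using rot_set[OF r(1)] by auto
    have nb: "\<forall>f \<in> set (butlast (e # M2 @ [b])). \<not> adj x f" using \<open>\<not> adj x e\<close> r(5) by (auto simp: nbs_0 butlast_append)
    have "b \<in> S1" "b \<in> S2"
      using sector_like_walk[OF S1(1) w sb _ _ nb] sector_like_walk[OF S2(1) w sb _ _ nb] that \<open>e \<in> S2\<close> by auto
    then show False using noSp r(3) sb unfolding Sp_def by auto
  qed
  have inner: "p = hd P \<or> p = last P" if "p \<in> set P" "e \<in> set cs" "adj p e" for p e
    using D1[OF that(2,3,1)] D2[OF that(2,3,1)] disj by blast
  have nge: "nbs (hd P) cs \<ge> 1" "nbs (last P) cs \<ge> 1"
    using d nbs_0[of "hd P" cs] nbs_0[of "last P" cs] by (auto simp: Suc_le_eq)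
  obtain D R where DR: "rot cs (D @ R)" "D \<noteq> []" "\<forall>c \<in> set cs. adj (hd P) c \<longleftrightarrow> c = hd D \<or> c = last D"
    "nbs x (butlast (tl D)) = 0"
    by (rule two_arms[OF vP[OF hl(1)] nge(1)])
  have sDR: "set cs = set D \<union> set R" using rot_set[OF DR(1)] by simp
  have hlD: "hd D \<in> set cs" "last D \<in> set cs" "adj (hd P) (hd D)" "adj (hd P) (last D)" using DR(2,3) sDR by auto
  have hlD1: "hd D \<in> S1" "last D \<in> S1" using D1 hlD hl(1) hl' by auto
  have notD: "e \<notin> set D" if e: "e \<in> set cs" "adj (last P) e" for e
  proof
    assume eD: "e \<in> set D"
    have e2: "e \<in> S2" using D2 e hl(2) hl' by auto
    then have ne: "e \<noteq> hd D" "e \<noteq> last D" using hlD1 disj by auto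
    obtain U V where UV: "D = U @ e # V" using eD split_list by metis
    then have "U \<noteq> []" "V \<noteq> []" using ne by auto
    then obtain h U' where U': "U = h # U'" by (cases U) auto
    have h: "h = hd D" using UV U' by simp
    have "set (U' @ [e]) \<subseteq> set (butlast (tl D))" using UV U' \<open>V \<noteq> []\<close> by (auto simp: butlast_append)
    then have nb: "\<forall>f \<in> set (U' @ [e]). \<not> adj x f" using DR(4) by (auto simp: nbs_0)
    have "icyc ((h # U' @ [e]) @ V @ R)" using icyc_rot[OF DR(1) cyc] UV U' by simp
    then have "ipath (h # U' @ [e])" using icyc_arc \<open>V \<noteq> []\<close> by blast
    then have "ipath (rev (h # U' @ [e]))" by (simp only: ipath_rev)
    then have w: "walk (e # rev U' @ [h])" using ipath_walk by simp
    have "last (e # rev U' @ [h]) \<in> S2"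
      by (rule sector_like_walk[OF S2(1) w]) (use e2 sDR UV U' nb in \<open>auto simp: butlast_append\<close>)
    then show False using h hlD1 disj by auto
  qed
  have inR: "e \<in> set R" if "e \<in> set cs" "adj (last P) e" for e
    using notD[OF that] that(1) sDR by blast
  obtain E0 R0 where E0: "rot cs (E0 @ R0)" "E0 \<noteq> []" "\<forall>c \<in> set cs. adj (last P) c \<longleftrightarrow> c = hd E0 \<or> c = last E0"
    "nbs x (butlast (tl E0)) = 0"
    by (rule two_arms[OF vP[OF hl(2)] nge(2)])
  have E0in: "hd E0 \<in> set R" "last E0 \<in> set R" "hd E0 \<in> set cs" "last E0 \<in> set cs"
    using inR E0(2,3) rot_set[OF E0(1)] by auto
  obtain Y E Y' where E: "R = Y @ E @ Y'" "E \<noteq> []" "nbs x (butlast (tl E)) = 0"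
    "\<forall>c \<in> set cs. adj (last P) c \<longleftrightarrow> c = hd E \<or> c = last E"
  proof (cases "hd E0 = last E0")
    case True
    obtain U V where "R = U @ hd E0 # V" using split_list[OF E0in(1)] by blast
    then show ?thesis using that[of U "[hd E0]" V] E0(3) True by auto
  next
    case False
    \<comment> \<open>Of the two arcs between the attachments of \<open>last P\<close>, the
      spoke-free one must avoid \<open>D\<close>. Otherwise it would contain \<open>D\<close> and
      hence all attachments of \<open>P\<close>, in one sector.\<close>
    have key: "nbs x F = 0" if F: "R = U @ b # F @ b' # V" and bb: "{b, b'} = {hd E0, last E0}" for U b F b' V
    proof -
      have r: "rot cs (b # F @ b' # V @ D @ U)"
        using rot_trans[OF DR(1)] rotI[of "D @ U" "b # F @ b' # V"] F by simp
      have "os {b, b'}" unfolding bb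
        using same[OF hl(2), of "hd E0" "last E0"] E0(3) E0in by blast
      then have "nbs x F = 0 \<or> nbs x (V @ D @ U) = 0" by (rule os_pair_arc[OF r])
      moreover have "nbs x (V @ D @ U) \<noteq> 0"
      proof
        assume z: "nbs x (V @ D @ U) = 0"
        have "rot cs (b' # (V @ D @ U) @ b # F)" using rot_trans[OF r] rotI[of "b # F" "b' # V @ D @ U"] by simp
        moreover have "attach P \<subseteq> set (b' # (V @ D @ U) @ [b])"
        proof
          fix e assume "e \<in> attach P"
          then obtain p where p: "p \<in> set P" "adj p e" "e \<in> set cs" by (auto simp: attach_def)
          then consider "p = hd P" | "p = last P" using inner by blast
          then show "e \<in> set (b' # (V @ D @ U) @ [b])"
          proof cases
            case 1
            then have "e \<in> set D" using DR(2,3) p by auto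
            then show ?thesis by auto
          next
            case 2
            then have "e \<in> {b, b'}" unfolding bb using E0(3) p by blast
            then show ?thesis by auto
          qed
        qed
        ultimately show False using os_arc z nos by blast
      qed
      ultimately show ?thesis by blast
    qed
    from E0in(1,2) False show ?thesis
    proof (rule mem_arc_between)
      fix U F V assume F: "R = U @ hd E0 # F @ last E0 # V"
      then have "nbs x F = 0" by (rule key) simp
      then show ?thesis using that[of U "hd E0 # F @ [last E0]" V] E0(3) F by simp
    next
      fix U F V assume F: "R = U @ last E0 # F @ hd E0 # V"
      then have "nbs x F = 0" by (rule key) blast
      then show ?thesis using that[of U "last E0 # F @ [hd E0]" V] E0(3) F by auto
    qed
  qed
  have r: "rot cs (D @ Y @ E @ Y')" using DR(1) E(1) by simp
  have ddist: "distinct (D @ Y @ E @ Y')" using rot_dist[OF r] .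
  have sall: "set cs = set (D @ Y @ E @ Y')" using rot_set[OF r] .
  have attE: "adj p c \<longleftrightarrow> p = hd P \<and> (c = hd D \<or> c = last D) \<or> p = last P \<and> (c = hd E \<or> c = last E)"
    if "p \<in> set P" "c \<in> set cs" for p c
    using inner[OF that] DR(3) E(4) that(2) hl' by blast
  obtain D' l where Dl: "D = D' @ [l]" using DR(2) by (cases D rule: rev_cases) auto
  obtain h D'' where Dh: "D = h # D''" using DR(2) by (cases D) auto
  obtain E' m where Em: "E = E' @ [m]" using E(2) by (cases E rule: rev_cases) auto
  obtain g E'' where Eg: "E = g # E''" using E(2) by (cases E) auto
  have e1: "last D = l" "last E = m" unfolding Dl Em by simp_all
  have e2: "hd D = h" "hd E = g" unfolding Dh Eg by simp_all
  note ends = e1(1) e2(1) e1(2) e2(2)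
  have inatt: "l \<in> attach P" "h \<in> attach P" "m \<in> attach P" "g \<in> attach P"
    using hlD hl E(4) sall E(2) ends unfolding attach_def by auto
  have Yn: "\<forall>b \<in> set (Y @ Y'). b \<notin> attach P"
  proof
    fix b assume b: "b \<in> set (Y @ Y')"
    have bcs: "b \<in> set cs" using b sall by auto
    have "hd D \<in> set D" "last D \<in> set D" "hd E \<in> set E" "last E \<in> set E" using DR(2) E(2) by auto
    then have "b \<noteq> hd D" "b \<noteq> last D" "b \<noteq> hd E" "b \<noteq> last E" using b ddist by auto
    then show "b \<notin> attach P" using attE[of _ b] bcs unfolding attach_def by blast
  qed
  have rg1: "rot cs (l # Y @ g # E'' @ Y' @ D')"
    using rot_trans[OF r] rotI[of D' "l # Y @ g # E'' @ Y'"] Dl Eg by simp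
  have rg2: "rot cs (m # Y' @ h # D'' @ Y @ E')"
    using rot_trans[OF r] rotI[of "h # D'' @ Y @ E'" "m # Y'"] Dh Em by simp
  have k: "nbs x (l # Y @ [g]) \<le> 2" "nbs x (m # Y' @ [h]) \<le> 2"
    using free_gap[OF Pf rg1 inatt(1,4)] free_gap[OF Pf rg2 inatt(3,2)] Yn by auto
  have cnt: "nbs x F = (if length F = 1 then (if adj x (hd F) then 1 else 0)
      else (if adj x (hd F) then 1 else 0) + (if adj x (last F) then 1 else 0))"
    if "F \<noteq> []" "nbs x (butlast (tl F)) = 0" for F
  proof (cases "tl F" rule: rev_cases)
    case Nil
    then show ?thesis using that by (cases F) auto
  next
    case (snoc M b)
    then obtain a where "F = a # M @ [b]" using that(1) by (cases F) auto
    then show ?thesis using that(2) by simp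
  qed
  have tot: "nbs x cs = nbs x D + nbs x Y + nbs x E + nbs x Y'" using nbs_rot[OF r, of x] by simp
  have nD: "nbs x D = (if length D = 1 then (if adj x h then 1 else 0)
      else (if adj x h then 1 else 0) + (if adj x l then 1 else 0))" using cnt[OF DR(2,4)] ends by simp
  have nE: "nbs x E = (if length E = 1 then (if adj x g then 1 else 0)
      else (if adj x g then 1 else 0) + (if adj x m then 1 else 0))" using cnt[OF E(2,3)] ends by simp
  have lD1: "length D = 1 \<Longrightarrow> l = h" "length E = 1 \<Longrightarrow> m = g" using Dl Dh Em Eg by auto
  \<comment> \<open>The two closed gaps together count every spoke, and a spoke forming a one-vertex
    \<open>D\<close> or \<open>E\<close> twice. They have at most four against a total of at least
    four, so each has exactly two and nothing is counted twice.\<close>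
  have fin4: "nbs x (l # Y @ [g]) = 2" "nbs x (m # Y' @ [h]) = 2" "length D = 1 \<longrightarrow> \<not> adj x h" "length E = 1 \<longrightarrow> \<not> adj x g"
    using k tot nD nE lD1 spokes4 by (auto split: if_splits)
  have "layout D Y E Y' P"
    unfolding layout_def ends using r DR(2) E(2) ip len attE fin4 unfolding off_wheel_def ends by blast
  then show False using no_layout by blast
qed

end

section \<open>Attachments of a path with at most one neighbour of the centre\<close>

context min_wheel begin

theorem free_walk_one_sector:
  assumes "walk P" "off_wheel P" "nbs x P = 0" shows "os (attach P)"
  by (rule helly) (auto simp: attach_def intro!: free_pair[OF assms])

lemma sector_like_three:
  assumes "sector_like S" "{a, b, c} \<subseteq> S" "adj x a" "adj x b" "adj x c" "a \<noteq> b" "a \<noteq> c" "b \<noteq> c"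
  shows False
proof -
  have "finite S" using assms(1) finite_subset unfolding sector_like_def by blast
  then have "card {a, b, c} \<le> card {d \<in> S. adj x d}" by (intro card_mono) (use assms in auto)
  then show False using assms unfolding sector_like_def by simp
qed

text \<open>Any two of the four sectors considered have at least three spokes among their ends. So a
  \<open>sector_like\<close> set contains both ends of at most one of them, and three such sets miss
  one. The spoke \<open>z4\<close> is the last before \<open>z0\<close>; it equals \<open>z3\<close>
  if there are only four spokes.\<close>

lemma sector_missed:
  assumes S: "sector_like S1" "sector_like S2" "sector_like S3"
  obtains s M t W where "rot cs (s # M @ t # W)" "nbs x M = 0" "adj x s" "adj x t"
    "\<not> {s, t} \<subseteq> S1" "\<not> {s, t} \<subseteq> S2" "\<not> {s, t} \<subseteq> S3"
proof -
  obtain z0 where "z0 \<in> set cs" "adj x z0" using spokes4 nbs_0[of x cs] by fastforce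
  then obtain Y where Y: "rot cs (z0 # Y)" using rot_start by metis
  have n: "nbs x Y \<ge> 3" using nbs_rot[OF Y, of x] \<open>adj x z0\<close> spokes4 by simp
  then have "nbs x Y = Suc (nbs x Y - 1)" by simp
  then obtain T0 z1 Y1 where 1: "Y = T0 @ z1 # Y1" "adj x z1" "nbs x T0 = 0" "nbs x Y1 = nbs x Y - 1"
    by (rule nbs_Suc_first)
  then have "nbs x Y1 = Suc (nbs x Y1 - 1)" using n by linarith
  then obtain T1 z2 Y2 where 2: "Y1 = T1 @ z2 # Y2" "adj x z2" "nbs x T1 = 0" "nbs x Y2 = nbs x Y1 - 1"
    by (rule nbs_Suc_first)
  then have "nbs x Y2 = Suc (nbs x Y2 - 1)" using 1(4) n by linarith
  then obtain T2 z3 Y3 where 3: "Y2 = T2 @ z3 # Y3" "adj x z3" "nbs x T2 = 0" "nbs x Y3 = nbs x Y2 - 1"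
    by (rule nbs_Suc_first)
  have "nbs x (z3 # Y3) = Suc (nbs x Y3)" using 3(2) by simp
  then obtain Y4 z4 T3 where 4: "z3 # Y3 = Y4 @ z4 # T3" "adj x z4" "nbs x T3 = 0" "nbs x Y4 = nbs x Y3"
    by (rule nbs_Suc_last)
  have eq: "Y = T0 @ z1 # T1 @ z2 # T2 @ z3 # Y3" using 1(1) 2(1) 3(1) by simp
  have d: "distinct (z0 # T0 @ z1 # T1 @ z2 # T2 @ z3 # Y3)" using rot_dist[OF Y] eq by simp
  have z4: "z4 \<in> set (z3 # Y3)" unfolding 4(1) by simp
  have zs: "z0 \<noteq> z1" "z0 \<noteq> z2" "z0 \<noteq> z3" "z1 \<noteq> z2" "z1 \<noteq> z3" "z2 \<noteq> z3" "z4 \<noteq> z0" "z4 \<noteq> z1" "z4 \<noteq> z2"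
    using d z4 by auto
  have r0: "rot cs (z0 # T0 @ z1 # T1 @ z2 # T2 @ z3 # Y3)" using Y eq by simp
  have r1: "rot cs (z1 # T1 @ z2 # T2 @ z3 # Y3 @ z0 # T0)"
    using rot_trans[OF r0] rotI[of "z0 # T0" "z1 # T1 @ z2 # T2 @ z3 # Y3"] by simp
  have r2: "rot cs (z2 # T2 @ z3 # Y3 @ z0 # T0 @ z1 # T1)"
    using rot_trans[OF r0] rotI[of "z0 # T0 @ z1 # T1" "z2 # T2 @ z3 # Y3"] by simp
  have "rot cs ((z0 # T0 @ z1 # T1 @ z2 # T2 @ Y4) @ z4 # T3)" using r0 4(1) by simp
  then have r4: "rot cs (z4 # T3 @ z0 # T0 @ z1 # T1 @ z2 # T2 @ Y4)"
    using rot_trans rotI[of "z0 # T0 @ z1 # T1 @ z2 # T2 @ Y4" "z4 # T3"] by fastforce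
  define ok where "ok s t \<longleftrightarrow> \<not> {s, t} \<subseteq> S1 \<and> \<not> {s, t} \<subseteq> S2 \<and> \<not> {s, t} \<subseteq> S3" for s t
  note a = \<open>adj x z0\<close> 1(2) 2(2) 3(2) 4(2)
  have excl: "\<not> ({z0, z1} \<subseteq> S \<and> {z1, z2} \<subseteq> S)" "\<not> ({z0, z1} \<subseteq> S \<and> {z2, z3} \<subseteq> S)"
    "\<not> ({z0, z1} \<subseteq> S \<and> {z4, z0} \<subseteq> S)" "\<not> ({z1, z2} \<subseteq> S \<and> {z2, z3} \<subseteq> S)"
    "\<not> ({z1, z2} \<subseteq> S \<and> {z4, z0} \<subseteq> S)" "\<not> ({z2, z3} \<subseteq> S \<and> {z4, z0} \<subseteq> S)" if "sector_like S" for S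
    using sector_like_three[OF that, of z0 z1 z2] sector_like_three[OF that, of z4 z0 z1]
      sector_like_three[OF that, of z1 z2 z3] sector_like_three[OF that, of z0 z1 z2] sector_like_three[OF that, of z0 z2 z3] a zs
    by auto
  have "ok z0 z1 \<or> ok z1 z2 \<or> ok z2 z3 \<or> ok z4 z0"
    using excl[OF S(1)] excl[OF S(2)] excl[OF S(3)] unfolding ok_def by argo
  then show thesis
    using that[OF r0 1(3) a(1,2)] that[OF r1 2(3) a(2,3)] that[OF r2 3(3) a(3,4)] that[OF r4 4(3) a(5,1)]
    unfolding ok_def by blast
qed

lemma walk_two_parts:
  assumes "walk W" "set W \<subseteq> A \<union> B" "\<And>a b. a \<in> A \<Longrightarrow> b \<in> B \<Longrightarrow> \<not> adj a b"
  shows "set W \<subseteq> A \<or> set W \<subseteq> B"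
  using assms(1,2)
proof (induction W rule: walk.induct)
  case (3 a b W)
  then have "set (b # W) \<subseteq> A \<or> set (b # W) \<subseteq> B" by simp
  then show ?case
  proof
    assume "set (b # W) \<subseteq> A"
    then have "a \<in> A" using 3(2,3) assms(3)[of b a] adj_sym by auto
    then show ?thesis using \<open>set (b # W) \<subseteq> A\<close> by simp
  next
    assume "set (b # W) \<subseteq> B"
    then have "a \<in> B" using 3(2,3) assms(3)[of a b] by auto
    then show ?thesis using \<open>set (b # W) \<subseteq> B\<close> by simp
  qed
qed auto

text \<open>An arc with at most one inner spoke can be cut there into parts of two sectors with a
  common vertex. The arc is the complement of a gap around a missed sector. If it had two inner
  spokes, the connection in \<open>P\<close> between the ends of the gap would have to avoid
  \<open>y\<close>, and both ends of the missed sector would lie in \<open>S1\<close> or both in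
  \<open>S2\<close>.\<close>

theorem walk_two_sectors:
  assumes P: "walk P" "off_wheel P" "distinct P" "P = P1 @ y # P2" "nbs x P1 = 0" "nbs x P2 = 0"
    and xy: "adj x y"
  shows "\<exists>xs ys. rot cs (xs @ ys) \<and> attach P \<subseteq> set xs \<and> nbs x (butlast (tl xs)) \<le> 1"
proof (cases "\<exists>c c'. c \<in> attach P \<and> c' \<in> attach P \<and> c \<noteq> c'")
  case False
  show ?thesis
  proof (cases "attach P = {}")
    case True
    then show ?thesis by (intro exI[of _ "[]"] exI[of _ cs]) auto
  next
    case ne: False
    then obtain c where c: "c \<in> attach P" "attach P \<subseteq> {c}" using False by blast
    then have "c \<in> set cs" by (auto simp: attach_def)
    then obtain ys where "rot cs (c # ys)" by (rule rot_start)
    then show ?thesis using c by (intro exI[of _ "[c]"] exI[of _ ys]) auto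
  qed
next
  case True
  then obtain c0 c0' where cc: "c0 \<in> attach P" "c0' \<in> attach P" "c0 \<noteq> c0'" by blast
  have sT: "attach P \<subseteq> set cs" by (auto simp: attach_def)
  have w12: "walk P1" "walk P2" using P(1,4) walk_append[of P1 "y # P2"] walk_append[of "[y]" P2] by auto
  have off12: "off_wheel P1" "off_wheel P2" using P(2,4) by (auto simp: off_wheel_def)
  have "\<exists>S1 S2. sector_like S1 \<and> sector_like S2 \<and> attach P1 \<subseteq> S1 \<union> S2 \<and> attach P2 \<subseteq> S1 \<union> S2 \<and>
    (\<forall>W. walk W \<longrightarrow> set W \<subseteq> set P1 \<union> set P2 \<longrightarrow> attach W \<subseteq> S1 \<or> attach W \<subseteq> S2)"
  proof (cases "\<exists>p \<in> set P1. \<exists>q \<in> set P2. adj p q")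
    \<comment> \<open>An edge \<open>p q\<close> joins the two parts of \<open>P\<close> without
      using \<open>y\<close>. The walk \<open>W\<close> traverses both parts by way of this edge, so
      one sector serves for both.\<close>
    case True
    then obtain p q where pq: "p \<in> set P1" "q \<in> set P2" "adj p q" by blast
    obtain U1 V1 where 1: "P1 = U1 @ p # V1" using split_list[OF pq(1)] by blast
    obtain U2 V2 where 2: "P2 = U2 @ q # V2" using split_list[OF pq(2)] by blast
    have w3: "walk (p # V1)" "walk (U2 @ [q])"
      using w12 1 2 walk_append[of U1 "p # V1"] walk_append[of "U2 @ [q]" V2] by auto
    define X where "X = P1 @ tl (rev (p # V1))"
    have hr: "hd (rev (p # V1)) = last (p # V1)" "last (rev (p # V1)) = p" by (simp_all add: hd_rev last_rev del: rev.simps)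
    have wX: "walk X" unfolding X_def
      by (rule walk_glue_tl[OF w12(1) walk_rev[OF w3(1)]]) (use 1 hr in auto)
    have lX: "last X = p"
    proof (cases V1 rule: rev_cases)
      case Nil
      then show ?thesis unfolding X_def using 1 by simp
    next
      case (snoc V v)
      then show ?thesis unfolding X_def by simp
    qed
    define Z where "Z = X @ rev (U2 @ [q])"
    have wZ: "walk Z" unfolding Z_def
      by (rule walk_glue[OF wX walk_rev[OF w3(2)]]) (use lX pq 1 in \<open>auto simp: X_def\<close>)
    have lZ: "last Z = hd P2" unfolding Z_def 2 by (cases U2) (auto simp: last_rev)
    define W where "W = Z @ tl P2"
    have wW: "walk W" unfolding W_def
      by (rule walk_glue_tl[OF wZ w12(2)]) (use lZ 2 in \<open>auto simp: Z_def\<close>)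
    have "set (tl (rev (p # V1))) \<subseteq> set P1" using 1 by (cases V1 rule: rev_cases) auto
    moreover have "set P2 = insert (hd P2) (set (tl P2))" unfolding 2 by (cases U2) auto
    moreover have "hd P2 \<in> set (rev (U2 @ [q]))" using 2 by (cases U2) auto
    ultimately have sW: "set W = set P1 \<union> set P2"
      unfolding W_def Z_def X_def using 2 by auto
    have "os (attach W)"
      by (rule free_walk_one_sector[OF wW]) (use sW off12 P(5,6) in \<open>auto simp: off_wheel_def nbs_0\<close>)
    then obtain S where S: "sector_like S" "attach W \<subseteq> S" by (rule os_secset)
    have "attach W' \<subseteq> S" if "set W' \<subseteq> set P1 \<union> set P2" for W'
      using S(2) that unfolding sW[symmetric] attach_def by blast
    then show ?thesis using S(1) by (metis Un_upper1 Un_upper2 sup.idem)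
  next
    case False
    obtain S1 where S1: "sector_like S1" "attach P1 \<subseteq> S1"
      using free_walk_one_sector[OF w12(1) off12(1) P(5)] by (rule os_secset)
    obtain S2 where S2: "sector_like S2" "attach P2 \<subseteq> S2"
      using free_walk_one_sector[OF w12(2) off12(2) P(6)] by (rule os_secset)
    have "attach W \<subseteq> S1 \<or> attach W \<subseteq> S2" if "walk W" "set W \<subseteq> set P1 \<union> set P2" for W
    proof -
      have "set W \<subseteq> set P1 \<or> set W \<subseteq> set P2" using walk_two_parts[OF that] False by blast
      then show ?thesis using S1(2) S2(2) unfolding attach_def by blast
    qed
    then show ?thesis using S1 S2 by blast
  qed
  then obtain S1 S2 where S12: "sector_like S1" "sector_like S2" "attach P1 \<subseteq> S1 \<union> S2" "attach P2 \<subseteq> S1 \<union> S2"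
    "\<And>W. walk W \<Longrightarrow> set W \<subseteq> set P1 \<union> set P2 \<Longrightarrow> attach W \<subseteq> S1 \<or> attach W \<subseteq> S2" by blast
  have "y \<notin> set cs" "y \<noteq> x" using P(2,4) by (auto simp: off_wheel_def)
  then have "os {c \<in> set cs. adj y c}" using proper[of y] unfolding improper_def by blast
  then obtain S3 where S3: "sector_like S3" "{c \<in> set cs. adj y c} \<subseteq> S3" by (rule os_secset)
  have attS: "attach P \<subseteq> S1 \<union> S2 \<union> S3"
  proof
    fix c assume "c \<in> attach P"
    then have "c \<in> attach P1 \<or> c \<in> attach P2 \<or> c \<in> {c \<in> set cs. adj y c}" using P(4) by (auto simp: attach_def)
    then show "c \<in> S1 \<union> S2 \<union> S3" using S12 S3 by blast
  qed
  obtain s M t W where st: "rot cs (s # M @ t # W)" "nbs x M = 0" "adj x s" "adj x t"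
    "\<not> {s, t} \<subseteq> S1" "\<not> {s, t} \<subseteq> S2" "\<not> {s, t} \<subseteq> S3"
    by (rule sector_missed[OF S12(1,2) S3(1)])
  have Wne: "W \<noteq> []"
  proof
    assume "W = []"
    then show False using nbs_rot[OF st(1), of x] st(2,3,4) spokes4 by simp
  qed
  have ip: "ipath (s # M @ [t])" using icyc_arc[of "s # M @ [t]" W] icyc_rot[OF st(1) cyc] Wne by simp
  have sub: "set (s # M @ [t]) \<subseteq> set cs" using rot_set[OF st(1)] by auto
  have reach: "{s, t} \<subseteq> S" if S: "sector_like S" and e: "e \<in> set M" "e \<in> S" for S e
  proof -
    obtain U V where M: "M = U @ e # V" using split_list[OF e(1)] by blast
    have nb: "\<forall>f \<in> set M. \<not> adj x f" using st(2) by (simp add: nbs_0)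
    have w1: "walk (e # V @ [t])"
      using ipath_walk[OF ipath_sub[of "s # U" "e # V @ [t]" "[]"]] ip M by simp
    have "s # M @ [t] = [] @ (s # U @ [e]) @ V @ [t]" using M by simp
    then have "ipath (s # U @ [e])" using ipath_sub ip by metis
    then have "ipath (rev (s # U @ [e]))" by (simp only: ipath_rev)
    then have w2: "walk (e # rev U @ [s])" using ipath_walk by simp
    have "last (e # V @ [t]) \<in> S"
      by (rule sector_like_walk[OF S w1]) (use sub M e nb in \<open>auto simp: butlast_append\<close>)
    moreover have "last (e # rev U @ [s]) \<in> S"
      by (rule sector_like_walk[OF S w2]) (use sub M e nb in \<open>auto simp: butlast_append\<close>)
    ultimately show ?thesis by simp
  qed
  have none: "\<forall>e \<in> set M. e \<notin> attach P"
    using reach[OF S12(1)] reach[OF S12(2)] reach[OF S3(1)] st(5-7) attS by blast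
  then have int: "\<forall>e \<in> set (butlast (tl (s # M @ [t]))). e \<notin> attach P" by simp
  have "rot cs ((s # M @ [t]) @ W)" using st(1) by simp
  then obtain a G b R L1 L2 where E: "rot cs (a # G @ b # R)" "a \<in> attach P" "b \<in> attach P"
    "\<forall>c \<in> set G. c \<notin> attach P" "a # G @ [b] = L1 @ (s # M @ [t]) @ L2"
    by (rule extend_arc[OF _ _ int card_att_two[OF cc sT]]) auto
  note co = arc_att_complement[OF E(1,4) sT]
  have k: "nbs x (a # G @ [b]) = nbs x L1 + 2 + nbs x L2" unfolding E(5) using st(2-4) by simp
  have nP: "nbs x P \<le> 1" using P(4-6) by simp
  show ?thesis
  proof (cases "nbs x R \<le> 1")
    case True
    then show ?thesis using co by (intro exI[of _ "b # R @ [a]"] exI[of _ G]) auto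
  next
    case False
    obtain P' where P': "ipath P'" "P' \<noteq> []" "set P' \<subseteq> set P" "a \<in> attach P'" "b \<in> attach P'"
      "\<not> (3 \<le> nbs x (a # G @ [b]) + nbs x P' \<and> nbs x (a # G @ [b]) + nbs x P' < nbs x cs)"
      by (rule gap_connect[OF P(1,2) nP P(3) E(1-4)])
    have "nbs x P' \<le> 1" using nbs_subset[OF ipath_distinct[OF P'(1)] P'(3) P(3), of x] nP by simp
    \<comment> \<open>The gap has at least two spokes and the rest \<open>R\<close> at least two
      more. A neighbour of \<open>x\<close> on \<open>P'\<close> or a third spoke in the gap would
      put the count into the excluded range.\<close>
    then have z: "nbs x P' = 0" "nbs x L1 = 0" "nbs x L2 = 0" using P'(6) k co(3) False by linarith+
    have S: "attach P' \<subseteq> S1 \<or> attach P' \<subseteq> S2"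
    proof -
      have "set P' \<subseteq> set P1 \<union> set P2" using xy z(1) P'(3) P(4) by (auto simp: nbs_0)
      then show ?thesis using S12(5)[OF ipath_walk[OF P'(1)]] by blast
    qed
    have Rne: "R \<noteq> []" using False by auto
    have "ipath (a # G @ [b])" using icyc_arc[of "a # G @ [b]" R] icyc_rot[OF E(1) cyc] Rne by simp
    then have ip2: "ipath (L1 @ s # M @ t # L2)" using E(5) by simp
    have sub2: "set (L1 @ s # M @ t # L2) \<subseteq> set cs" using rot_set[OF E(1)] E(5) by (metis Un_iff append_Cons append_Nil append.assoc set_append subsetI)
    have "ipath (L1 @ [s])" using ipath_sub[of "[]" "L1 @ [s]" "M @ t # L2"] ip2 by simp
    then have w1: "walk (L1 @ [s])" using ipath_walk by blast
    have "ipath (t # L2)" using ipath_sub[of "L1 @ s # M" "t # L2" "[]"] ip2 by simp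
    then have w2: "walk (rev (t # L2))" using ipath_walk ipath_rev by blast
    have h1: "hd (L1 @ [s]) = a" using E(5) by (cases L1) auto
    have "last (a # G @ [b]) = last (t # L2)" unfolding E(5) by simp
    then have h2: "hd (rev (t # L2)) = b" by (simp add: hd_rev del: rev.simps)
    have both: "{s, t} \<subseteq> S" if "sector_like S" "attach P' \<subseteq> S" for S
    proof -
      have "last (L1 @ [s]) \<in> S"
        by (rule sector_like_walk[OF that(1) w1]) (use h1 that P'(4) sub2 z(2) in \<open>auto simp: nbs_0\<close>)
      moreover have "last (rev (t # L2)) \<in> S"
        by (rule sector_like_walk[OF that(1) w2]) (use h2 that P'(5) sub2 z(3) in \<open>auto simp: nbs_0\<close>)
      ultimately show ?thesis by simp
    qed
    show ?thesis using S both[OF S12(1)] both[OF S12(2)] st(5,6) by blast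
  qed
qed

end

section \<open>Subdivisions and induced subgraphs of pair digraphs\<close>

lemma undirected_iff: "(u, v) \<in> undirected E \<longleftrightarrow> (u, v) \<in> E \<or> (v, u) \<in> E"
  by (auto simp: undirected_def)

lemma undirected_Un: "undirected (E \<union> F) = undirected E \<union> undirected F"
  by (auto simp: undirected_def)

lemma vwalk_arcs_verts: "(u, v) \<in> set (vwalk_arcs p) \<Longrightarrow> u \<in> set p \<and> v \<in> set p"
  by (induction p rule: vwalk_arcs.induct) auto

lemma vwalk_arcs_split: "vwalk_arcs (p @ g # q) = vwalk_arcs (p @ [g]) @ vwalk_arcs (g # q)"
  by (induction p rule: vwalk_arcs.induct) auto

section \<open>Induced paths and cycles described by their arcs\<close>

context sgraph begin

lemma ipath_iff_arcs:
  "ipath p \<longleftrightarrow> distinct p \<and> (\<forall>u \<in> set p. \<forall>v \<in> set p. adj u v \<longleftrightarrow> (u, v) \<in> undirected (set (vwalk_arcs p)))"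
proof (induction p rule: vwalk_arcs.induct)
  case 1
  then show ?case by simp
next
  case (2 a)
  then show ?case by (simp add: undirected_iff)
next
  case (3 a b p)
  have arcs: "set (vwalk_arcs (a # b # p)) = insert (a, b) (set (vwalk_arcs (b # p)))" by simp
  have inn: "(u, v) \<in> set (vwalk_arcs (b # p)) \<Longrightarrow> u \<in> set (b # p) \<and> v \<in> set (b # p)" for u v
    using vwalk_arcs_verts by metis
  show ?case
  proof
    assume ip: "ipath (a # b # p)"
    then have ip': "ipath (b # p)" "a \<notin> set (b # p)" "\<And>c. c \<in> set (b # p) \<Longrightarrow> adj a c \<longleftrightarrow> c = b"
      by auto
    have IH: "\<And>u v. u \<in> set (b # p) \<Longrightarrow> v \<in> set (b # p) \<Longrightarrow> adj u v \<longleftrightarrow> (u, v) \<in> undirected (set (vwalk_arcs (b # p)))"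
      using 3 ip'(1) by blast
    have "adj u v \<longleftrightarrow> (u, v) \<in> undirected (set (vwalk_arcs (a # b # p)))"
      if uv: "u \<in> set (a # b # p)" "v \<in> set (a # b # p)" for u v
    proof -
      consider "u = a" "v = a" | "u = a" "v \<in> set (b # p)" | "v = a" "u \<in> set (b # p)"
        | "u \<in> set (b # p)" "v \<in> set (b # p)" using uv by auto
      then show ?thesis
      proof cases
        case 1
        then show ?thesis unfolding undirected_iff arcs using inn ip'(2) by auto
      next
        case 2
        then show ?thesis unfolding undirected_iff arcs using inn ip'(2) ip'(3)[of v] by auto
      next
        case 3
        then show ?thesis unfolding undirected_iff arcs using inn ip'(2) ip'(3)[of u] adj_commute[of u v] by auto
      next
        case 4
        then show ?thesis using IH[OF 4] ip'(2) unfolding undirected_iff arcs by auto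
      qed
    qed
    then show "distinct (a # b # p) \<and> (\<forall>u \<in> set (a # b # p). \<forall>v \<in> set (a # b # p).
      adj u v \<longleftrightarrow> (u, v) \<in> undirected (set (vwalk_arcs (a # b # p))))"
      using ipath_distinct[OF ip] by blast
  next
    assume R: "distinct (a # b # p) \<and> (\<forall>u \<in> set (a # b # p). \<forall>v \<in> set (a # b # p).
      adj u v \<longleftrightarrow> (u, v) \<in> undirected (set (vwalk_arcs (a # b # p))))"
    then have d: "distinct (b # p)" "a \<notin> set (b # p)" by auto
    have e: "adj u v \<longleftrightarrow> (u, v) \<in> undirected (set (vwalk_arcs (a # b # p)))"
      if "u \<in> set (a # b # p)" "v \<in> set (a # b # p)" for u v using R that by blast
    have "adj u v \<longleftrightarrow> (u, v) \<in> undirected (set (vwalk_arcs (b # p)))"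
      if "u \<in> set (b # p)" "v \<in> set (b # p)" for u v
      using e[of u v] that d(2) unfolding undirected_iff arcs by auto
    then have "ipath (b # p)" using 3 d(1) by blast
    moreover have "adj a c \<longleftrightarrow> c = b" if "c \<in> set (b # p)" for c
      using e[of a c] that d(2) inn unfolding undirected_iff arcs by auto
    ultimately show "ipath (a # b # p)" using d(2) by auto
  qed
qed

lemma icyc_iff_arcs:
  "icyc cs \<longleftrightarrow> distinct cs \<and> length cs \<ge> 3 \<and>
     (\<forall>u \<in> set cs. \<forall>v \<in> set cs. adj u v \<longleftrightarrow> (u, v) \<in> undirected (set (vwalk_arcs (cs @ [hd cs]))))"
proof (cases "length cs \<ge> 3")
  case True
  then obtain a p where cs: "cs = a # p" "length p \<ge> 2" by (cases cs) auto
  then have ne: "p \<noteq> []" by auto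
  have arcs: "set (vwalk_arcs (cs @ [hd cs])) = set (vwalk_arcs p) \<union> {(a, hd p), (last p, a)}"
    using cs(1) ne vwalk_arcs_append[of p "[a]"] by auto
  have hl: "hd p \<in> set p" "last p \<in> set p" using ne by auto
  have inn: "(u, v) \<in> set (vwalk_arcs p) \<Longrightarrow> u \<in> set p \<and> v \<in> set p" for u v
    using vwalk_arcs_verts by metis
  show ?thesis
  proof
    assume "icyc cs"
    then have c: "ipath p" "a \<notin> set p" "\<And>b. b \<in> set p \<Longrightarrow> adj a b \<longleftrightarrow> b = hd p \<or> b = last p"
      using cs(1) unfolding icyc_def by auto
    have pp: "\<And>u v. u \<in> set p \<Longrightarrow> v \<in> set p \<Longrightarrow> adj u v \<longleftrightarrow> (u, v) \<in> undirected (set (vwalk_arcs p))"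
      using c(1) ipath_iff_arcs by blast
    have "adj u v \<longleftrightarrow> (u, v) \<in> undirected (set (vwalk_arcs (cs @ [hd cs])))"
      if uv: "u \<in> set cs" "v \<in> set cs" for u v
    proof -
      consider "u = a" "v = a" | "u = a" "v \<in> set p" | "v = a" "u \<in> set p"
        | "u \<in> set p" "v \<in> set p" using uv cs(1) by auto
      then show ?thesis
      proof cases
        case 1
        then show ?thesis unfolding undirected_iff arcs using inn c(2) hl by auto
      next
        case 2
        then show ?thesis unfolding undirected_iff arcs using inn c(2) c(3)[of v] hl by auto
      next
        case 3
        then show ?thesis unfolding undirected_iff arcs using inn c(2) c(3)[of u] adj_commute[of u v] hl by auto
      next
        case 4
        then show ?thesis using pp[OF 4] c(2) unfolding undirected_iff arcs by auto
      qed
    qed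
    then show "distinct cs \<and> length cs \<ge> 3 \<and>
      (\<forall>u \<in> set cs. \<forall>v \<in> set cs. adj u v \<longleftrightarrow> (u, v) \<in> undirected (set (vwalk_arcs (cs @ [hd cs]))))"
      using icyc_distinct[OF \<open>icyc cs\<close>] True by blast
  next
    assume R: "distinct cs \<and> length cs \<ge> 3 \<and>
      (\<forall>u \<in> set cs. \<forall>v \<in> set cs. adj u v \<longleftrightarrow> (u, v) \<in> undirected (set (vwalk_arcs (cs @ [hd cs]))))"
    then have d: "distinct p" "a \<notin> set p" using cs(1) by auto
    have e: "adj u v \<longleftrightarrow> (u, v) \<in> undirected (set (vwalk_arcs (cs @ [hd cs])))"
      if "u \<in> set cs" "v \<in> set cs" for u v using R that by blast
    have "adj u v \<longleftrightarrow> (u, v) \<in> undirected (set (vwalk_arcs p))"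
      if "u \<in> set p" "v \<in> set p" for u v
      using e[of u v] that d(2) cs(1) unfolding undirected_iff arcs by auto
    then have "ipath p" using ipath_iff_arcs[of p] d(1) by blast
    moreover have "adj a c \<longleftrightarrow> c = hd p \<or> c = last p" if "c \<in> set p" for c
      using e[of a c] that d(2) cs(1) inn unfolding undirected_iff arcs by auto
    ultimately show "icyc cs" unfolding icyc_def using cs d(2) by blast
  qed
next
  case False
  then show ?thesis using icyc_length by auto
qed

end

text \<open>The path is inserted vertex by vertex, starting at \<open>u\<close>. The edge from the
  newest vertex to \<open>v\<close> is the one divided next, which is why \<open>u\<close>,
  \<open>V\<close> and \<open>B\<close> vary in the induction.\<close>

lemma subdivide_edge_by_path:
  assumes "subdivision_pair K \<lparr>pverts = V, parcs = B \<union> {(u, v), (v, u)}\<rparr>" "(u, v) \<notin> B" "(v, u) \<notin> B"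
    "B \<subseteq> V \<times> V" "u \<in> V" "v \<in> V" "distinct zs" "set zs \<inter> V = {}" "u \<noteq> v"
  shows "subdivision_pair K \<lparr>pverts = V \<union> set zs, parcs = B \<union> undirected (set (vwalk_arcs (u # zs @ [v])))\<rparr>"
  using assms
proof (induction zs arbitrary: u V B)
  case Nil
  have "undirected (set (vwalk_arcs (u # [] @ [v]))) = {(u, v), (v, u)}" by (auto simp: undirected_def)
  then show ?case using Nil.prems(1) by simp
next
  case (Cons z zs)
  let ?H = "\<lparr>pverts = V, parcs = B \<union> {(u, v), (v, u)}\<rparr>"
  have zV: "z \<notin> V" using Cons.prems(8) by auto
  have "subdivision_pair K (subdivide ?H (u, v) z)"
    by (rule subdivision_pair_divide[OF _ _ Cons.prems(1)]) (use zV in auto)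
  moreover have "subdivide ?H (u, v) z
    = \<lparr>pverts = insert z V, parcs = (B \<union> {(u, z), (z, u)}) \<union> {(z, v), (v, z)}\<rparr>"
    using Cons.prems(2,3) by (auto simp: subdivide.simps)
  ultimately have *: "subdivision_pair K \<lparr>pverts = insert z V, parcs = (B \<union> {(u, z), (z, u)}) \<union> {(z, v), (v, z)}\<rparr>"
    by (simp only:)
  have nz: "(z, v) \<notin> B \<union> {(u, z), (z, u)}" "(v, z) \<notin> B \<union> {(u, z), (z, u)}"
    using Cons.prems zV by auto
  have "subdivision_pair K \<lparr>pverts = insert z V \<union> set zs,
    parcs = (B \<union> {(u, z), (z, u)}) \<union> undirected (set (vwalk_arcs (z # zs @ [v])))\<rparr>"
    by (rule Cons.IH[OF * nz]) (use Cons.prems in auto)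
  moreover have "undirected (set (vwalk_arcs (u # (z # zs) @ [v]))) = {(u, z), (z, u)} \<union> undirected (set (vwalk_arcs (z # zs @ [v])))"
    by (auto simp: undirected_def)
  ultimately show ?case by (simp add: Un_assoc)
qed

definition induced_on :: "'a pair_pre_digraph \<Rightarrow> 'a set \<Rightarrow> 'a pair_pre_digraph" where
  "induced_on G X = \<lparr>pverts = X, parcs = {(u, v) \<in> parcs G. u \<in> X \<and> v \<in> X}\<rparr>"

section \<open>Induced subdivisions of K4, diamonds and bowties in a graph\<close>

context pair_graph begin

definition adjG :: "'a \<Rightarrow> 'a \<Rightarrow> bool" where
  "adjG u v \<longleftrightarrow> (u, v) \<in> parcs G"

sublocale sgraph adjG
  by unfold_locales (auto simp: adjG_def arcs_symmetric dest: no_loops')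

lemma adjG_verts: "adjG u v \<Longrightarrow> u \<in> pverts G \<and> v \<in> pverts G"
  by (auto simp: adjG_def dest: in_arcsD1 in_arcsD2)

lemma induced_on_induced:
  assumes "X \<subseteq> pverts G" shows "induced_subgraph (with_proj (induced_on G X)) (with_proj G)"
proof -
  have "wf_digraph (with_proj (induced_on G X))"
    unfolding wf_digraph_wp_iff by unfold_locales (auto simp: induced_on_def)
  moreover have "wf_digraph (with_proj G)" by unfold_locales
  ultimately show ?thesis using assms
    unfolding induced_subgraph_def subgraph_def compatible_def
    by (auto simp: induced_on_def)
qed

lemma free_of_induced:
  assumes "free_of R G" "X \<subseteq> pverts G" shows "\<not> R (induced_on G X)"
  using assms induced_on_induced unfolding free_of_def by blast

lemma icyc_verts:
  assumes "icyc H" shows "set H \<subseteq> pverts G"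
proof
  fix y assume "y \<in> set H"
  then have "nbs y H = 2" using nbs_icyc_self[OF assms] by blast
  then have "\<exists>z \<in> set H. adjG y z" using nbs_0[of y H] by fastforce
  then show "y \<in> pverts G" using adjG_verts by blast
qed

text \<open>The branch vertices are \<open>t\<close>, \<open>g\<close>, \<open>h\<close> and
  \<open>x\<close>. Starting from the complete graph on them, the three edges of the triangle
  \<open>t g h\<close> and the edge \<open>x t\<close> are replaced by paths, while the edges
  \<open>x g\<close> and \<open>x h\<close> stay.\<close>

lemma no_K4_config:
  assumes free: "free_of K4_subdivision G"
    and cyc: "icyc (t # P1 @ g # P2 @ h # P3)" and path: "ipath (x # Z)"
    and disj: "set (x # Z) \<inter> set (t # P1 @ g # P2 @ h # P3) = {}"
    and cross: "\<And>z y. z \<in> set (x # Z) \<Longrightarrow> y \<in> set (t # P1 @ g # P2 @ h # P3) \<Longrightarrow>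
      adjG z y \<longleftrightarrow> z = x \<and> (y = g \<or> y = h) \<or> z = last (x # Z) \<and> y = t"
  shows False
proof -
  let ?C = "t # P1 @ g # P2 @ h # P3"
  let ?u = "\<lambda>p. undirected (set (vwalk_arcs p))"
  have dC: "distinct ?C" using icyc_distinct[OF cyc] .
  have dZ: "distinct (x # Z)" using ipath_distinct[OF path] .
  have d: "distinct [t, g, h, x]" using dC disj by auto
  define K :: "'a pair_pre_digraph" where
    "K = \<lparr>pverts = {t, g, h, x}, parcs = {(u, v). u \<in> {t, g, h, x} \<and> v \<in> {t, g, h, x} \<and> u \<noteq> v}\<rparr>"
  have K4: "K\<^bsub>4\<^esub> (with_proj K)"
    unfolding complete_digraph_pair_def using d by (auto simp: K_def)
  interpret K: pair_graph K using pair_graphI_complete[OF K4] .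
  have s0: "subdivision_pair K K" by (rule subdivision_pair_base) unfold_locales
  have K: "K = \<lparr>pverts = {t, g, h, x}, parcs = {(g, h), (h, g), (h, t), (t, h), (x, t), (t, x), (x, g), (g, x), (x, h), (h, x)}
      \<union> {(t, g), (g, t)}\<rparr>"
    unfolding K_def using d by auto
  have inn: "(u, v) \<in> ?u p \<Longrightarrow> u \<in> set p \<and> v \<in> set p" for u v :: 'a and p
    unfolding undirected_iff using vwalk_arcs_verts by metis
  have usub: "?u p \<subseteq> V \<times> V" if "set p \<subseteq> V" for p and V :: "'a set"
    using inn[of _ _ p] that by auto
  define U1 U2 U3 where "U1 = ?u (t # P1 @ [g])" and "U2 = ?u (g # P2 @ [h])" and "U3 = ?u (h # P3 @ [t])"
  define V1 V2 V3 where "V1 = {t, g, h, x} \<union> set P1" and "V2 = V1 \<union> set P2" and "V3 = V2 \<union> set P3"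
  have n1: "(u, v) \<notin> U1" if "u \<in> {h, x} \<or> v \<in> {h, x}" for u v
    unfolding U1_def using inn[of u v "t # P1 @ [g]"] that dC disj by auto
  have n2: "(u, v) \<notin> U2" if "u \<in> {t, x} \<or> v \<in> {t, x}" for u v
    unfolding U2_def using inn[of u v "g # P2 @ [h]"] that dC disj by auto
  have n3: "(u, v) \<notin> U3" if "u \<in> {g, x} \<or> v \<in> {g, x}" for u v
    unfolding U3_def using inn[of u v "h # P3 @ [t]"] that dC disj by auto
  have b1: "U1 \<subseteq> V1 \<times> V1" unfolding U1_def V1_def by (rule usub) auto
  have "U2 \<subseteq> V2 \<times> V2" unfolding U2_def by (rule usub) (auto simp: V2_def V1_def)
  moreover have "V1 \<times> V1 \<subseteq> V2 \<times> V2" unfolding V2_def by blast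
  ultimately have b2: "U1 \<union> U2 \<subseteq> V2 \<times> V2" using b1 by (metis Un_least subset_trans)
  have "U3 \<subseteq> V3 \<times> V3" unfolding U3_def by (rule usub) (auto simp: V3_def V2_def V1_def)
  moreover have "V2 \<times> V2 \<subseteq> V3 \<times> V3" unfolding V3_def by blast
  ultimately have b3: "U1 \<union> U2 \<union> U3 \<subseteq> V3 \<times> V3" using b2 by (metis Un_least subset_trans)
  have v1: "t \<in> V1" "g \<in> V1" "h \<in> V1" "x \<in> V1" unfolding V1_def by auto
  have v2: "t \<in> V2" "g \<in> V2" "h \<in> V2" "x \<in> V2" using v1 unfolding V2_def by auto
  have v3: "t \<in> V3" "g \<in> V3" "h \<in> V3" "x \<in> V3" using v2 unfolding V3_def by auto
  have dj: "distinct P1" "distinct P2" "distinct P3" "distinct Z" "set P2 \<inter> V1 = {}" "set P3 \<inter> V2 = {}" "set Z \<inter> V3 = {}"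
    unfolding V3_def V2_def V1_def using d dC disj dZ by auto
  have s1: "subdivision_pair K \<lparr>pverts = V1,
      parcs = {(g, h), (h, g), (h, t), (t, h), (x, t), (t, x), (x, g), (g, x), (x, h), (h, x)} \<union> U1\<rparr>"
    unfolding V1_def U1_def
    by (rule subdivide_edge_by_path[OF s0[unfolded K], folded K]) (use d dC disj in auto)
  \<comment> \<open>The arcs are regrouped so that the edge to be divided next stands apart, as
    \<open>subdivide_edge_by_path\<close> expects.\<close>
  have e1: "{(g, h), (h, g), (h, t), (t, h), (x, t), (t, x), (x, g), (g, x), (x, h), (h, x)} \<union> U1 =
      ({(h, t), (t, h), (x, t), (t, x), (x, g), (g, x), (x, h), (h, x)} \<union> U1) \<union> {(g, h), (h, g)}" by auto
  have s2: "subdivision_pair K \<lparr>pverts = V2,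
      parcs = ({(h, t), (t, h), (x, t), (t, x), (x, g), (g, x), (x, h), (h, x)} \<union> U1) \<union> U2\<rparr>"
    unfolding V2_def U2_def
    by (rule subdivide_edge_by_path[OF s1[unfolded e1]]) (use d dj b1 v1 n1 in auto)
  have e2: "({(h, t), (t, h), (x, t), (t, x), (x, g), (g, x), (x, h), (h, x)} \<union> U1) \<union> U2 =
    ({(x, t), (t, x), (x, g), (g, x), (x, h), (h, x)} \<union> U1 \<union> U2) \<union> {(h, t), (t, h)}" by auto
  have s3: "subdivision_pair K \<lparr>pverts = V3,
      parcs = ({(x, t), (t, x), (x, g), (g, x), (x, h), (h, x)} \<union> U1 \<union> U2) \<union> U3\<rparr>"
    unfolding V3_def U3_def
    by (rule subdivide_edge_by_path[OF s2[unfolded e2]]) (use d dj b2 v2 n1 n2 in auto)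
  have e3: "({(x, t), (t, x), (x, g), (g, x), (x, h), (h, x)} \<union> U1 \<union> U2) \<union> U3 =
    ({(x, g), (g, x), (x, h), (h, x)} \<union> U1 \<union> U2 \<union> U3) \<union> {(x, t), (t, x)}" by auto
  have s4: "subdivision_pair K \<lparr>pverts = V3 \<union> set Z,
      parcs = ({(x, g), (g, x), (x, h), (h, x)} \<union> U1 \<union> U2 \<union> U3) \<union> ?u (x # Z @ [t])\<rparr>"
    by (rule subdivide_edge_by_path[OF s3[unfolded e3]]) (use d dj b3 v3 n1 n2 n3 in auto)
  define X where "X = set ?C \<union> set (x # Z)"
  have Xv: "X \<subseteq> pverts G"
  proof -
    have "z \<in> pverts G" if "z \<in> set Z" for z
    proof -
      have "walk (x # Z)" using ipath_walk[OF path] .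
      then show ?thesis using that
      proof (induction "x # Z" arbitrary: x Z rule: walk.induct)
        case (3 a b xs)
        then show ?case using adjG_verts[of a b] by (cases "z = b") auto
      qed auto
    qed
    moreover have "x \<in> pverts G" using cross[of x g] adjG_verts[of x g] by auto
    ultimately show ?thesis using icyc_verts[OF cyc] unfolding X_def by auto
  qed
  have cycarcs: "U1 \<union> U2 \<union> U3 = ?u (?C @ [hd ?C])"
  proof -
    have "vwalk_arcs (?C @ [hd ?C]) = vwalk_arcs (t # P1 @ [g]) @ vwalk_arcs (g # P2 @ [h]) @ vwalk_arcs (h # P3 @ [t])"
      using vwalk_arcs_split[of "t # P1" g "P2 @ h # P3 @ [t]"] vwalk_arcs_split[of "g # P2" h "P3 @ [t]"] by simp
    then show ?thesis unfolding U1_def U2_def U3_def by (auto simp: undirected_def)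
  qed
  have patharcs: "?u (x # Z @ [t]) = ?u (x # Z) \<union> {(last (x # Z), t), (t, last (x # Z))}"
    using vwalk_arcs_append[of "x # Z" "[t]"] by (auto simp: undirected_def)
  have c1: "adjG u v \<longleftrightarrow> (u, v) \<in> ?u (?C @ [hd ?C])" if "u \<in> set ?C" "v \<in> set ?C" for u v
    using cyc that unfolding icyc_iff_arcs by blast
  have c2: "adjG u v \<longleftrightarrow> (u, v) \<in> ?u (x # Z)" if "u \<in> set (x # Z)" "v \<in> set (x # Z)" for u v
    using path that unfolding ipath_iff_arcs by blast
  have in1: "(u, v) \<in> ?u (?C @ [hd ?C]) \<Longrightarrow> u \<in> set ?C \<and> v \<in> set ?C" for u v
    using inn[of u v "?C @ [hd ?C]"] by auto
  have in2: "(u, v) \<in> ?u (x # Z) \<Longrightarrow> u \<in> set (x # Z) \<and> v \<in> set (x # Z)" for u v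
    using inn by metis
  define L where "L = last (x # Z)"
  have LZ: "L \<in> set (x # Z)" unfolding L_def by (rule last_in_set) simp
  have mem: "x \<in> set (x # Z)" "t \<in> set ?C" "g \<in> set ?C" "h \<in> set ?C" by auto
  define A B where "A = set ?C" and "B = set (x # Z)"
  have "{(x, g), (g, x), (x, h), (h, x)} \<union> ?u (?C @ [hd ?C]) \<union> (?u (x # Z) \<union> {(L, t), (t, L)})
    = {(u, v). adjG u v \<and> u \<in> X \<and> v \<in> X}" (is "?l = ?r")
  proof (rule set_eqI)
    fix e :: "'a \<times> 'a"
    obtain u v where e: "e = (u, v)" by (cases e)
    have cr: "\<And>z y. z \<in> B \<Longrightarrow> y \<in> A \<Longrightarrow> adjG z y \<longleftrightarrow> z = x \<and> (y = g \<or> y = h) \<or> z = L \<and> y = t"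
      using cross unfolding A_def B_def L_def by blast
    have AB: "A \<inter> B = {}" "X = A \<union> B" "x \<in> B" "L \<in> B" "t \<in> A" "g \<in> A" "h \<in> A"
      using disj mem LZ unfolding A_def B_def X_def by auto
    have i1: "(u, v) \<in> ?u (?C @ [hd ?C]) \<longleftrightarrow> u \<in> A \<and> v \<in> A \<and> adjG u v" using in1 c1 unfolding A_def by blast
    have i2: "(u, v) \<in> ?u (x # Z) \<longleftrightarrow> u \<in> B \<and> v \<in> B \<and> adjG u v" using in2 c2 unfolding B_def by blast
    have "(u, v) \<in> ?l \<longleftrightarrow> (u, v) \<in> {(x, g), (g, x), (x, h), (h, x), (L, t), (t, L)} \<or>
       u \<in> A \<and> v \<in> A \<and> adjG u v \<or> u \<in> B \<and> v \<in> B \<and> adjG u v"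
      using i1 i2 by blast
    also have "\<dots> \<longleftrightarrow> adjG u v \<and> u \<in> X \<and> v \<in> X"
      using cr[of u v] cr[of v u] AB adj_commute[of u v] by auto
    finally show "e \<in> ?l \<longleftrightarrow> e \<in> ?r" using e by simp
  qed
  moreover have "({(x, g), (g, x), (x, h), (h, x)} \<union> U1 \<union> U2 \<union> U3) \<union> ?u (x # Z @ [t])
    = {(x, g), (g, x), (x, h), (h, x)} \<union> ?u (?C @ [hd ?C]) \<union> (?u (x # Z) \<union> {(L, t), (t, L)})"
    unfolding cycarcs[symmetric] patharcs L_def[symmetric] by (simp only: Un_assoc)
  moreover have "V3 \<union> set Z = X" unfolding X_def V3_def V2_def V1_def by auto
  moreover have "induced_on G X = \<lparr>pverts = X, parcs = {(u, v). adjG u v \<and> u \<in> X \<and> v \<in> X}\<rparr>"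
    unfolding induced_on_def adjG_def by auto
  ultimately have "subdivision_pair K (induced_on G X)" using s4 by (simp only:)
  then have "K4_subdivision (induced_on G X)" unfolding K4_subdivision_def using K4 by blast
  then show False using free_of_induced[OF free Xv] by blast
qed

text \<open>The three neighbours and \<open>x\<close> are the branch vertices. In
  \<open>no_K4_config\<close> the list \<open>Z\<close> is empty, and since \<open>last [x]\<close>
  is \<open>x\<close>, the edge from \<open>x\<close> to \<open>t\<close> is undivided.\<close>

lemma no_wheel3_G:
  assumes free: "free_of K4_subdivision G" and H: "icyc H" "x \<notin> set H"
  shows "nbs x H \<noteq> 3"
proof
  assume "nbs x H = 3"
  then have "nbs x H = Suc 2" by simp
  then obtain U t W where 1: "H = U @ t # W" "adjG x t" "nbs x U = 0" "nbs x W = 2" by (rule nbs_Suc_first)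
  have r: "rot H (t # W @ U)" using 1(1) rotI[of U "t # W"] by simp
  have "nbs x (W @ U) = Suc 1" using 1 by simp
  then obtain P1 g V where 2: "W @ U = P1 @ g # V" "adjG x g" "nbs x P1 = 0" "nbs x V = 1" by (rule nbs_Suc_first)
  then have "nbs x V = Suc 0" by simp
  then obtain P2 h P3 where 3: "V = P2 @ h # P3" "adjG x h" "nbs x P2 = 0" "nbs x P3 = 0" by (rule nbs_Suc_first)
  have eq: "t # W @ U = t # P1 @ g # P2 @ h # P3" using 2(1) 3(1) by simp
  have ic: "icyc (t # P1 @ g # P2 @ h # P3)" using icyc_rot[OF r H(1)] eq by simp
  have nx: "x \<notin> set (t # P1 @ g # P2 @ h # P3)" using rot_set[OF r] H(2) eq by simp
  show False
    by (rule no_K4_config[OF free ic, of x "[]"])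
      (use nx 1(2) 2(2,3) 3(2,3,4) in \<open>auto simp: nbs_0\<close>)
qed

lemma no_wheel2_path_G:
  assumes free: "free_of K4_subdivision G"
    and H: "icyc H" "x \<notin> set H" "nbs x H = 2" "t \<in> set H" "\<not> adjG x t"
    and Z: "ipath Z" "Z \<noteq> []" "set Z \<inter> set H = {}" "x \<notin> set Z" "\<forall>z \<in> set Z. adjG x z \<longleftrightarrow> z = hd Z"
      "\<forall>z \<in> set Z. \<forall>y \<in> set H. adjG z y \<longleftrightarrow> z = last Z \<and> y = t"
  shows False
proof -
  obtain Y where r: "rot H (t # Y)" using rot_start[OF H(4)] by blast
  have "nbs x Y = Suc 1" using nbs_rot[OF r, of x] H(3,5) by simp
  then obtain P1 g V where 2: "Y = P1 @ g # V" "adjG x g" "nbs x P1 = 0" "nbs x V = 1" by (rule nbs_Suc_first)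
  then have "nbs x V = Suc 0" by simp
  then obtain P2 h P3 where 3: "V = P2 @ h # P3" "adjG x h" "nbs x P2 = 0" "nbs x P3 = 0" by (rule nbs_Suc_first)
  have eq: "t # Y = t # P1 @ g # P2 @ h # P3" using 2(1) 3(1) by simp
  have ic: "icyc (t # P1 @ g # P2 @ h # P3)" using icyc_rot[OF r H(1)] eq by simp
  have s: "set H = set (t # P1 @ g # P2 @ h # P3)" using rot_set[OF r] eq by simp
  have ip: "ipath (x # Z)" using Z by auto
  have lx: "last (x # Z) = last Z" "last Z \<in> set Z" using Z(2) by auto
  have xH: "adjG x y \<longleftrightarrow> y = g \<or> y = h" if "y \<in> set H" for y
    using that H(5) 2(2,3) 3(2,3,4) unfolding s by (auto simp: nbs_0)
  show False
  proof (rule no_K4_config[OF free ic ip])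
    show "set (x # Z) \<inter> set (t # P1 @ g # P2 @ h # P3) = {}" using Z(3) H(2) s by auto
    fix z y assume z: "z \<in> set (x # Z)" and "y \<in> set (t # P1 @ g # P2 @ h # P3)"
    then have y: "y \<in> set H" using s by simp
    show "adjG z y \<longleftrightarrow> z = x \<and> (y = g \<or> y = h) \<or> z = last (x # Z) \<and> y = t"
    proof (cases "z = x")
      case True
      have "x \<noteq> last Z" using Z(4) lx(2) by auto
      then show ?thesis using True xH[OF y] lx(1) by auto
    next
      case False
      then show ?thesis using Z(6) z y lx(1) by auto
    qed
  qed
qed

text \<open>If \<open>c\<close> and \<open>d\<close> are adjacent, the four vertices form a K4, seen
  here as a triangle with three neighbours of \<open>d\<close>; otherwise the diamond is
  induced.\<close>

lemma no_diamond_G: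
  assumes free: "free_of K4_subdivision G" "free_of diamond G"
    and e: "adjG a b" "adjG a c" "adjG b c" "adjG a d" "adjG b d" "c \<noteq> d"
  shows False
proof (cases "adjG c d")
  case True
  have "icyc [a, b, c]" unfolding icyc_def
    using e adj_commute adj_irrefl by (intro exI[of _ a] exI[of _ "[b, c]"]) auto
  moreover have "d \<notin> set [a, b, c]" "nbs d [a, b, c] = 3" using e True adj_commute[of d] by auto
  ultimately show False using no_wheel3_G[OF free(1)] by blast
next
  case False
  have d: "distinct [a, b, c, d]" using e by auto
  define K :: "'a pair_pre_digraph" where
    "K = \<lparr>pverts = {a, b, c, d}, parcs = {(u, v). u \<in> {a, b, c, d} \<and> v \<in> {a, b, c, d} \<and> u \<noteq> v}\<rparr>"
  have "K\<^bsub>4\<^esub> (with_proj K)" unfolding complete_digraph_pair_def using d by (auto simp: K_def)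
  moreover have "(c, d) \<in> parcs K" using d by (auto simp: K_def)
  moreover have "(u, v) \<in> parcs (induced_on G {a, b, c, d}) \<longleftrightarrow> (u, v) \<in> parcs K - {(c, d), (d, c)}" for u v
    using e(1-5) e(1-5)[THEN adj_sym] d False adj_sym[of d c] adj_irrefl[of u]
    unfolding induced_on_def K_def adjG_def by auto
  then have "parcs (induced_on G {a, b, c, d}) = parcs K - {(c, d), (d, c)}" by (intro set_eqI) auto
  moreover have "pverts (induced_on G {a, b, c, d}) = pverts K" by (simp add: induced_on_def K_def)
  ultimately have "diamond (induced_on G {a, b, c, d})" unfolding diamond_def by blast
  moreover have "{a, b, c, d} \<subseteq> pverts G" using e adjG_verts by blast
  ultimately show False using free_of_induced[OF free(2)] by blast
qed

lemma no_bowtie_G: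
  assumes free: "free_of K4_subdivision G" "free_of diamond G" "free_of bowtie G"
    and e: "adjG v a" "adjG v b" "adjG a b" "adjG v c" "adjG v d" "adjG c d" "{a, b} \<inter> {c, d} = {}"
  shows False
proof -
  have dist: "distinct [v, a, b, c, d]" using e by auto
  note D = no_diamond_G[OF free(1,2)]
  have n: "\<not> adjG a c" "\<not> adjG a d" "\<not> adjG b c" "\<not> adjG b d"
    using D[of v a b c] D[of v a b d] D[of v b a c] D[of v b a d] e dist adj_commute[of b a] by auto
  have n': "\<not> adjG c a" "\<not> adjG d a" "\<not> adjG c b" "\<not> adjG d b" using n adj_sym by blast+
  have "(u, w) \<in> parcs (induced_on G {v, a, b, c, d}) \<longleftrightarrow>
      (u, w) \<in> undirected {(v, a), (a, b), (b, v), (v, c), (c, d), (d, v)}" for u w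
    using e(1-6) e(1-6)[THEN adj_sym] dist n n' adj_irrefl[of u]
    unfolding induced_on_def adjG_def undirected_iff by auto
  then have "parcs (induced_on G {v, a, b, c, d}) = undirected {(v, a), (a, b), (b, v), (v, c), (c, d), (d, v)}"
    by (intro set_eqI) auto
  moreover have "pverts (induced_on G {v, a, b, c, d}) = {v, a, b, c, d}" by (simp add: induced_on_def)
  ultimately have "bowtie (induced_on G {v, a, b, c, d})" unfolding bowtie_def using dist by blast
  moreover have "{v, a, b, c, d} \<subseteq> pverts G" using e adjG_verts by blast
  ultimately show False using free_of_induced[OF free(3)] by blast
qed

end

section \<open>Prisms, and the translation of holes, sectors and proper wheels\<close>

context pair_graph begin

lemma ipath_verts:
  assumes "ipath p" "length p \<ge> 2" shows "set p \<subseteq> pverts G"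
proof -
  have "walk p" using ipath_walk[OF assms(1)] .
  then show ?thesis using assms(2)
  proof (induction p rule: walk.induct)
    case (3 a b p)
    then show ?case using adjG_verts[of a b] by (cases p) auto
  qed auto
qed

lemma no_prism_G:
  assumes free: "free_of prism G"
    and p: "ipath p" "ipath q" "ipath r" "length p \<ge> 2" "length q \<ge> 2" "length r \<ge> 2"
      "set p \<inter> set q = {}" "set p \<inter> set r = {}" "set q \<inter> set r = {}"
      "\<forall>a \<in> set p. \<forall>b \<in> set q. adjG a b \<longleftrightarrow> a = hd p \<and> b = hd q \<or> a = last p \<and> b = last q"
      "\<forall>a \<in> set p. \<forall>b \<in> set r. adjG a b \<longleftrightarrow> a = hd p \<and> b = hd r \<or> a = last p \<and> b = last r"
      "\<forall>a \<in> set q. \<forall>b \<in> set r. adjG a b \<longleftrightarrow> a = hd q \<and> b = hd r \<or> a = last q \<and> b = last r"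
  shows False
proof -
  let ?u = "\<lambda>p. undirected (set (vwalk_arcs p))"
  define X where "X = set p \<union> set q \<union> set r"
  have Xv: "X \<subseteq> pverts G" using ipath_verts p unfolding X_def by blast
  have dist: "distinct (p @ q @ r)" using p ipath_distinct by auto
  have inn: "(u, v) \<in> ?u l \<longleftrightarrow> u \<in> set l \<and> v \<in> set l \<and> adjG u v" if "ipath l" for u v l
    using that vwalk_arcs_verts[of u v l] vwalk_arcs_verts[of v u l] unfolding ipath_iff_arcs undirected_iff by blast
  define T where "T = {(hd p, hd q), (hd q, hd r), (hd r, hd p)} \<union> {(last p, last q), (last q, last r), (last r, last p)}"
  have hl: "hd p \<in> set p" "last p \<in> set p" "hd q \<in> set q" "last q \<in> set q" "hd r \<in> set r" "last r \<in> set r"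
    using p(4-6) by (auto intro!: hd_in_set last_in_set)
  have T: "(u, v) \<in> undirected T \<longleftrightarrow> adjG u v \<and> u \<in> X \<and> v \<in> X \<and>
      \<not> (u \<in> set p \<and> v \<in> set p) \<and> \<not> (u \<in> set q \<and> v \<in> set q) \<and> \<not> (u \<in> set r \<and> v \<in> set r)" for u v
  proof
    assume "(u, v) \<in> undirected T"
    then show "adjG u v \<and> u \<in> X \<and> v \<in> X \<and>
      \<not> (u \<in> set p \<and> v \<in> set p) \<and> \<not> (u \<in> set q \<and> v \<in> set q) \<and> \<not> (u \<in> set r \<and> v \<in> set r)"
      unfolding undirected_iff T_def X_def
      using hl p(7-12) adj_sym by (elim disjE UnE insertE emptyE) (simp_all add: disjoint_iff, (metis hl p(10-12) adj_sym)+)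
  next
    assume R: "adjG u v \<and> u \<in> X \<and> v \<in> X \<and>
      \<not> (u \<in> set p \<and> v \<in> set p) \<and> \<not> (u \<in> set q \<and> v \<in> set q) \<and> \<not> (u \<in> set r \<and> v \<in> set r)"
    then have vu: "adjG v u" using adj_sym by blast
    from R consider "u \<in> set p" "v \<in> set q" | "u \<in> set p" "v \<in> set r" | "u \<in> set q" "v \<in> set r"
      | "v \<in> set p" "u \<in> set q" | "v \<in> set p" "u \<in> set r" | "v \<in> set q" "u \<in> set r"
      unfolding X_def by blast
    then show "(u, v) \<in> undirected T"
    proof cases
      case 1
      then have "u = hd p \<and> v = hd q \<or> u = last p \<and> v = last q"
        using p(10)[rule_format, OF 1] R by blast
      then show ?thesis unfolding undirected_iff T_def by auto
    next
      case 2
      then have "u = hd p \<and> v = hd r \<or> u = last p \<and> v = last r"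
        using p(11)[rule_format, OF 2] R by blast
      then show ?thesis unfolding undirected_iff T_def by auto
    next
      case 3
      then have "u = hd q \<and> v = hd r \<or> u = last q \<and> v = last r"
        using p(12)[rule_format, OF 3] R by blast
      then show ?thesis unfolding undirected_iff T_def by auto
    next
      case 4
      then have "v = hd p \<and> u = hd q \<or> v = last p \<and> u = last q"
        using p(10)[rule_format, OF 4] vu by blast
      then show ?thesis unfolding undirected_iff T_def by auto
    next
      case 5
      then have "v = hd p \<and> u = hd r \<or> v = last p \<and> u = last r"
        using p(11)[rule_format, OF 5] vu by blast
      then show ?thesis unfolding undirected_iff T_def by auto
    next
      case 6
      then have "v = hd q \<and> u = hd r \<or> v = last q \<and> u = last r"
        using p(12)[rule_format, OF 6] vu by blast
      then show ?thesis unfolding undirected_iff T_def by auto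
    qed
  qed
  have "parcs (induced_on G X) = undirected (set (vwalk_arcs p) \<union> set (vwalk_arcs q) \<union> set (vwalk_arcs r) \<union> T)"
  proof (rule set_eqI)
    fix e :: "'a \<times> 'a"
    obtain u v where e: "e = (u, v)" by (cases e)
    have "(u, v) \<in> undirected (set (vwalk_arcs p) \<union> set (vwalk_arcs q) \<union> set (vwalk_arcs r) \<union> T) \<longleftrightarrow>
      (u, v) \<in> ?u p \<or> (u, v) \<in> ?u q \<or> (u, v) \<in> ?u r \<or> (u, v) \<in> undirected T"
      unfolding undirected_Un by blast
    also have "\<dots> \<longleftrightarrow> adjG u v \<and> u \<in> X \<and> v \<in> X"
      unfolding inn[OF p(1)] inn[OF p(2)] inn[OF p(3)] T X_def by blast
    finally show "e \<in> parcs (induced_on G X) \<longleftrightarrow>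
      e \<in> undirected (set (vwalk_arcs p) \<union> set (vwalk_arcs q) \<union> set (vwalk_arcs r) \<union> T)"
      unfolding e induced_on_def adjG_def by simp
  qed
  then have arcs: "parcs (induced_on G X) = undirected
      (set (vwalk_arcs p) \<union> set (vwalk_arcs q) \<union> set (vwalk_arcs r)
       \<union> {(hd p, hd q), (hd q, hd r), (hd r, hd p)} \<union> {(last p, last q), (last q, last r), (last r, last p)})"
    unfolding T_def by (simp only: Un_assoc)
  have verts: "pverts (induced_on G X) = set p \<union> set q \<union> set r" by (simp add: induced_on_def X_def)
  have len: "vwalk_length p \<ge> 1" "vwalk_length q \<ge> 1" "vwalk_length r \<ge> 1" using p(4-6) by simp_all
  have "prism (induced_on G X)"
    unfolding prism_def using dist len verts arcs by blast
  then show False using free_of_induced[OF free Xv] by blast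
qed

lemma forbidden_adjG:
  assumes "free_of K4_subdivision G" "free_of diamond G" "free_of bowtie G" "free_of prism G"
  shows "forbidden adjG"
proof unfold_locales
  show "nbs x H \<noteq> 3" if "icyc H" "x \<notin> set H" for H x
    using no_wheel3_G[OF assms(1) that] .
  show False if "icyc H" "x \<notin> set H" "nbs x H = 2" "t \<in> set H" "\<not> adjG x t" "ipath Z" "Z \<noteq> []"
      "set Z \<inter> set H = {}" "x \<notin> set Z" "\<forall>z \<in> set Z. adjG x z \<longleftrightarrow> z = hd Z"
      "\<forall>z \<in> set Z. \<forall>y \<in> set H. adjG z y \<longleftrightarrow> z = last Z \<and> y = t" for H x t Z
    using no_wheel2_path_G[OF assms(1) that] .
  show False if "adjG a b" "adjG a c" "adjG b c" "adjG a d" "adjG b d" "c \<noteq> d" for a b c d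
    using no_diamond_G[OF assms(1,2) that] .
  show False if "adjG v a" "adjG v b" "adjG a b" "adjG v c" "adjG v d" "adjG c d" "{a, b} \<inter> {c, d} = {}" for v a b c d
    using no_bowtie_G[OF assms(1-3) that] .
qed (rule no_prism_G[OF assms(4)])

lemma hole_icyc:
  assumes "hole G C"
  obtains cs where "icyc cs" "set cs = pverts C" "\<And>u v. (u, v) \<in> parcs C \<longleftrightarrow> adjG u v \<and> u \<in> set cs \<and> v \<in> set cs"
proof -
  obtain cs where cs: "distinct cs" "length cs \<ge> 3" "pverts C = set cs"
    "parcs C = undirected (set (vwalk_arcs (cs @ [hd cs])))"
    using assms unfolding hole_def cycle_graph_def by blast
  have ind: "(u, v) \<in> parcs C \<longleftrightarrow> adjG u v \<and> u \<in> set cs \<and> v \<in> set cs" for u v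
    using assms cs(3) unfolding hole_def induced_subgraph_def adjG_def by auto
  then have "icyc cs" unfolding icyc_iff_arcs using cs by blast
  then show thesis using that cs(3) ind by metis
qed

lemma icyc_hole:
  assumes "icyc cs" "length cs \<ge> 4" shows "hole G (induced_on G (set cs))"
proof -
  let ?A = "undirected (set (vwalk_arcs (cs @ [hd cs])))"
  have c: "distinct cs" "length cs \<ge> 3" "\<And>u v. u \<in> set cs \<Longrightarrow> v \<in> set cs \<Longrightarrow> adjG u v \<longleftrightarrow> (u, v) \<in> ?A"
    using assms(1) unfolding icyc_iff_arcs by blast+
  have "hd cs \<in> set cs" using c(2) by (cases cs) auto
  then have "(u, v) \<in> ?A \<Longrightarrow> u \<in> set cs \<and> v \<in> set cs" for u v
    using vwalk_arcs_verts[of u v "cs @ [hd cs]"] vwalk_arcs_verts[of v u "cs @ [hd cs]"]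
    unfolding undirected_iff by auto
  then have "parcs (induced_on G (set cs)) = ?A"
    using c(3) unfolding induced_on_def adjG_def by auto
  then have "cycle_graph (induced_on G (set cs))"
    unfolding cycle_graph_def using c(1,2) by (intro exI[of _ cs]) (simp add: induced_on_def)
  moreover have "card (pverts (induced_on G (set cs))) \<ge> 4"
    using assms(2) distinct_card[OF c(1)] by (simp add: induced_on_def)
  ultimately show ?thesis using induced_on_induced[OF icyc_verts[OF assms(1)]] unfolding hole_def by blast
qed

lemma walk_iff_arcs: "walk s \<longleftrightarrow> (\<forall>(u, v) \<in> set (vwalk_arcs s). adjG u v)"
  by (induction s rule: walk.induct) auto

lemma nbrs_in_eq: "nbrs_in G v S = {c \<in> S. adjG v c}"
  unfolding nbrs_in_def adjG_def by simp

context
  fixes C :: "'a pair_pre_digraph" and cs :: "'a list" and x :: 'a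
  assumes cyc: "icyc cs" and sC: "set cs = pverts C"
    and aC: "\<And>u v. (u, v) \<in> parcs C \<longleftrightarrow> adjG u v \<and> u \<in> set cs \<and> v \<in> set cs"
    and two: "nbs x cs \<ge> 2"
begin

lemma spokes_eq: "spokes G C x = {c \<in> set cs. adjG x c}"
  unfolding spokes_def nbrs_in_eq sC ..

lemma card_nbrs: "card (nbrs_in G v (pverts C)) = nbs v cs"
  using nbs_card[OF icyc_distinct[OF cyc]] sC unfolding nbrs_in_eq by simp

text \<open>A sector is a path in \<open>C\<close> without a preferred direction, so it may appear
  as an arc of \<open>cs\<close> or of its reversal.\<close>

lemma sector_one_sector:
  assumes "sector G C x s" "T \<subseteq> set s" shows "one_sector x cs T"
proof -
  have s: "set s \<subseteq> set cs" "distinct s" "s \<noteq> []" "set (vwalk_arcs s) \<subseteq> parcs C"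
    "set (butlast (tl s)) \<inter> spokes G C x = {}"
    using assms(1) sC unfolding sector_def vpath_def vwalk_def by auto
  have w: "walk s" unfolding walk_iff_arcs using s(4) aC by auto
  have "set (butlast (tl s)) \<subseteq> set s" by (meson in_set_butlastD list.set_sel(2) s(3) subsetI tl_Nil)
  then have n: "nbs x (butlast (tl s)) = 0" using s(1,5) unfolding spokes_eq nbs_0 by auto
  obtain ds Y where ds: "ds = cs \<or> ds = rev cs" "rot ds (s @ Y)" using walk_in_icyc[OF cyc w s(2,3,1)] by blast
  then have "one_sector x ds T" unfolding one_sector_def using assms(2) n by blast
  then show ?thesis using ds(1) one_sector_rev[of x "rev cs" T] by auto
qed

lemma arc_sector:
  assumes r: "rot cs (xs @ ys)" and ne: "xs \<noteq> []" and n: "nbs x (butlast (tl xs)) = 0"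
  shows "\<exists>s. sector G C x s \<and> set xs \<subseteq> set s"
proof -
  have int: "\<forall>c \<in> set (butlast (tl xs)). \<not> adjG x c" using n by (simp add: nbs_0)
  have two': "2 \<le> length (filter (adjG x) cs)" using two by (simp add: nbs_def)
  obtain a M b R L1 L2 where E: "rot cs (a # M @ b # R)" "adjG x a" "adjG x b"
    "\<forall>c \<in> set M. \<not> adjG x c" "a # M @ [b] = L1 @ xs @ L2"
    by (rule extend_arc[OF r ne int two'])
  let ?s = "a # M @ [b]"
  have sub: "set ?s \<subseteq> set cs" using rot_set[OF E(1)] by auto
  have ic: "icyc (a # M @ b # R)" using icyc_rot[OF E(1) cyc] .
  have w: "walk ?s"
  proof (cases "R = []")
    \<comment> \<open>With nothing outside, the arc is the whole cycle and need not be an induced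
      path, but it is still a walk.\<close>
    case True
    then obtain p where p: "a # M @ [b] = a # p" "p \<noteq> []" by blast
    then have "ipath p" "adjG a (hd p)" using ic True unfolding icyc_def by auto
    then show ?thesis using ipath_walk[of p] p by (cases p) auto
  next
    case False
    then show ?thesis using ipath_walk icyc_arc[of ?s R] ic by simp
  qed
  have d: "distinct ?s" using icyc_distinct[OF ic] by auto
  have "set (vwalk_arcs ?s) \<subseteq> parcs C"
  proof
    fix e assume e: "e \<in> set (vwalk_arcs ?s)"
    obtain u v where uv: "e = (u, v)" by (cases e)
    have "u \<in> set ?s \<and> v \<in> set ?s" using vwalk_arcs_verts e uv by metis
    then show "e \<in> parcs C" using w e uv sub aC unfolding walk_iff_arcs by blast
  qed
  then have "vpath ?s (with_proj C)" unfolding vpath_def vwalk_def using d sub sC by auto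
  moreover have "set (butlast (tl ?s)) \<inter> spokes G C x = {}" using E(4) unfolding spokes_eq by auto
  moreover have "hd ?s \<in> spokes G C x" "last ?s \<in> spokes G C x" using E(2,3) sub unfolding spokes_eq by auto
  ultimately have "sector G C x ?s" unfolding sector_def by simp
  moreover have "set xs \<subseteq> set ?s" unfolding E(5) by auto
  ultimately show ?thesis by blast
qed

lemma one_sector_sector:
  assumes "one_sector x cs T" shows "\<exists>s. sector G C x s \<and> T \<subseteq> set s"
proof -
  obtain xs ys where xs: "rot cs (xs @ ys)" "T \<subseteq> set xs" "nbs x (butlast (tl xs)) = 0"
    using assms unfolding one_sector_def by blast
  show ?thesis
  proof (cases "xs = []")
    case True
    \<comment> \<open>An empty arc cannot be extended to a sector. As \<open>T\<close> is empty in
      this case, the arc of any single vertex serves instead.\<close>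
    have "cs = [hd cs] @ tl cs" using icyc_length[OF cyc] by (cases cs) auto
    then have "\<exists>s. sector G C x s \<and> set [hd cs] \<subseteq> set s"
      using arc_sector[of "[hd cs]" "tl cs"] by (metis butlast.simps(1) list.distinct(1) list.sel(3) nbs_simps(1) rot_refl)
    then show ?thesis using True xs(2) by auto
  next
    case False
    then show ?thesis using arc_sector[OF xs(1) _ xs(3)] xs(2) by blast
  qed
qed

lemma proper_for_iff:
  assumes "v \<noteq> x" "v \<notin> set cs"
  shows "proper_for G C x v \<longleftrightarrow> \<not> improper x cs v"
proof -
  have "(\<exists>s. sector G C x s \<and> nbrs_in G v (pverts C) \<subseteq> set s) \<longleftrightarrow> one_sector x cs {c \<in> set cs. adjG v c}"
    using sector_one_sector one_sector_sector unfolding nbrs_in_eq sC by blast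
  then show ?thesis
    unfolding proper_for_def improper_def card_nbrs wheel_verts_def using assms sC
    by (auto simp: adjG_def)
qed

end

lemma improper_vert:
  assumes "icyc cs" "improper x cs v" shows "v \<in> pverts G"
proof (rule ccontr)
  assume nv: "v \<notin> pverts G"
  then have no: "\<not> adjG v c" for c using adjG_verts by blast
  then have "one_sector x cs {c \<in> set cs. adjG v c}"
    unfolding one_sector_def by (intro exI[of _ "[]"] exI[of _ cs]) auto
  moreover have "nbs v cs = 0" using no by (simp add: nbs_0)
  ultimately show False using assms(2) unfolding improper_def by simp
qed

lemma min_wheel_adjG:
  assumes free: "free_of K4_subdivision G" "free_of diamond G" "free_of bowtie G" "free_of prism G"
    and W: "proper_wheel G C x" and mini: "\<And>C'. proper_wheel G C' x \<Longrightarrow> card (spokes G C x) \<le> card (spokes G C' x)"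
    and cs: "icyc cs" "set cs = pverts C" "\<And>u v. (u, v) \<in> parcs C \<longleftrightarrow> adjG u v \<and> u \<in> set cs \<and> v \<in> set cs"
  shows "min_wheel adjG x cs"
proof -
  interpret F: forbidden adjG using forbidden_adjG[OF free] .
  have w: "wheel G C x" "\<And>v. v \<in> pverts G \<Longrightarrow> proper_for G C x v" using W unfolding proper_wheel_def by auto
  have x: "x \<in> pverts G" "x \<notin> set cs" using w(1) cs(2) unfolding wheel_def by auto
  have n3: "nbs x cs \<ge> 3" using w(1) nbs_card[OF icyc_distinct[OF cs(1)], of x] cs(2) unfolding wheel_def nbrs_in_eq by simp
  then have two: "nbs x cs \<ge> 2" by simp
  show ?thesis
  proof unfold_locales
    show "\<not> improper x cs v" for v
    proof
      assume i: "improper x cs v"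
      then have "v \<noteq> x" "v \<notin> set cs" "v \<in> pverts G" using improper_vert[OF cs(1) i] unfolding improper_def by auto
      then show False using proper_for_iff[OF cs two] w(2) i by blast
    qed
    fix cs' assume c': "icyc cs'" "x \<notin> set cs'" "3 \<le> nbs x cs'" "nbs x cs' < nbs x cs"
    show "\<exists>v. improper x cs' v"
    proof (rule ccontr)
      assume no: "\<not> ?thesis"
      define C' where "C' = induced_on G (set cs')"
      have pC: "set cs' = pverts C'" "\<And>u v. (u, v) \<in> parcs C' \<longleftrightarrow> adjG u v \<and> u \<in> set cs' \<and> v \<in> set cs'"
        unfolding C'_def induced_on_def adjG_def by auto
      have two': "nbs x cs' \<ge> 2" using c'(3) by simp
      \<comment> \<open>Three spokes would be a subdivision of K4; the fourth makes the rim long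
        enough to be a hole.\<close>
      have "nbs x cs' \<ge> 4" using c'(3) F.no_wheel3[OF c'(1,2)] by linarith
      then have "length cs' \<ge> 4" unfolding nbs_def using length_filter_le[of "adjG x" cs'] by linarith
      then have "hole G C'" unfolding C'_def using icyc_hole[OF c'(1)] by blast
      then have "wheel G C' x"
        unfolding wheel_def card_nbrs[OF c'(1) pC two'] using x(1) c'(2,3) pC(1) by auto
      moreover have "proper_for G C' x v" if "v \<in> pverts G" for v
      proof (cases "v = x \<or> v \<in> set cs'")
        case True
        then show ?thesis unfolding proper_for_def wheel_verts_def using pC(1) by auto
      next
        case False
        then show ?thesis using proper_for_iff[OF c'(1) pC two'] no by blast
      qed
      ultimately have "proper_wheel G C' x" unfolding proper_wheel_def by blast
      then have "card (spokes G C x) \<le> card (spokes G C' x)" by (rule mini)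
      then show False
        using card_nbrs[OF cs two, of x] card_nbrs[OF c'(1) pC two', of x] c'(4) unfolding spokes_def by simp
    qed
  qed (use cs x n3 in auto)
qed

end

theorem theorem3p15:
  fixes G C :: "'a pair_pre_digraph" and x :: 'a and P :: "'a list"
  assumes "pair_graph G"
    and "free_of K4_subdivision G" and "free_of diamond G" and "free_of bowtie G"
    and "free_of prism G" and "free_of K33 G"
    and "proper_wheel G C x"
    and "\<And>C'. proper_wheel G C' x \<Longrightarrow> card (spokes G C x) \<le> card (spokes G C' x)"
    and "vpath P (with_proj G)"
    and "set P \<subseteq> pverts G - wheel_verts C x"
    and "card (nbrs_in G x (set P)) \<le> 1"
  shows "(nbrs_in G x (set P) = {} \<longrightarrow>
            (\<exists>S. sector G C x S \<and>
              (\<forall>p \<in> set P. \<forall>c \<in> pverts C. p \<rightarrow>\<^bsub>with_proj G\<^esub> c \<longrightarrow>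
                 p \<in> set S \<or> c \<in> set S)))
       \<and> (card (nbrs_in G x (set P)) = 1 \<longrightarrow>
            (\<exists>S1 S2. sector G C x S1 \<and> sector G C x S2 \<and> set S1 \<inter> set S2 \<noteq> {} \<and>
              (\<forall>p \<in> set P. \<forall>c \<in> pverts C. p \<rightarrow>\<^bsub>with_proj G\<^esub> c \<longrightarrow>
                 p \<in> set S1 \<union> set S2 \<or> c \<in> set S1 \<union> set S2)))"
proof -
  interpret pair_graph G by (fact assms(1))
  have "hole G C" using assms(7) unfolding proper_wheel_def wheel_def by blast
  note hole_icyc[OF this]
  then obtain cs where cs: "icyc cs" "set cs = pverts C"
    "\<And>u v. (u, v) \<in> parcs C \<longleftrightarrow> adjG u v \<and> u \<in> set cs \<and> v \<in> set cs"
    by metis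
  interpret W: min_wheel adjG x cs
    using min_wheel_adjG[OF assms(2-5,7,8) cs] .
  have two: "nbs x cs \<ge> 2" using W.spokes4 by simp
  have dP: "distinct P" and wP: "walk P"
    using assms(9) unfolding vpath_def vwalk_def walk_iff_arcs adjG_def by auto
  have off_wheel: "W.off_wheel P" using assms(10) cs(2) unfolding W.off_wheel_def wheel_verts_def by auto
  have nP: "card (nbrs_in G x (set P)) = nbs x P" unfolding nbrs_in_eq nbs_card[OF dP] ..
  have attD: "c \<in> W.attach P" if "p \<in> set P" "c \<in> pverts C" "p \<rightarrow>\<^bsub>with_proj G\<^esub> c" for p c
    using that cs(2) unfolding W.attach_def adjG_def by auto
  show ?thesis
  proof (intro conjI impI)
    assume "nbrs_in G x (set P) = {}"
    then have "nbs x P = 0" using nP by simp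
    then have "one_sector x cs (W.attach P)" using W.free_walk_one_sector[OF wP off_wheel] by blast
    then obtain S where "sector G C x S" "W.attach P \<subseteq> set S" using one_sector_sector[OF cs two] by blast
    then show "\<exists>S. sector G C x S \<and> (\<forall>p \<in> set P. \<forall>c \<in> pverts C. p \<rightarrow>\<^bsub>with_proj G\<^esub> c \<longrightarrow>
                 p \<in> set S \<or> c \<in> set S)" using attD by blast
  next
    assume "card (nbrs_in G x (set P)) = 1"
    then have "nbs x P = Suc 0" using nP by simp
    then obtain P1 y P2 where y: "P = P1 @ y # P2" "adjG x y" "nbs x P1 = 0" "nbs x P2 = 0"
      by (rule nbs_Suc_first)
    obtain xs ys where xs: "rot cs (xs @ ys)" "W.attach P \<subseteq> set xs" "nbs x (butlast (tl xs)) \<le> 1"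
      using W.walk_two_sectors[OF wP off_wheel dP y(1,3,4,2)] by blast
    have "\<exists>S1 S2. sector G C x S1 \<and> sector G C x S2 \<and> set S1 \<inter> set S2 \<noteq> {} \<and> W.attach P \<subseteq> set S1 \<union> set S2"
    proof (cases "nbs x (butlast (tl xs)) = 0")
      case True
      then have "one_sector x cs (W.attach P)" using xs unfolding one_sector_def by blast
      then obtain S where S: "sector G C x S" "W.attach P \<subseteq> set S" using one_sector_sector[OF cs two] by blast
      then have "set S \<noteq> {}" unfolding sector_def vpath_def vwalk_def by auto
      then show ?thesis using S by (intro exI[of _ S]) simp
    next
      case False
      then have "nbs x (butlast (tl xs)) = Suc 0" using xs(3) by simp
      then obtain U u V where u: "butlast (tl xs) = U @ u # V" "adjG x u" "nbs x U = 0" "nbs x V = 0"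
        by (rule nbs_Suc_first)
      \<comment> \<open>The only inner spoke \<open>u\<close> lies strictly inside
        \<open>xs\<close>. Cutting there gives two arcs that extend to sectors sharing
        \<open>u\<close>.\<close>
      obtain h l where xs': "xs = h # U @ u # V @ [l]"
      proof (cases xs)
        case Nil
        then show ?thesis using u(1) by simp
      next
        case (Cons h t)
        then have "t \<noteq> []" "butlast t = U @ u # V" using u(1) by auto
        then have "t = (U @ u # V) @ [last t]" by (metis append_butlast_last_id)
        then show ?thesis using that[of h "last t"] Cons by simp
      qed
      have r1: "rot cs ((h # U @ [u]) @ V @ l # ys)" using xs(1) xs' by simp
      have r2: "rot cs ((u # V @ [l]) @ ys @ h # U)"
        using rot_trans[OF xs(1)] rotI[of "h # U" "u # V @ l # ys"] xs' by simp
      obtain S1 where S1: "sector G C x S1" "set (h # U @ [u]) \<subseteq> set S1"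
        using arc_sector[OF cs two r1] u(3) by auto
      obtain S2 where S2: "sector G C x S2" "set (u # V @ [l]) \<subseteq> set S2"
        using arc_sector[OF cs two r2] u(4) by auto
      have "u \<in> set S1 \<inter> set S2" using S1(2) S2(2) by auto
      moreover have "W.attach P \<subseteq> set S1 \<union> set S2" using xs(2) S1(2) S2(2) unfolding xs' by auto
      ultimately show ?thesis using S1(1) S2(1) by blast
    qed
    then show "\<exists>S1 S2. sector G C x S1 \<and> sector G C x S2 \<and> set S1 \<inter> set S2 \<noteq> {} \<and>
              (\<forall>p \<in> set P. \<forall>c \<in> pverts C. p \<rightarrow>\<^bsub>with_proj G\<^esub> c \<longrightarrow>
                 p \<in> set S1 \<union> set S2 \<or> c \<in> set S1 \<union> set S2)" using attD by blast
  qed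
qed

end
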